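(* Let $U_-<U_+$ be real numbers and let $D\in C^0([U_-,U_+])$ be nonnegative, with $D^*:=\max D$. Assume there exist $\theta\in{]0,1[}$ and $p\in[1,\infty[$ such that $$\widetilde C_{p,\theta}:=\int_{U_-}^{U_+}\Big(\frac{(U_+-u)^\theta(u-U_-)^\theta}{D(u)}\Big)^{p-1}\,du<\infty .$$ Then the unique and monotone profile $U$ for $D$ and $(U_-,U_+)$ satisfies $U'\in L^p(\mathbb{R})$, namely $$\|U'\|_{L^p(\mathbb{R})}^p\le\widehat C_\theta^{\,p-1}\,\widetilde C_{p,\theta}\quad\text{with}\quad\widehat C_\theta:=\sqrt{\frac{2D^*}{1-\theta}}\;\frac{U_+-U_-}{(U_+-U(0))^\theta(U(0)-U_-)^\theta}.$$ Moreover, with $Q(y)=D(U(y))U'(y)$: if $\int_{U(0)}^{U_+}\frac{D(s)}{U_+-s}\,ds<\infty$, then $$U(y)=U_+\ \text{ for }\ y\ge y_+^*:=\frac{U_+-U(0)}{Q(0)}\int_{U(0)}^{U_+}\frac{D(u)}{U_+-u}\,du>0;$$ and analogously, if $\int_{U_-}^{U(0)}\frac{D(s)}{s-U_-}\,ds<\infty$, then $$U(y)=U_-\ \text{ for }\ y\le y_-^*:=-\frac{U(0)-U_-}{Q(0)}\int_{U_-}^{U(0)}\frac{D(u)}{u-U_-}\,du<0.$$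
   Context: Profile: extend $D$ to a bounded nonnegative continuous function on $\mathbb{R}$ (e.g. by constants), and put $A(u)=\int_{U_-}^uD(s)\,ds$, $\overline u_\pm(y)=U_-$ for $y<0$, $\overline u_\pm(y)=U_+$ for $y>0$. The profile $U$ is the unique function $U\in L^2_{\mathrm{loc}}(\mathbb{R})$ for which there is $v\in H^1(\mathbb{R})$ with $U=\overline u_\pm+v'$ and $$\int_{\mathbb{R}}\Big(A(U(y))\,\psi''(y)-U(y)\big(\tfrac y2\psi(y)\big)'\Big)\,dy=0\quad\text{for all }\psi\in C^2_c(\mathbb{R}),$$ i.e. the weak solution of $(D(U)U')'+\frac y2U'=0$ on $\mathbb{R}$, $U(\pm\infty)=U_\pm$. It exists, is unique, is nondecreasing with values in $[U_-,U_+]$, and does not depend on the chosen extension. The flux $Q$ is the weak derivative of $A\circ U$ (suitable representative); one has $U(0)\in{]U_-,U_+[}$ and $Q(0)>0$. Finiteness of $\widetilde C_{p,\theta}$ includes that the integrand is defined almost everywhere, i.e. $D(u)>0$ for a.e. $u\in[U_-,U_+]$. *)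

theory Defs
  imports "HOL-Analysis.Analysis"
begin

text \<open>
  Functions in Lebesgue and Sobolev spaces are represented by arbitrary Lebesgue measurable
  representatives.
\<close>

definition in_Lp :: "real \<Rightarrow> (real \<Rightarrow> real) \<Rightarrow> bool" where
  "in_Lp p f \<longleftrightarrow> f \<in> borel_measurable lebesgue \<and> integrable lebesgue (\<lambda>x. \<bar>f x\<bar> powr p)"

definition Lp_norm :: "real \<Rightarrow> (real \<Rightarrow> real) \<Rightarrow> real" where
  "Lp_norm p f = (LINT x|lebesgue. \<bar>f x\<bar> powr p) powr (1 / p)"

definition in_Lp_loc :: "real \<Rightarrow> (real \<Rightarrow> real) \<Rightarrow> bool" where
  "in_Lp_loc p f \<longleftrightarrow> f \<in> borel_measurable lebesgue \<and>
     (\<forall>K. compact K \<longrightarrow> set_integrable lebesgue K (\<lambda>x. \<bar>f x\<bar> powr p))"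

text \<open>Compactly supported functions of class \<open>C\<^sup>k\<close> on the real line.\<close>

definition Cc :: "nat \<Rightarrow> (real \<Rightarrow> real) set" where
  "Cc k = {\<psi>. (\<forall>j<k. \<forall>x. (deriv ^^ j) \<psi> field_differentiable at x) \<and>
               continuous_on UNIV ((deriv ^^ k) \<psi>) \<and>
               compact (closure {x. \<psi> x \<noteq> 0})}"

text \<open>
  \<open>g\<close> is a weak derivative of \<open>f\<close>. As is usual in one dimension, the test functions are the
  compactly supported functions of class \<open>C\<^sup>1\<close>.
\<close>

definition weak_deriv :: "(real \<Rightarrow> real) \<Rightarrow> (real \<Rightarrow> real) \<Rightarrow> bool" where
  "weak_deriv f g \<longleftrightarrow> in_Lp_loc 1 f \<and> in_Lp_loc 1 g \<and>
     (\<forall>\<phi>\<in>Cc 1. (LINT x|lebesgue. f x * deriv \<phi> x) = - (LINT x|lebesgue. g x * \<phi> x))"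

text \<open>\<open>v \<in> H\<^sup>1(\<real>)\<close> with weak derivative \<open>w\<close>.\<close>

definition in_H1_with_deriv :: "(real \<Rightarrow> real) \<Rightarrow> (real \<Rightarrow> real) \<Rightarrow> bool" where
  "in_H1_with_deriv v w \<longleftrightarrow> in_Lp 2 v \<and> in_Lp 2 w \<and> weak_deriv v w"

text \<open>The interval integral is oriented, so this is also the intended value for \<open>u < Um\<close>.\<close>

definition primitive :: "real \<Rightarrow> (real \<Rightarrow> real) \<Rightarrow> real \<Rightarrow> real" where
  "primitive Um D u = (LBINT s=Um..u. D s)"

definition step_fun :: "real \<Rightarrow> real \<Rightarrow> real \<Rightarrow> real" where
  "step_fun Um Up y = (if y < 0 then Um else Up)"

definition admissible_extension ::
    "(real \<Rightarrow> real) \<Rightarrow> real \<Rightarrow> real \<Rightarrow> (real \<Rightarrow> real) \<Rightarrow> bool" where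
  "admissible_extension D Um Up E \<longleftrightarrow>
     (\<forall>u\<in>{Um..Up}. E u = D u) \<and> continuous_on UNIV E \<and> bounded (range E) \<and> (\<forall>u. 0 \<le> E u)"

text \<open>
  \<open>U\<close> is a profile for \<open>D\<close> and \<open>(Um, Up)\<close>: a weak solution of
  \<open>(D(U) U')' + y/2 U' = 0\<close> with \<open>U(-\<infinity>) = Um\<close> and \<open>U(\<infinity>) = Up\<close>. Any admissible extension of \<open>D\<close>
  may be used. The integrand of the weak equation is always integrable: \<open>primitive Um E\<close> is
  Lipschitz, so its composition with \<open>U\<close> is locally square integrable, like \<open>U\<close>.
\<close>

definition is_profile ::
    "(real \<Rightarrow> real) \<Rightarrow> real \<Rightarrow> real \<Rightarrow> (real \<Rightarrow> real) \<Rightarrow> bool" where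
  "is_profile D Um Up U \<longleftrightarrow> in_Lp_loc 2 U \<and>
     (\<exists>v w. in_H1_with_deriv v w \<and> (AE y in lebesgue. U y = step_fun Um Up y + w y)) \<and>
     (\<exists>E. admissible_extension D Um Up E \<and>
        (\<forall>\<psi>\<in>Cc 2. (LINT y|lebesgue. primitive Um E (U y) * (deriv ^^ 2) \<psi> y
                                    - U y * deriv (\<lambda>z. z / 2 * \<psi> z) y) = 0))"

text \<open>
  Finiteness of \<open>C_tilde\<close>. Positivity almost everywhere has to be required explicitly because of
  the convention \<open>x / 0 = 0\<close>. With it, the convention \<open>0 powr 0 = 0\<close> (relevant for \<open>p = 1\<close>) only
  matters on a null set.
\<close>

definition C_tilde_integrand ::
    "(real \<Rightarrow> real) \<Rightarrow> real \<Rightarrow> real \<Rightarrow> real \<Rightarrow> real \<Rightarrow> real \<Rightarrow> real" where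
  "C_tilde_integrand D Um Up p \<theta> u =
     (((Up - u) powr \<theta> * (u - Um) powr \<theta>) / D u) powr (p - 1)"

definition C_tilde_finite :: "(real \<Rightarrow> real) \<Rightarrow> real \<Rightarrow> real \<Rightarrow> real \<Rightarrow> real \<Rightarrow> bool" where
  "C_tilde_finite D Um Up p \<theta> \<longleftrightarrow>
     (AE u in lebesgue. u \<in> {Um..Up} \<longrightarrow> 0 < D u) \<and>
     set_integrable lebesgue {Um..Up} (C_tilde_integrand D Um Up p \<theta>)"

definition C_tilde :: "(real \<Rightarrow> real) \<Rightarrow> real \<Rightarrow> real \<Rightarrow> real \<Rightarrow> real \<Rightarrow> real" where
  "C_tilde D Um Up p \<theta> = (LINT u:{Um..Up}|lebesgue. C_tilde_integrand D Um Up p \<theta> u)"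

text \<open>The argument \<open>U0\<close> is the value of the profile at \<open>0\<close>.\<close>

definition C_hat :: "(real \<Rightarrow> real) \<Rightarrow> real \<Rightarrow> real \<Rightarrow> real \<Rightarrow> real \<Rightarrow> real" where
  "C_hat D Um Up \<theta> U0 =
     sqrt (2 * (SUP u\<in>{Um..Up}. D u) / (1 - \<theta>)) *
     ((Up - Um) / ((Up - U0) powr \<theta> * (U0 - Um) powr \<theta>))"

end

theory Submission
  imports Defs
begin

text \<open>
  Write \<open>A\<close> for the primitive of the extended \<open>D\<close>, and let \<open>X\<close> be the primitive of \<open>U\<close> that is
  asymptotic to \<open>Um y\<close> at \<open>-\<infinity>\<close> and to \<open>Up y\<close> at \<open>\<infinity>\<close>; it is \<open>y\<close> times the step function plus
  \<open>v\<close>, with \<open>v\<close> from the definition of the profile. Integrating the weak equation twice (the lemma of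
  du Bois-Reymond) turns it into the pointwise identity \<open>A (U y) = c + Z y - y X y / 2\<close> with
  \<open>Z' = X\<close>. Equivalently, the flux is \<open>(A \<circ> U)' = (X - y U) / 2\<close>.
  
  \<^bold>\<open>Monotonicity.\<close> The identity is the Euler-Lagrange equation of a convex functional of \<open>X\<close>.
  Testing it with the difference \<open>h\<close> of \<open>X\<close> and a line of intercept \<open>q\<close> on an interval at whose ends
  \<open>h\<close> vanishes gives \<open>\<integral> (3/4 h\<^sup>2 + q/2 h) \<le> 0\<close> (\<open>energy_inequality\<close>), because \<open>A\<close> is monotone. Hence
  \<open>X\<close> coincides with every chord on which \<open>q h \<ge> 0\<close>. Applied to rays through the origin, and to the two asymptotes,
  this shows that \<open>X 0 > 0\<close>, that \<open>X\<close> lies above both asymptotes and that \<open>X y / y\<close> decreases on each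
  half line. A chord with negative intercept would contradict the last two facts, so \<open>X\<close> exceeds no chord at all: it is
  convex (\<open>X_convex\<close>), with slopes in \<open>[Um, Up]\<close>. On \<open>[Um, Up]\<close> the function \<open>A\<close> is a homeomorphism onto its
  image, so \<open>U\<close> has a continuous representative \<open>V\<close>, and \<open>V = X'\<close> is nondecreasing.
  
  \<^bold>\<open>The derivative.\<close> Substituting \<open>w = A u\<close> and \<open>w = A (V y)\<close> in the same integral shows that the
  image of \<open>Q dy\<close> under \<open>V\<close> is \<open>D du\<close> (\<open>change_of_variables\<close>). With density \<open>1 / D\<close> this gives that \<open>V\<close>
  is absolutely continuous with derivative \<open>Q / D(V)\<close>; with a power as density it gives
  \<open>\<integral> |V'|\<^sup>p \<le> C\<^sup>p\<^sup>-\<^sup>1 \<integral> ((Up - u)\<^sup>\<theta> (u - Um)\<^sup>\<theta> / D)\<^sup>p\<^sup>-\<^sup>1 du\<close> as soon as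
  \<open>Q \<le> C (Up - V)\<^sup>\<theta> (V - Um)\<^sup>\<theta>\<close>.
  
  \<^bold>\<open>The flux bound.\<close> By reflection it suffices to consider \<open>y \<ge> 0\<close>. There \<open>Q' = - y/2 V'\<close>, and \<open>Q \<le> D\<^sup>* V'\<close>
  yields the Gaussian decay \<open>Q y \<le> Q 0 exp (- y\<^sup>2 / (4 D\<^sup>*))\<close>. Comparing \<open>Q y\<close> with the value at the
  point where the Gaussian has fallen to \<open>Q y / 2\<close> bounds \<open>Q y\<close> by \<open>Up - V y\<close> times the square root of a logarithm,
  which a geometric mean with the bound \<open>2 (Q 0)\<^sup>2 \<le> D\<^sup>* (Up - V 0)\<^sup>2\<close> turns into the required power
  (\<open>flux_bound_by_right_gap\<close>).
  
  \<^bold>\<open>Extinction.\<close> As a function of \<open>u = V y\<close> the flux is concave, so it lies above its chord: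
  \<open>Q y \<ge> Q 0 (Up - V y) / (Up - V 0)\<close>. Dividing by \<open>Up - V\<close> and changing variables bounds every \<open>y\<close>
  with \<open>V y < Up\<close> by \<open>y\<^sub>+\<^sup>*\<close>.
\<close>

section \<open>Absolutely continuous functions\<close>

text \<open>
  Local absolute continuity, in the form of the fundamental theorem of calculus: an equation between integrals over all
  compact intervals is what every later argument uses, and it makes the derivative a class of functions
  modulo null sets.
\<close>

definition has_ac_deriv :: "(real \<Rightarrow> real) \<Rightarrow> (real \<Rightarrow> real) \<Rightarrow> bool" where
  "has_ac_deriv f f' \<longleftrightarrow>
     (\<forall>a b. a \<le> b \<longrightarrow> f' absolutely_integrable_on {a..b} \<and> integral {a..b} f' = f b - f a)"

lemma has_ac_derivD:
  assumes "has_ac_deriv f f'" "a \<le> b"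
  shows "f' absolutely_integrable_on {a..b}" "integral {a..b} f' = f b - f a"
    "(f' has_integral (f b - f a)) {a..b}"
proof -
  show 1: "f' absolutely_integrable_on {a..b}" and 2: "integral {a..b} f' = f b - f a"
    using assms by (auto simp: has_ac_deriv_def)
  show "(f' has_integral (f b - f a)) {a..b}"
    using set_lebesgue_integral_eq_integral(1)[OF 1] 2 by (metis integrable_integral)
qed

lemma has_ac_derivI:
  assumes "\<And>a b. a \<le> b \<Longrightarrow> f' absolutely_integrable_on {a..b}"
    and "\<And>a b. a \<le> b \<Longrightarrow> (f' has_integral (f b - f a)) {a..b}"
  shows "has_ac_deriv f f'"
  using assms by (auto simp: has_ac_deriv_def integral_unique)

lemma has_ac_deriv_C1:
  assumes "\<And>x. (f has_real_derivative f' x) (at x)" "continuous_on UNIV f'"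
  shows "has_ac_deriv f f'"
proof (rule has_ac_derivI)
  fix a b :: real assume "a \<le> b"
  show "f' absolutely_integrable_on {a..b}"
    by (meson absolutely_integrable_continuous_real assms(2) continuous_on_subset subset_UNIV)
  show "(f' has_integral (f b - f a)) {a..b}"
    using \<open>a \<le> b\<close> assms(1)
    by (intro fundamental_theorem_of_calculus)
      (auto intro: has_field_derivative_at_within simp flip: has_real_derivative_iff_has_vector_derivative)
qed

lemma has_ac_deriv_add:
  assumes "has_ac_deriv f f'" "has_ac_deriv g g'"
  shows "has_ac_deriv (\<lambda>x. f x + g x) (\<lambda>x. f' x + g' x)"
proof (rule has_ac_derivI)
  fix a b :: real assume ab: "a \<le> b"
  show "(\<lambda>x. f' x + g' x) absolutely_integrable_on {a..b}"
    using has_ac_derivD(1)[OF assms(1) ab] has_ac_derivD(1)[OF assms(2) ab] by simp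
  show "((\<lambda>x. f' x + g' x) has_integral (f b + g b - (f a + g a))) {a..b}"
    using has_integral_add[OF has_ac_derivD(3)[OF assms(1) ab] has_ac_derivD(3)[OF assms(2) ab]]
    by (simp add: algebra_simps)
qed

lemma has_ac_deriv_cmult:
  assumes "has_ac_deriv f f'"
  shows "has_ac_deriv (\<lambda>x. c * f x) (\<lambda>x. c * f' x)"
proof (rule has_ac_derivI)
  fix a b :: real assume ab: "a \<le> b"
  show "(\<lambda>x. c * f' x) absolutely_integrable_on {a..b}"
    using has_ac_derivD(1)[OF assms(1) ab] by simp
  show "((\<lambda>x. c * f' x) has_integral (c * f b - c * f a)) {a..b}"
    using has_integral_mult_right[OF has_ac_derivD(3)[OF assms(1) ab], of c]
    by (simp add: algebra_simps)
qed

lemma has_ac_deriv_diff: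
  assumes "has_ac_deriv f f'" "has_ac_deriv g g'"
  shows "has_ac_deriv (\<lambda>x. f x - g x) (\<lambda>x. f' x - g' x)"
  using has_ac_deriv_add[OF assms(1) has_ac_deriv_cmult[OF assms(2), of "-1"]] by simp

lemma has_ac_deriv_const: "has_ac_deriv (\<lambda>x. c) (\<lambda>x. 0)"
  by (rule has_ac_deriv_C1) auto

lemma has_ac_deriv_ident: "has_ac_deriv (\<lambda>x. x) (\<lambda>x. 1)"
  by (rule has_ac_deriv_C1) auto

lemma has_ac_deriv_cong:
  assumes "has_ac_deriv f f'" "\<And>x. f x = g x" "AE x in lebesgue. f' x = g' x"
  shows "has_ac_deriv g g'"
proof -
  have "negligible {x. f' x \<noteq> g' x}"
    using assms(3) by (simp add: AE_iff_null_sets eventually_ae_filter negligible_iff_null_sets)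
      (metis (mono_tags, lifting) mem_Collect_eq negligible_iff_null_sets negligible_subset subsetI)
  note N = this
  show ?thesis
  proof (rule has_ac_derivI)
    fix a b :: real assume ab: "a \<le> b"
    show "g' absolutely_integrable_on {a..b}"
      by (rule absolutely_integrable_spike[OF has_ac_derivD(1)[OF assms(1) ab] N]) auto
    show "(g' has_integral (g b - g a)) {a..b}"
      using has_integral_spike[OF N _ has_ac_derivD(3)[OF assms(1) ab], of g'] assms(2) by auto
  qed
qed

lemma has_ac_deriv_reflect:
  assumes "has_ac_deriv f f'"
  shows "has_ac_deriv (\<lambda>x. f (- x)) (\<lambda>x. - f' (- x))"
proof (rule has_ac_derivI)
  fix a b :: real assume ab: "a \<le> b"
  have "(\<lambda>x. f' (- x)) absolutely_integrable_on {a..b}"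
    using has_ac_derivD(1)[OF assms, of "-b" "-a"] ab
      absolutely_integrable_reflect_real[where f = f' and a = "-b" and b = "-a"] by (simp del: absolutely_integrable_reflect_real)
  thus "(\<lambda>x. - f' (- x)) absolutely_integrable_on {a..b}"
    using absolutely_integrable_on_scaleR_iff[where c = "-1" and f = "\<lambda>x. f' (- x)" and S = "{a..b}"] by simp
  have "((\<lambda>x. f' (- x)) has_integral (f (- a) - f (- b))) {a..b}"
    using has_ac_derivD(3)[OF assms, of "-b" "-a"] ab
      has_integral_reflect_real[where f = f' and i = "f (-a) - f (-b)" and a = "-b" and b = "-a"] by (simp del: has_integral_reflect_real)
  from has_integral_neg[OF this]
  show "((\<lambda>x. - f' (- x)) has_integral (f (- b) - f (- a))) {a..b}" by simp
qed

lemma has_ac_deriv_continuous: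
  assumes "has_ac_deriv f f'"
  shows "continuous_on UNIV f"
proof -
  have "continuous_on {a..b} f" if "a \<le> b" for a b
  proof -
    have "continuous_on {a..b} (\<lambda>x. integral {a..x} f')"
      using has_ac_derivD(3)[OF assms that] by (intro indefinite_integral_continuous_1) auto
    hence "continuous_on {a..b} (\<lambda>x. integral {a..x} f' + f a)"
      by (intro continuous_intros)
    moreover have "integral {a..x} f' + f a = f x" if "x \<in> {a..b}" for x
      using has_ac_derivD(2)[OF assms, of a x] that by auto
    ultimately show ?thesis
      using continuous_on_cong[of "{a..b}" "{a..b}" "\<lambda>x. integral {a..x} f' + f a" f] by blast
  qed
  have "isCont f x" for x
    using \<open>\<And>a b. a \<le> b \<Longrightarrow> continuous_on {a..b} f\<close>[of "x - 1" "x + 1"] by (intro continuous_on_interior[of "{x-1..x+1}"]) auto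
  thus ?thesis by (simp add: continuous_at_imp_continuous_on)
qed

lemma has_ac_deriv_mono:
  assumes "has_ac_deriv f f'" "a \<le> b" "AE x in lebesgue. x \<in> {a..b} \<longrightarrow> 0 \<le> f' x"
  shows "f a \<le> f b"
proof -
  have "0 \<le> (LINT x:{a..b}|lebesgue. f' x)"
    unfolding set_lebesgue_integral_def using assms(3)
    by (intro integral_nonneg_AE) (auto elim!: eventually_mono simp: indicator_def)
  also have "\<dots> = f b - f a"
    using has_ac_derivD[OF assms(1,2)] by (simp add: set_lebesgue_integral_eq_integral)
  finally show ?thesis by simp
qed

text \<open>
  The product of two integrals is an integral over the plane, which the diagonal cuts into two halves. This is
  the product rule for two indefinite integrals vanishing at \<open>-\<infinity>\<close>.
\<close>

lemma integral_mult_split_diagonal: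
  fixes F G :: "real \<Rightarrow> real"
  assumes F: "integrable lborel F" and G: "integrable lborel G"
  shows "(LINT x|lborel. F x) * (LINT x|lborel. G x) =
     (LINT x|lborel. F x * (LINT t|lborel. G t * indicator {..x} t)) +
     (LINT x|lborel. G x * (LINT t|lborel. F t * indicator {..x} t))"
    "integrable lborel (\<lambda>x. F x * (LINT t|lborel. G t * indicator {..x} t))"
proof -
  have [measurable]: "F \<in> borel_measurable borel" "G \<in> borel_measurable borel"
    using F G by auto
  have prod: "integrable (lborel \<Otimes>\<^sub>M lborel) (\<lambda>(x, t). F x * G t)"
  proof (rule lborel_pair.Fubini_integrable)
    show "integrable lborel (\<lambda>x. LINT y|lborel. norm (case (x, y) of (x, t) \<Rightarrow> F x * G t))"
      using F G by (simp add: abs_mult)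
  qed (use G in auto)
  have low: "integrable (lborel \<Otimes>\<^sub>M lborel) (\<lambda>(x, t). F x * (G t * indicator {..x} t))"
    by (rule Bochner_Integration.integrable_bound[OF prod])
      (auto simp: indicator_def split: prod.splits)
  have up: "integrable (lborel \<Otimes>\<^sub>M lborel) (\<lambda>(x, t). F x * (G t * indicator {x<..} t))"
    by (rule Bochner_Integration.integrable_bound[OF prod])
      (auto simp: indicator_def split: prod.splits)
  have "(LINT x|lborel. F x) * (LINT x|lborel. G x) = (LINT x|lborel. LINT t|lborel. F x * G t)"
    using F G by simp
  also have "\<dots> = integral\<^sup>L (lborel \<Otimes>\<^sub>M lborel) (\<lambda>(x, t). F x * G t)"
    using lborel_pair.integral_fst[OF prod] by simp
  also have "\<dots> = integral\<^sup>L (lborel \<Otimes>\<^sub>M lborel)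
      (\<lambda>p. (case p of (x, t) \<Rightarrow> F x * (G t * indicator {..x} t)) +
           (case p of (x, t) \<Rightarrow> F x * (G t * indicator {x<..} t)))"
    by (intro Bochner_Integration.integral_cong) (auto simp: indicator_def split: prod.splits)
  also have "\<dots> = integral\<^sup>L (lborel \<Otimes>\<^sub>M lborel) (\<lambda>(x, t). F x * (G t * indicator {..x} t)) +
      integral\<^sup>L (lborel \<Otimes>\<^sub>M lborel) (\<lambda>(x, t). F x * (G t * indicator {x<..} t))"
    by (rule Bochner_Integration.integral_add[OF low up])
  also have "integral\<^sup>L (lborel \<Otimes>\<^sub>M lborel) (\<lambda>(x, t). F x * (G t * indicator {..x} t)) =
      (LINT x|lborel. F x * (LINT t|lborel. G t * indicator {..x} t))"
    using lborel_pair.integral_fst[OF low] by simp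
  also have "integral\<^sup>L (lborel \<Otimes>\<^sub>M lborel) (\<lambda>(x, t). F x * (G t * indicator {x<..} t)) =
      (LINT t|lborel. LINT x|lborel. F x * (G t * indicator {x<..} t))"
    using lborel_pair.integral_snd[OF up] by simp
  also have "\<dots> = (LINT t|lborel. G t * (LINT x|lborel. F x * indicator {..t} x))"
  proof (intro Bochner_Integration.integral_cong refl)
    fix t
    have "(LINT x|lborel. F x * (G t * indicator {x<..} t)) =
        (LINT x|lborel. G t * (F x * indicator {..<t} x))"
      by (intro Bochner_Integration.integral_cong) (auto simp: indicator_def)
    also have "\<dots> = G t * (LINT x|lborel. F x * indicator {..<t} x)"
      by simp
    also have "(LINT x|lborel. F x * indicator {..<t} x) = (LINT x|lborel. F x * indicator {..t} x)"
    proof (rule integral_cong_AE)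
      show "AE x in lborel. F x * indicat_real {..<t} x = F x * indicat_real {..t} x"
        using AE_lborel_singleton[of t] by eventually_elim (simp add: indicator_def)
    qed simp_all
    finally show "(LINT x|lborel. F x * (G t * indicator {x<..} t)) =
        G t * (LINT x|lborel. F x * indicator {..t} x)" .
  qed
  finally show "(LINT x|lborel. F x) * (LINT x|lborel. G x) =
     (LINT x|lborel. F x * (LINT t|lborel. G t * indicator {..x} t)) +
     (LINT x|lborel. G x * (LINT t|lborel. F t * indicator {..x} t))" .
  show "integrable lborel (\<lambda>x. F x * (LINT t|lborel. G t * indicator {..x} t))"
    using lborel_pair.integrable_fst[OF low] by simp
qed

text \<open>
  Fubini's theorem needs measurability with respect to the product of two Lebesgue-Borel measures, so a merely Lebesgue
  measurable derivative is first replaced by a Borel one.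
\<close>

lemma locally_abs_integrable_borel_version:
  fixes f' :: "real \<Rightarrow> real"
  assumes "f' absolutely_integrable_on {a..b}"
  obtains F where "integrable lborel F" "\<And>x. x \<notin> {a..b} \<Longrightarrow> F x = 0"
    "AE x in lebesgue. x \<in> {a..b} \<longrightarrow> F x = f' x"
    "\<And>x. x \<in> {a..b} \<Longrightarrow> (LINT t|lborel. F t * indicator {..x} t) = integral {a..x} f'"
    "(LINT t|lborel. F t) = integral {a..b} f'"
proof -
  have int: "integrable lebesgue (\<lambda>x. indicator {a..b} x * f' x)"
    using assms by (simp add: set_integrable_def)
  then obtain G where G[measurable]: "G \<in> borel_measurable lborel"
      and GE: "AE x in lborel. indicator {a..b} x * f' x = G x"
    using completion_ex_borel_measurable_real[of "\<lambda>x. indicator {a..b} x * f' x" lborel] by auto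
  define F where "F x = indicator {a..b} x * G x" for x
  have [measurable]: "F \<in> borel_measurable borel"
    unfolding F_def using G by simp
  have FE: "AE x in lebesgue. F x = indicator {a..b} x * f' x"
    using AE_completion[OF GE]
  proof eventually_elim
    fix x assume "indicator {a..b} x * f' x = G x"
    thus "F x = indicator {a..b} x * f' x"
      by (cases "x \<in> {a..b}") (simp_all add: F_def)
  qed
  have "integrable lebesgue F"
    by (rule Bochner_Integration.integrable_cong_AE_imp[OF int]) (use FE in \<open>auto simp: eq_commute intro: measurable_completion\<close>)
  hence F: "integrable lborel F"
    by (subst (asm) integrable_completion) auto
  have I: "(LINT t|lborel. F t * indicator S t) = integral ({a..b} \<inter> S) f'" if S[measurable]: "S \<in> sets borel" "{a..b} \<inter> S = {a..c}" for S c
  proof -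
    have sub: "f' absolutely_integrable_on {a..c}"
      by (rule set_integrable_subset[OF assms]) (use that(2) in \<open>auto simp: set_eq_iff\<close>)
    have "(LINT t|lborel. F t * indicator S t) = (LINT t|lebesgue. F t * indicator S t)"
      by (rule integral_completion[symmetric]) simp
    also have "\<dots> = (LINT t|lebesgue. indicator {a..c} t * f' t)"
    proof (rule integral_cong_AE)
      show "(\<lambda>t. F t * indicator S t) \<in> borel_measurable lebesgue"
        by (rule measurable_completion) simp
      show "(\<lambda>t. indicat_real {a..c} t * f' t) \<in> borel_measurable lebesgue"
        using borel_measurable_integrable[OF sub[unfolded set_integrable_def]] by simp
      show "AE x in lebesgue. F x * indicat_real S x = indicat_real {a..c} x * f' x"
        using FE
      proof eventually_elim
        fix x assume "F x = indicator {a..b} x * f' x"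
        moreover have "x \<in> {a..b} \<and> x \<in> S \<longleftrightarrow> x \<in> {a..c}" using that(2) by blast
        ultimately show "F x * indicat_real S x = indicat_real {a..c} x * f' x"
          by (auto simp: indicator_def)
      qed
    qed
    also have "\<dots> = integral {a..c} f'"
      using set_lebesgue_integral_eq_integral(2)[OF sub] by (simp add: set_lebesgue_integral_def)
    finally show ?thesis using that by simp
  qed
  show thesis
  proof (rule that[of F, OF F])
    show "F x = 0" if "x \<notin> {a..b}" for x using that by (simp add: F_def)
    show "AE x in lebesgue. x \<in> {a..b} \<longrightarrow> F x = f' x"
      using FE by eventually_elim auto
    show "(LINT t|lborel. F t * indicator {..x} t) = integral {a..x} f'" if "x \<in> {a..b}" for x
    proof -
      have eq: "{a..b} \<inter> {..x} = {a..x}" using that by auto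
      have "(LINT t|lborel. F t * indicator {..x} t) = integral ({a..b} \<inter> {..x}) f'"
        by (rule I[OF _ eq]) simp
      thus ?thesis by (simp only: eq)
    qed
    show "(LINT t|lborel. F t) = integral {a..b} f'"
      using I[of UNIV b] by simp
  qed
qed

lemma absolutely_integrable_mult_continuous:
  fixes f g :: "real \<Rightarrow> real"
  assumes "f absolutely_integrable_on {a..b}" "continuous_on {a..b} g"
  shows "(\<lambda>x. f x * g x) absolutely_integrable_on {a..b}"
proof -
  have "(\<lambda>x. g x * f x) absolutely_integrable_on {a..b}"
  proof (rule absolutely_integrable_bounded_measurable_product_real[OF _ _ _ assms(1)])
    show "g \<in> borel_measurable (lebesgue_on {a..b})"
      using assms(2) by (intro continuous_imp_measurable_on_sets_lebesgue) auto
    show "bounded (g ` {a..b})"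
      using assms(2) by (intro compact_imp_bounded compact_continuous_image) auto
  qed auto
  thus ?thesis by (simp add: mult.commute)
qed

lemma has_ac_deriv_mult:
  assumes f: "has_ac_deriv f f'" and g: "has_ac_deriv g g'"
  shows "has_ac_deriv (\<lambda>x. f x * g x) (\<lambda>x. f' x * g x + f x * g' x)"
proof -
  have cf: "continuous_on S f" and cg: "continuous_on S g" for S
    using has_ac_deriv_continuous[OF f] has_ac_deriv_continuous[OF g]
    by (auto intro: continuous_on_subset)
  have half: "(LINT x|lborel. F x * (LINT t|lborel. G t * indicator {..x} t)) =
      integral {a..b} (\<lambda>x. f' x * g x) - (f b - f a) * g a"
    if ab: "a \<le> b" and f: "has_ac_deriv f f'" and g: "has_ac_deriv g g'"
      and F: "integrable lborel F" "\<And>x. x \<notin> {a..b} \<Longrightarrow> F x = 0" "AE x in lebesgue. x \<in> {a..b} \<longrightarrow> F x = f' x"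
      and G: "integrable lborel G"
        "\<And>x. x \<in> {a..b} \<Longrightarrow> (LINT t|lborel. G t * indicator {..x} t) = integral {a..x} g'"
    for F G a b f f' g g'
  proof -
    have cg: "continuous_on {a..b} g"
      using has_ac_deriv_continuous[OF g] by (rule continuous_on_subset) auto
    have i1: "(\<lambda>x. f' x * (g x - g a)) absolutely_integrable_on {a..b}"
      by (intro absolutely_integrable_mult_continuous has_ac_derivD(1)[OF f ab] continuous_intros cg)
    have i2: "(\<lambda>x. f' x * g x) absolutely_integrable_on {a..b}"
      by (intro absolutely_integrable_mult_continuous has_ac_derivD(1)[OF f ab] cg)
    note prod = integral_mult_split_diagonal(2)[OF F(1) G(1)]
    have "(LINT x|lborel. F x * (LINT t|lborel. G t * indicator {..x} t)) =
        (LINT x|lebesgue. F x * (LINT t|lborel. G t * indicator {..x} t))"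
      by (rule integral_completion[symmetric]) (use borel_measurable_integrable[OF prod] in simp)
    also have "\<dots> = (LINT x:{a..b}|lebesgue. f' x * (g x - g a))"
      unfolding set_lebesgue_integral_def
    proof (rule integral_cong_AE)
      show "(\<lambda>x. F x * (LINT t|lborel. G t * indicator {..x} t)) \<in> borel_measurable lebesgue"
        using measurable_completion[OF borel_measurable_integrable[OF prod]] by simp
      show "(\<lambda>x. indicat_real {a..b} x *\<^sub>R (f' x * (g x - g a))) \<in> borel_measurable lebesgue"
        using borel_measurable_integrable[OF i1[unfolded set_integrable_def]] .
      show "AE x in lebesgue. F x * (LINT t|lborel. G t * indicator {..x} t) =
          indicat_real {a..b} x *\<^sub>R (f' x * (g x - g a))"
        using F(3)
      proof eventually_elim
        fix x assume "x \<in> {a..b} \<longrightarrow> F x = f' x"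
        thus "F x * (LINT t|lborel. G t * indicator {..x} t) =
            indicat_real {a..b} x *\<^sub>R (f' x * (g x - g a))"
          using F(2)[of x] G(2)[of x] has_ac_derivD(2)[OF g, of a x]
          by (cases "x \<in> {a..b}") simp_all
      qed
    qed
    also have "\<dots> = integral {a..b} (\<lambda>x. f' x * (g x - g a))"
      by (rule set_lebesgue_integral_eq_integral(2)[OF i1])
    also have "\<dots> = integral {a..b} (\<lambda>x. f' x * g x - f' x * g a)"
      by (simp add: algebra_simps)
    also have "\<dots> = integral {a..b} (\<lambda>x. f' x * g x) - integral {a..b} (\<lambda>x. f' x * g a)"
      using set_lebesgue_integral_eq_integral(1)[OF i2] has_ac_derivD(3)[OF f ab]
      by (intro integral_diff integrable_on_mult_left) auto
    also have "integral {a..b} (\<lambda>x. f' x * g a) = (f b - f a) * g a"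
      using has_ac_derivD(2)[OF f ab] by simp
    finally show ?thesis .
  qed
  show ?thesis
  proof (rule has_ac_derivI)
    fix a b :: real assume ab: "a \<le> b"
    have i1: "(\<lambda>x. f' x * g x) absolutely_integrable_on {a..b}"
      by (intro absolutely_integrable_mult_continuous has_ac_derivD(1)[OF f ab] cg)
    have i2: "(\<lambda>x. g' x * f x) absolutely_integrable_on {a..b}"
      by (intro absolutely_integrable_mult_continuous has_ac_derivD(1)[OF g ab] cf)
    show i: "(\<lambda>x. f' x * g x + f x * g' x) absolutely_integrable_on {a..b}"
      using set_integral_add(1)[OF i1 i2] by (simp add: mult.commute)
    obtain F where F: "integrable lborel F" "\<And>x. x \<notin> {a..b} \<Longrightarrow> F x = 0"
      "AE x in lebesgue. x \<in> {a..b} \<longrightarrow> F x = f' x"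
      "\<And>x. x \<in> {a..b} \<Longrightarrow> (LINT t|lborel. F t * indicator {..x} t) = integral {a..x} f'"
      "(LINT t|lborel. F t) = integral {a..b} f'"
      using locally_abs_integrable_borel_version[OF has_ac_derivD(1)[OF f ab]] by blast
    obtain G where G: "integrable lborel G" "\<And>x. x \<notin> {a..b} \<Longrightarrow> G x = 0"
      "AE x in lebesgue. x \<in> {a..b} \<longrightarrow> G x = g' x"
      "\<And>x. x \<in> {a..b} \<Longrightarrow> (LINT t|lborel. G t * indicator {..x} t) = integral {a..x} g'"
      "(LINT t|lborel. G t) = integral {a..b} g'"
      using locally_abs_integrable_borel_version[OF has_ac_derivD(1)[OF g ab]] by blast
    have "(f b - f a) * (g b - g a) =
        (integral {a..b} (\<lambda>x. f' x * g x) - (f b - f a) * g a) +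
        (integral {a..b} (\<lambda>x. g' x * f x) - (g b - g a) * f a)"
      using integral_mult_split_diagonal(1)[OF F(1) G(1)]
        half[OF ab f g F(1-3) G(1,4)] half[OF ab g f G(1-3) F(1,4)]
        has_ac_derivD(2)[OF f ab] has_ac_derivD(2)[OF g ab] F(5) G(5)
      by simp
    hence "integral {a..b} (\<lambda>x. f' x * g x) + integral {a..b} (\<lambda>x. g' x * f x) =
        f b * g b - f a * g a"
      by (simp add: algebra_simps)
    hence "integral {a..b} (\<lambda>x. f' x * g x + g' x * f x) = f b * g b - f a * g a"
      using set_lebesgue_integral_eq_integral(1)[OF i1] set_lebesgue_integral_eq_integral(1)[OF i2]
      by (simp add: integral_add)
    thus "((\<lambda>x. f' x * g x + f x * g' x) has_integral (f b * g b - f a * g a)) {a..b}"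
      using set_lebesgue_integral_eq_integral(1)[OF i]
      by (metis (no_types, lifting) integrable_integral integral_cong mult.commute)
  qed
qed

text \<open>
  At almost every point an integrable function is the limit of its averages over shrinking intervals.
\<close>

lemma AE_nonneg_if_interval_integrals_nonneg:
  fixes f :: "real \<Rightarrow> real"
  assumes int: "\<And>a b. a \<le> b \<Longrightarrow> f absolutely_integrable_on {a..b}"
    and nn: "\<And>a b. a \<le> b \<Longrightarrow> 0 \<le> integral {a..b} f"
  shows "AE x in lebesgue. 0 \<le> f x"
proof -
  have "f integrable_on cbox a b" for a b
    using int[of a b] by (cases "a \<le> b") (auto dest: set_lebesgue_integral_eq_integral(1))
  then obtain N where N: "negligible N" "\<And>x e. \<lbrakk>x \<notin> N; 0 < e\<rbrakk> \<Longrightarrow>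
      \<exists>d>0. \<forall>h. 0 < h \<and> h < d \<longrightarrow>
        norm (integral (cbox x (x + h *\<^sub>R One)) f /\<^sub>R h ^ DIM(real) - f x) < e"
    using integrable_ccontinuous_explicit[of f] by blast
  have "0 \<le> f x" if xN: "x \<notin> N" for x
  proof (rule ccontr)
    assume "\<not> 0 \<le> f x"
    then obtain d where d: "d > 0" "\<And>h. 0 < h \<Longrightarrow> h < d \<Longrightarrow>
        \<bar>integral {x..x+h} f / h - f x\<bar> < - f x"
      using N(2)[OF xN, of "- f x"] by (auto simp: divide_inverse mult.commute)
    have "integral {x..x+d/2} f / (d/2) < 0" using d(2)[of "d/2"] \<open>d > 0\<close> by linarith
    moreover have "0 \<le> integral {x..x+d/2} f / (d/2)"
      using nn[of x "x + d/2"] \<open>d > 0\<close> by simp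
    ultimately show False by linarith
  qed
  moreover have "AE x in lebesgue. x \<notin> N"
    using N(1) by (simp add: AE_not_in negligible_iff_null_sets)
  ultimately show ?thesis by (auto elim: eventually_mono)
qed

lemma AE_zero_if_interval_integrals_zero:
  fixes f :: "real \<Rightarrow> real"
  assumes int: "\<And>a b. a \<le> b \<Longrightarrow> f absolutely_integrable_on {a..b}"
    and nn: "\<And>a b. a \<le> b \<Longrightarrow> integral {a..b} f = 0"
  shows "AE x in lebesgue. f x = 0"
proof -
  have "AE x in lebesgue. 0 \<le> f x"
    by (rule AE_nonneg_if_interval_integrals_nonneg) (use assms in auto)
  moreover have "AE x in lebesgue. 0 \<le> - f x"
    by (rule AE_nonneg_if_interval_integrals_nonneg)
      (use assms absolutely_integrable_on_scaleR_iff[where c = "-1" and f = f] in auto)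
  ultimately show ?thesis by eventually_elim auto
qed

lemma has_ac_deriv_imp_DERIV:
  assumes F: "has_ac_deriv F f" and cont: "continuous_on UNIV f"
  shows "(F has_real_derivative f x) (at x)"
proof -
  have "((\<lambda>y. integral {x - 1..y} f) has_real_derivative f x) (at x within {x-1..x+1})"
    by (rule integral_has_real_derivative) (use cont in \<open>auto intro: continuous_on_subset\<close>)
  hence "((\<lambda>y. integral {x - 1..y} f) has_real_derivative f x) (at x)"
    using at_within_interior[of x "{x-1..x+1}"] by simp
  hence D: "((\<lambda>y. integral {x - 1..y} f + F (x-1)) has_real_derivative f x) (at x)"
    by (auto intro!: derivative_eq_intros)
  have "\<forall>\<^sub>F y in nhds x. integral {x - 1..y} f + F (x-1) = F y"
  proof (rule eventually_nhds_in_open[THEN eventually_mono])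
    show "open {x - 1<..}" by simp
  qed (use has_ac_derivD(2)[OF F] in auto)
  thus ?thesis using D by (rule DERIV_cong_ev[OF refl _ refl, THEN iffD1])
qed

lemma ac_primitive_exists:
  assumes int: "\<And>a b. a \<le> b \<Longrightarrow> f absolutely_integrable_on {a..b::real}"
  obtains F where "has_ac_deriv F f"
proof
  define F where "F y = (if 0 \<le> y then integral {0..y} f else - integral {y..0} f)" for y
  have i: "f integrable_on {a..b}" for a b
    using int[of a b] by (cases "a \<le> b") (auto dest: set_lebesgue_integral_eq_integral(1))
  have "integral {a..b} f = F b - F a" if "a \<le> b" for a b
    using that i Henstock_Kurzweil_Integration.integral_combine[of a 0 b f]
      Henstock_Kurzweil_Integration.integral_combine[of 0 a b f]
      Henstock_Kurzweil_Integration.integral_combine[of a b 0 f]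
    by (auto simp: F_def)
  thus "has_ac_deriv F f" using int by (simp add: has_ac_deriv_def)
qed

lemma in_Lp_loc_1_iff:
  "in_Lp_loc 1 f \<longleftrightarrow> f \<in> borel_measurable lebesgue \<and> (\<forall>a b. f absolutely_integrable_on {a..b})"
proof (intro iffI conjI allI)
  assume f: "in_Lp_loc 1 f"
  thus [measurable]: "f \<in> borel_measurable lebesgue" by (simp add: in_Lp_loc_def)
  fix a b
  have "(\<lambda>x. \<bar>f x\<bar>) absolutely_integrable_on {a..b}"
    using f by (auto simp: in_Lp_loc_def)
  thus "f absolutely_integrable_on {a..b}"
    by (rule set_integrable_bound)
      (auto simp: set_borel_measurable_def intro!: borel_measurable_times borel_measurable_indicator)
next
  assume f: "f \<in> borel_measurable lebesgue \<and> (\<forall>a b. f absolutely_integrable_on {a..b})"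
  have "(\<lambda>x. \<bar>f x\<bar> powr 1) absolutely_integrable_on K" if K: "compact K" for K
  proof -
    obtain r where r: "K \<subseteq> {-r..r}"
      using compact_imp_bounded[OF K] by (force simp: bounded_iff abs_le_iff)
    have "f absolutely_integrable_on {-r..r}" using f by blast
    hence "(\<lambda>x. \<bar>f x\<bar>) absolutely_integrable_on {-r..r}" by (rule set_integrable_abs)
    hence "(\<lambda>x. \<bar>f x\<bar>) absolutely_integrable_on K"
      by (rule set_integrable_subset) (use r K in \<open>simp_all add: fmeasurableD[OF lmeasurable_compact]\<close>)
    thus ?thesis by simp
  qed
  thus "in_Lp_loc 1 f" using f by (simp add: in_Lp_loc_def)
qed

section \<open>Test functions\<close>

lemma LINT_bounded_support:
  fixes h :: "real \<Rightarrow> real"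
  assumes "h absolutely_integrable_on {a..b}" "\<And>x. x \<notin> {a..b} \<Longrightarrow> h x = 0"
  shows "integrable lebesgue h" "(LINT x|lebesgue. h x) = integral {a..b} h"
proof -
  have eq: "indicat_real {a..b} x *\<^sub>R h x = h x" for x
    using assms(2)[of x] by (cases "x \<in> {a..b}") auto
  show "integrable lebesgue h" using assms(1) unfolding set_integrable_def eq .
  show "(LINT x|lebesgue. h x) = integral {a..b} h"
    using set_lebesgue_integral_eq_integral(2)[OF assms(1)]
    by (simp only: set_lebesgue_integral_def eq)
qed

lemma bounded_support_interval:
  fixes f :: "real \<Rightarrow> real"
  assumes "bounded {x. f x \<noteq> 0}"
  obtains r where "0 < r" "\<And>x. r \<le> \<bar>x\<bar> \<Longrightarrow> f x = 0"
proof -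
  from assms obtain r where r: "r > 0" "\<And>x. f x \<noteq> 0 \<Longrightarrow> \<bar>x\<bar> \<le> r"
    by (auto simp: bounded_pos)
  show thesis
    by (rule that[of "r + 1"]) (use r in force)+
qed

lemma Cc_0_iff: "\<phi> \<in> Cc 0 \<longleftrightarrow> continuous_on UNIV \<phi> \<and> bounded {x. \<phi> x \<noteq> 0}"
  by (simp add: Cc_def compact_closure)

text \<open>
  A recursive description of the test functions, which makes induction on the order of smoothness possible.
\<close>

lemma Cc_Suc_iff:
  "\<phi> \<in> Cc (Suc k) \<longleftrightarrow>
     (\<forall>x. \<phi> field_differentiable at x) \<and> deriv \<phi> \<in> Cc k \<and> bounded {x. \<phi> x \<noteq> 0}"
proof -
  have "bounded {x. deriv \<phi> x \<noteq> 0}" if b: "bounded {x. \<phi> x \<noteq> 0}"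
  proof -
    obtain r where r: "0 < r" "\<And>x. r \<le> \<bar>x\<bar> \<Longrightarrow> \<phi> x = 0"
      using bounded_support_interval[OF b] by blast
    have "deriv \<phi> x = 0" if "\<bar>x\<bar> > r" for x
    proof -
      have "\<forall>\<^sub>F z in nhds x. \<phi> z = 0"
      proof (rule eventually_nhds_in_open[THEN eventually_mono])
        show "open {z. r < \<bar>z\<bar>}" by (intro open_Collect_less continuous_intros)
      qed (use r that in auto)
      hence "deriv \<phi> x = deriv (\<lambda>_. 0) x" by (intro deriv_cong_ev) auto
      thus ?thesis by simp
    qed
    hence "{x. deriv \<phi> x \<noteq> 0} \<subseteq> {-r..r}" by (force simp: abs_le_iff)
    thus ?thesis using bounded_subset bounded_closed_interval by blast
  qed
  moreover have "(\<forall>j<Suc k. \<forall>x. (deriv ^^ j) \<phi> field_differentiable at x) \<longleftrightarrow>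
      (\<forall>x. \<phi> field_differentiable at x) \<and> (\<forall>j<k. \<forall>x. (deriv ^^ j) (deriv \<phi>) field_differentiable at x)"
    unfolding All_less_Suc2 by (simp add: funpow_swap1)
  moreover have "(deriv ^^ Suc k) \<phi> = (deriv ^^ k) (deriv \<phi>)"
    by (simp add: funpow_swap1)
  ultimately show ?thesis by (auto simp: Cc_def compact_closure simp del: funpow.simps)
qed

lemma Cc_deriv: "\<phi> \<in> Cc (Suc k) \<Longrightarrow> deriv \<phi> \<in> Cc k"
  by (simp add: Cc_Suc_iff)

lemma Cc_has_deriv: "\<phi> \<in> Cc (Suc k) \<Longrightarrow> (\<phi> has_real_derivative deriv \<phi> x) (at x)"
  by (simp add: Cc_Suc_iff DERIV_deriv_iff_field_differentiable)

lemma deriv_lincomb_Cc: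
  assumes "\<phi> \<in> Cc (Suc k)" "\<eta> \<in> Cc (Suc k)"
  shows "deriv (\<lambda>x. a * \<phi> x + b * \<eta> x) = (\<lambda>x. a * deriv \<phi> x + b * deriv \<eta> x)"
  using assms[THEN Cc_has_deriv]
  by (intro ext DERIV_imp_deriv) (auto intro!: derivative_eq_intros)

lemma Cc_lincomb:
  assumes "\<phi> \<in> Cc k" "\<eta> \<in> Cc k"
  shows "(\<lambda>x. a * \<phi> x + b * \<eta> x) \<in> Cc k"
  using assms
proof (induction k arbitrary: \<phi> \<eta>)
  case 0
  have "bounded {x. a * \<phi> x + b * \<eta> x \<noteq> 0}"
    by (rule bounded_subset[of "{x. \<phi> x \<noteq> 0} \<union> {x. \<eta> x \<noteq> 0}"]) (use 0 in \<open>auto simp: Cc_0_iff\<close>)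
  thus ?case using 0 by (auto simp: Cc_0_iff intro!: continuous_intros)
next
  case (Suc k)
  have "bounded {x. a * \<phi> x + b * \<eta> x \<noteq> 0}"
    by (rule bounded_subset[of "{x. \<phi> x \<noteq> 0} \<union> {x. \<eta> x \<noteq> 0}"]) (use Suc.prems in \<open>auto simp: Cc_Suc_iff\<close>)
  thus ?case
    using Suc deriv_lincomb_Cc[OF Suc.prems, of a b]
    by (auto simp: Cc_Suc_iff intro!: field_differentiable_add field_differentiable_mult)
qed

lemma Cc_continuous: "\<phi> \<in> Cc k \<Longrightarrow> continuous_on UNIV \<phi>"
  by (cases k) (auto simp: Cc_0_iff Cc_Suc_iff field_differentiable_imp_continuous_at
      intro: continuous_at_imp_continuous_on)

lemma Cc_bounded_support: "\<phi> \<in> Cc k \<Longrightarrow> bounded {x. \<phi> x \<noteq> 0}"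
  by (simp add: Cc_def compact_closure)

lemma integrable_mult_Cc:
  assumes f: "\<And>a b. f absolutely_integrable_on {a..b::real}" and "\<phi> \<in> Cc k"
  shows "integrable lebesgue (\<lambda>x. f x * \<phi> x)"
proof -
  obtain r where r: "0 < r" "\<And>x. r \<le> \<bar>x\<bar> \<Longrightarrow> \<phi> x = 0"
    using bounded_support_interval[OF Cc_bounded_support[OF assms(2)]] by blast
  show ?thesis
  proof (rule LINT_bounded_support(1))
    show "(\<lambda>x. f x * \<phi> x) absolutely_integrable_on {-r..r}"
      using Cc_continuous[OF assms(2)]
      by (intro absolutely_integrable_mult_continuous f) (auto intro: continuous_on_subset)
  qed (use r in force)
qed

lemma integrable_Cc: "\<phi> \<in> Cc k \<Longrightarrow> integrable lebesgue \<phi>"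
  using integrable_mult_Cc[of "\<lambda>_. 1" \<phi> k] by simp

lemma has_ac_deriv_Cc:
  assumes "\<phi> \<in> Cc (Suc k)"
  shows "has_ac_deriv \<phi> (deriv \<phi>)"
  using assms Cc_continuous[of "deriv \<phi>" k]
  by (intro has_ac_deriv_C1) (auto simp: Cc_Suc_iff DERIV_deriv_iff_field_differentiable)

text \<open>
  The mean value zero is exactly what makes the primitive vanish to the right of the support as well.
\<close>

lemma Cc_antiderivative:
  assumes \<phi>: "\<phi> \<in> Cc k" and zero: "(LINT x|lebesgue. \<phi> x) = 0"
  obtains \<psi> where "\<psi> \<in> Cc (Suc k)" "deriv \<psi> = \<phi>"
proof -
  note cont = Cc_continuous[OF \<phi>]
  obtain r where r: "0 < r" "\<And>x. r \<le> \<bar>x\<bar> \<Longrightarrow> \<phi> x = 0"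
    using bounded_support_interval[OF Cc_bounded_support[OF \<phi>]] by blast
  have i: "\<phi> absolutely_integrable_on {a..b}" for a b
    using cont by (intro absolutely_integrable_continuous_real) (auto intro: continuous_on_subset)
  obtain F where F: "has_ac_deriv F \<phi>" using ac_primitive_exists[OF i] by blast
  define \<psi> where "\<psi> x = F x - F (-r)" for x
  have D: "(\<psi> has_real_derivative \<phi> x) (at x)" for x
    unfolding \<psi>_def using has_ac_deriv_imp_DERIV[OF F cont, of x]
    by (auto intro!: derivative_eq_intros)
  have "deriv \<psi> = \<phi>" using D by (auto intro: DERIV_imp_deriv)
  have total: "integral {-r..r} \<phi> = 0"
    using LINT_bounded_support(2)[OF i, of "-r" r] r zero by (smt (verit) atLeastAtMost_iff)
  have "\<psi> x = 0" if "r \<le> \<bar>x\<bar>" for x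
  proof (cases "x \<le> -r")
    case True
    have "integral {x..-r} \<phi> = integral {x..-r} (\<lambda>_. 0)"
      by (rule integral_cong) (use r in auto)
    thus ?thesis using has_ac_derivD(2)[OF F True] by (simp add: \<psi>_def)
  next
    case False
    hence "r \<le> x" using that by auto
    have "integral {r..x} \<phi> = integral {r..x} (\<lambda>_. 0)"
      by (rule integral_cong) (use r in auto)
    thus ?thesis using has_ac_derivD(2)[OF F \<open>r \<le> x\<close>] has_ac_derivD(2)[OF F, of "-r" r] total r
      by (simp add: \<psi>_def)
  qed
  hence "{x. \<psi> x \<noteq> 0} \<subseteq> {-r..r}" by (force simp: abs_le_iff)
  hence "bounded {x. \<psi> x \<noteq> 0}" using bounded_subset bounded_closed_interval by blast
  hence "\<psi> \<in> Cc (Suc k)"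
    using D \<phi> \<open>deriv \<psi> = \<phi>\<close> by (auto simp: Cc_Suc_iff field_differentiable_def)
  thus thesis using that \<open>deriv \<psi> = \<phi>\<close> by blast
qed

section \<open>The lemma of du Bois-Reymond\<close>

text \<open>
  Trapezoidal functions decrease to the indicator of an interval, so all integrals of \<open>f\<close> over intervals
  vanish.
\<close>

lemma AE_zero_if_orthogonal_Cc_0:
  fixes f :: "real \<Rightarrow> real"
  assumes int: "\<And>a b. f absolutely_integrable_on {a..b}"
    and orth: "\<And>\<eta>. \<eta> \<in> Cc 0 \<Longrightarrow> (LINT x|lebesgue. f x * \<eta> x) = 0"
  shows "AE x in lebesgue. f x = 0"
proof (rule AE_zero_if_interval_integrals_zero)
  fix a b :: real assume ab: "a \<le> b"
  define \<eta> where "\<eta> n x = max 0 (1 - real (Suc n) * max 0 (max (a - x) (x - b)))" for n x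
  have cont: "continuous_on UNIV (\<eta> n)" for n
    unfolding \<eta>_def by (intro continuous_intros)
  have zero: "\<eta> n x = 0" if "x \<notin> {a-1..b+1}" for n x
  proof -
    have "1 * 1 \<le> real (Suc n) * max 0 (max (a - x) (x - b))"
      using that by (intro mult_mono) auto
    thus ?thesis by (simp add: \<eta>_def)
  qed
  have le1: "0 \<le> \<eta> n x" "\<eta> n x \<le> 1" for n x by (auto simp: \<eta>_def)
  have "bounded {x. \<eta> n x \<noteq> 0}" for n
    by (rule bounded_subset[OF bounded_closed_interval[of "a-1" "b+1"]]) (use zero in blast)
  hence Cc: "\<eta> n \<in> Cc 0" for n using cont by (auto simp: Cc_0_iff)
  have big: "integrable lebesgue (\<lambda>x. indicator {a-1..b+1} x *\<^sub>R f x)"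
    using int[of "a-1" "b+1"] by (simp add: set_integrable_def)
  have "(\<lambda>n. LINT x|lebesgue. f x * \<eta> n x) \<longlonglongrightarrow> (LINT x|lebesgue. indicator {a..b} x *\<^sub>R f x)"
  proof (rule integral_dominated_convergence[where w = "\<lambda>x. \<bar>indicator {a-1..b+1} x *\<^sub>R f x\<bar>"])
    show "(\<lambda>x. indicator {a..b} x *\<^sub>R f x) \<in> borel_measurable lebesgue"
      using int[of a b] unfolding set_integrable_def by (rule borel_measurable_integrable)
    show "(\<lambda>x. f x * \<eta> n x) \<in> borel_measurable lebesgue" for n
      by (rule borel_measurable_integrable[OF integrable_mult_Cc[OF int Cc]])
    show "integrable lebesgue (\<lambda>x. \<bar>indicator {a-1..b+1} x *\<^sub>R f x\<bar>)"
      using big by (rule integrable_abs)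
    show "AE x in lebesgue. norm (f x * \<eta> n x) \<le> \<bar>indicator {a-1..b+1} x *\<^sub>R f x\<bar>" for n
    proof (rule AE_I2)
      fix x show "norm (f x * \<eta> n x) \<le> \<bar>indicator {a-1..b+1} x *\<^sub>R f x\<bar>"
        using le1[of n x] zero[of x n] mult_left_le[of "\<eta> n x" "\<bar>f x\<bar>"]
        by (cases "x \<in> {a-1..b+1}") (auto simp: abs_mult)
    qed
    show "AE x in lebesgue. (\<lambda>n. f x * \<eta> n x) \<longlonglongrightarrow> indicator {a..b} x *\<^sub>R f x"
    proof (rule AE_I2)
      fix x
      have "(\<lambda>n. \<eta> n x) \<longlonglongrightarrow> indicator {a..b} x"
      proof (cases "x \<in> {a..b}")
        case True
        thus ?thesis by (simp add: \<eta>_def max_absorb1)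
      next
        case False
        define d where "d = max 0 (max (a - x) (x - b))"
        have "d > 0" using False by (auto simp: d_def)
        obtain N where N: "1 < real N * d" using reals_Archimedean3[OF \<open>d > 0\<close>] by blast
        have "\<eta> n x = 0" if "n \<ge> N" for n
        proof -
          have "real N * d \<le> real (Suc n) * d" using that \<open>d > 0\<close> by (intro mult_right_mono) auto
          thus ?thesis using N by (simp add: \<eta>_def d_def[symmetric])
        qed
        hence "\<forall>\<^sub>F n in sequentially. \<eta> n x = 0" by (auto simp: eventually_sequentially)
        thus ?thesis using False by (simp add: tendsto_eventually)
      qed
      from tendsto_mult[OF tendsto_const[of "f x"] this]
      show "(\<lambda>n. f x * \<eta> n x) \<longlonglongrightarrow> indicator {a..b} x *\<^sub>R f x" by (simp add: mult.commute)
    qed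
  qed
  hence "(\<lambda>n. 0) \<longlonglongrightarrow> (LINT x|lebesgue. indicator {a..b} x *\<^sub>R f x)"
    by (simp add: orth[OF Cc])
  hence "(LINT x|lebesgue. indicator {a..b} x *\<^sub>R f x) = 0"
    by (simp add: LIMSEQ_const_iff)
  thus "integral {a..b} f = 0"
    using set_lebesgue_integral_eq_integral(2)[OF int] by (simp add: set_lebesgue_integral_def)
qed (rule int)

text \<open>
  A test function of integral zero is a derivative, so the functional factors through the integral. If no
  test function of this class had a nonzero integral, the functional would vanish; treating this case as well makes the
  construction of a smooth bump function superfluous.
\<close>

lemma functional_vanishing_on_derivs:
  fixes L :: "(real \<Rightarrow> real) \<Rightarrow> real"
  assumes orth: "\<And>\<psi>. \<psi> \<in> Cc (Suc k) \<Longrightarrow> L (deriv \<psi>) = 0"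
    and lin: "\<And>\<phi> \<eta> a b. \<phi> \<in> Cc k \<Longrightarrow> \<eta> \<in> Cc k \<Longrightarrow> L (\<lambda>x. a * \<phi> x + b * \<eta> x) = a * L \<phi> + b * L \<eta>"
  obtains c :: real where "\<And>\<phi>. \<phi> \<in> Cc k \<Longrightarrow> L \<phi> = c * (LINT x|lebesgue. \<phi> x)"
proof (cases "\<exists>\<eta>\<in>Cc k. (LINT x|lebesgue. \<eta> x) \<noteq> 0")
  case True
  then obtain \<eta> where \<eta>: "\<eta> \<in> Cc k" "(LINT x|lebesgue. \<eta> x) \<noteq> 0" by blast
  define I where "I = (LINT x|lebesgue. \<eta> x)"
  show thesis
  proof (rule that[of "L \<eta> / I"])
    fix \<phi> assume \<phi>: "\<phi> \<in> Cc k"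
    define m where "m = (LINT x|lebesgue. \<phi> x)"
    have "(LINT x|lebesgue. 1 * \<phi> x + (- m / I) * \<eta> x) = 0"
      using integrable_Cc[OF \<phi>] integrable_Cc[OF \<eta>(1)] \<eta>(2) by (simp add: I_def m_def)
    then obtain \<psi> where "\<psi> \<in> Cc (Suc k)" "deriv \<psi> = (\<lambda>x. 1 * \<phi> x + (- m / I) * \<eta> x)"
      using Cc_antiderivative[OF Cc_lincomb[OF \<phi> \<eta>(1), of 1 "- m / I"]] by blast
    hence "1 * L \<phi> + (- m / I) * L \<eta> = 0"
      using orth[of \<psi>] lin[OF \<phi> \<eta>(1), of 1 "- m / I"] by simp
    thus "L \<phi> = L \<eta> / I * (LINT x|lebesgue. \<phi> x)" by (simp add: m_def)
  qed
next
  case False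
  show thesis
  proof (rule that[of 0])
    fix \<phi> assume \<phi>: "\<phi> \<in> Cc k"
    then obtain \<psi> where "\<psi> \<in> Cc (Suc k)" "deriv \<psi> = \<phi>"
      using Cc_antiderivative[OF \<phi>] False by blast
    thus "L \<phi> = 0 * (LINT x|lebesgue. \<phi> x)" using orth by auto
  qed
qed

lemma LINT_mult_lincomb_Cc:
  assumes "\<And>a b. f absolutely_integrable_on {a..b::real}" "\<phi> \<in> Cc k" "\<eta> \<in> Cc k"
  shows "(LINT x|lebesgue. f x * (a * \<phi> x + b * \<eta> x)) =
    a * (LINT x|lebesgue. f x * \<phi> x) + b * (LINT x|lebesgue. f x * \<eta> x)"
proof -
  have "(LINT x|lebesgue. f x * (a * \<phi> x + b * \<eta> x)) =
      (LINT x|lebesgue. a * (f x * \<phi> x) + b * (f x * \<eta> x))"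
    by (simp add: algebra_simps)
  thus ?thesis using integrable_mult_Cc[OF assms(1,2)] integrable_mult_Cc[OF assms(1,3)] by simp
qed

lemma AE_const_if_orthogonal_derivs:
  fixes f :: "real \<Rightarrow> real"
  assumes int: "\<And>a b. f absolutely_integrable_on {a..b}"
    and orth: "\<And>\<phi>. \<phi> \<in> Cc 1 \<Longrightarrow> (LINT x|lebesgue. f x * deriv \<phi> x) = 0"
  obtains c where "AE x in lebesgue. f x = c"
proof -
  obtain c where c: "\<And>\<phi>. \<phi> \<in> Cc 0 \<Longrightarrow>
      (LINT x|lebesgue. f x * \<phi> x) = c * (LINT x|lebesgue. \<phi> x)"
    using functional_vanishing_on_derivs[of 0 "\<lambda>\<phi>. LINT x|lebesgue. f x * \<phi> x"]
      orth LINT_mult_lincomb_Cc[OF int] by auto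
  have "AE x in lebesgue. f x - c = 0"
  proof (rule AE_zero_if_orthogonal_Cc_0)
    fix \<eta> assume \<eta>: "\<eta> \<in> Cc 0"
    have "(LINT x|lebesgue. (f x - c) * \<eta> x) = (LINT x|lebesgue. f x * \<eta> x - c * \<eta> x)"
      by (simp add: algebra_simps)
    also have "\<dots> = 0"
      using integrable_mult_Cc[OF int \<eta>] integrable_Cc[OF \<eta>] c[OF \<eta>] by simp
    finally show "(LINT x|lebesgue. (f x - c) * \<eta> x) = 0" .
  qed (use int in auto)
  thus thesis using that by simp
qed

text \<open>
  Integration by parts over an interval that contains the support of the test function.
\<close>

lemma weak_deriv_if_has_ac_deriv:
  assumes "has_ac_deriv f g"
    and "g \<in> borel_measurable lebesgue"
  shows "weak_deriv f g"
proof -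
  have gi: "g absolutely_integrable_on {a..b}" for a b
    using has_ac_derivD(1)[OF assms(1), of a b] by (cases "a \<le> b") (auto simp: set_integrable_def)
  have fc: "continuous_on S f" for S
    using has_ac_deriv_continuous[OF assms(1)] by (rule continuous_on_subset) auto
  have fi: "f absolutely_integrable_on {a..b}" for a b
    by (intro absolutely_integrable_continuous_real fc)
  have fm: "f \<in> borel_measurable lebesgue"
    using borel_measurable_continuous_onI[OF fc] by (intro measurable_completion) simp
  have "(LINT x|lebesgue. f x * deriv \<phi> x) = - (LINT x|lebesgue. g x * \<phi> x)" if \<phi>: "\<phi> \<in> Cc 1" for \<phi>
  proof -
    have \<phi>': "deriv \<phi> \<in> Cc 0" using \<phi> Cc_deriv[of \<phi> 0] by simp
    obtain r where r: "0 < r" "\<And>x. r \<le> \<bar>x\<bar> \<Longrightarrow> \<phi> x = 0"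
      using bounded_support_interval[OF Cc_bounded_support[OF \<phi>]] by blast
    obtain r' where r': "0 < r'" "\<And>x. r' \<le> \<bar>x\<bar> \<Longrightarrow> deriv \<phi> x = 0"
      using bounded_support_interval[OF Cc_bounded_support[OF \<phi>']] by blast
    define R where "R = max r r'"
    have D: "has_ac_deriv (\<lambda>x. f x * \<phi> x) (\<lambda>x. g x * \<phi> x + f x * deriv \<phi> x)"
      using has_ac_deriv_mult[OF assms(1) has_ac_deriv_Cc[of \<phi> 0]] \<phi> by simp
    have "(LINT x|lebesgue. g x * \<phi> x) + (LINT x|lebesgue. f x * deriv \<phi> x) =
        (LINT x|lebesgue. g x * \<phi> x + f x * deriv \<phi> x)"
      by (rule Bochner_Integration.integral_add[symmetric])
        (use integrable_mult_Cc[OF gi \<phi>] integrable_mult_Cc[OF fi \<phi>'] in auto)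
    also have "\<dots> = integral {-R..R} (\<lambda>x. g x * \<phi> x + f x * deriv \<phi> x)"
    proof (rule LINT_bounded_support(2))
      show "(\<lambda>x. g x * \<phi> x + f x * deriv \<phi> x) absolutely_integrable_on {-R..R}"
        using has_ac_derivD(1)[OF D, of "-R" R] r(1) by (simp add: R_def)
      show "g x * \<phi> x + f x * deriv \<phi> x = 0" if "x \<notin> {-R..R}" for x
        using that r(2)[of x] r'(2)[of x] by (auto simp: R_def)
    qed
    also have "\<dots> = 0"
      using has_ac_derivD(2)[OF D, of "-R" R] r(1) r(2)[of R] r(2)[of "-R"] by (simp add: R_def)
    finally show ?thesis by simp
  qed
  thus ?thesis using assms(2) gi fi fm by (simp add: weak_deriv_def in_Lp_loc_1_iff)
qed

text \<open>
  A primitive of \<open>g\<close> also has the weak derivative \<open>g\<close>, so it differs from \<open>f\<close> by a constant.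
\<close>

lemma weak_deriv_imp_has_ac_deriv:
  assumes "weak_deriv f g"
  obtains F where "has_ac_deriv F g" "AE x in lebesgue. f x = F x"
proof -
  have f: "\<And>a b. f absolutely_integrable_on {a..b}" and g: "\<And>a b. g absolutely_integrable_on {a..b}"
    and gm: "g \<in> borel_measurable lebesgue"
    and w: "\<And>\<phi>. \<phi> \<in> Cc 1 \<Longrightarrow> (LINT x|lebesgue. f x * deriv \<phi> x) = - (LINT x|lebesgue. g x * \<phi> x)"
    using assms by (auto simp: weak_deriv_def in_Lp_loc_1_iff)
  obtain G where G: "has_ac_deriv G g" using ac_primitive_exists[of g] g by blast
  have Gi: "G absolutely_integrable_on {a..b}" for a b
    using has_ac_deriv_continuous[OF G]
    by (intro absolutely_integrable_continuous_real) (auto intro: continuous_on_subset)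
  have "weak_deriv G g" by (rule weak_deriv_if_has_ac_deriv[OF G gm])
  obtain c where c: "AE x in lebesgue. f x - G x = c"
  proof (rule AE_const_if_orthogonal_derivs[of "\<lambda>x. f x - G x"])
    show "(\<lambda>x. f x - G x) absolutely_integrable_on {a..b}" for a b
      using f Gi by (intro set_integral_diff(1)) auto
    fix \<phi> assume \<phi>: "\<phi> \<in> Cc 1"
    have \<phi>': "deriv \<phi> \<in> Cc 0" using \<phi> Cc_deriv[of \<phi> 0] by simp
    have "(LINT x|lebesgue. (f x - G x) * deriv \<phi> x) =
        (LINT x|lebesgue. f x * deriv \<phi> x - G x * deriv \<phi> x)"
      by (simp add: algebra_simps)
    also have "\<dots> = (LINT x|lebesgue. f x * deriv \<phi> x) - (LINT x|lebesgue. G x * deriv \<phi> x)"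
      using integrable_mult_Cc[OF f \<phi>'] integrable_mult_Cc[OF Gi \<phi>'] by simp
    also have "\<dots> = 0" using w[OF \<phi>] \<open>weak_deriv G g\<close> \<phi> by (simp add: weak_deriv_def)
    finally show "(LINT x|lebesgue. (f x - G x) * deriv \<phi> x) = 0" .
  qed blast
  show thesis
  proof (rule that)
    show "has_ac_deriv (\<lambda>x. G x + c) g"
      using has_ac_deriv_add[OF G has_ac_deriv_const[of c]] by simp
    show "AE x in lebesgue. f x = G x + c" using c by eventually_elim auto
  qed
qed

text \<open>
  The first-order statement applies to \<open>f\<close> after subtraction of a linear function: a functional
  \<open>\<phi> \<mapsto> \<integral> f \<phi>'\<close> that vanishes on derivatives is a multiple of the integral, as it is for a linear \<open>f\<close>.
\<close>

lemma AE_affine_if_orthogonal_second_derivs: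
  fixes f :: "real \<Rightarrow> real"
  assumes int: "\<And>a b. f absolutely_integrable_on {a..b}"
    and orth: "\<And>\<psi>. \<psi> \<in> Cc 2 \<Longrightarrow> (LINT x|lebesgue. f x * (deriv ^^ 2) \<psi> x) = 0"
  obtains c0 c1 where "AE x in lebesgue. f x = c0 + c1 * x"
proof -
  have d: "deriv \<phi> \<in> Cc 0" if "\<phi> \<in> Cc 1" for \<phi>
    using that Cc_deriv[of \<phi> 0] by simp
  obtain c where c: "\<And>\<phi>. \<phi> \<in> Cc 1 \<Longrightarrow>
      (LINT x|lebesgue. f x * deriv \<phi> x) = c * (LINT x|lebesgue. \<phi> x)"
  proof (rule functional_vanishing_on_derivs[of 1 "\<lambda>\<phi>. LINT x|lebesgue. f x * deriv \<phi> x"])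
    show "(LINT x|lebesgue. f x * deriv (deriv \<psi>) x) = 0" if "\<psi> \<in> Cc (Suc 1)" for \<psi>
      using orth[of \<psi>] that by (simp add: numeral_2_eq_2)
    fix \<phi> \<eta> a b assume \<phi>: "\<phi> \<in> Cc 1" and \<eta>: "\<eta> \<in> Cc 1"
    have "deriv (\<lambda>x. a * \<phi> x + b * \<eta> x) = (\<lambda>x. a * deriv \<phi> x + b * deriv \<eta> x)"
      using deriv_lincomb_Cc[of \<phi> 0 \<eta>] \<phi> \<eta> by simp
    thus "(LINT x|lebesgue. f x * deriv (\<lambda>x. a * \<phi> x + b * \<eta> x) x) =
      a * (LINT x|lebesgue. f x * deriv \<phi> x) + b * (LINT x|lebesgue. f x * deriv \<eta> x)"
      using LINT_mult_lincomb_Cc[OF int d[OF \<phi>] d[OF \<eta>]] by simp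
  qed blast
  obtain c0 where "AE x in lebesgue. f x + c * x = c0"
  proof (rule AE_const_if_orthogonal_derivs[of "\<lambda>x. f x + c * x"])
    have i2: "(\<lambda>x. c * x) absolutely_integrable_on {a..b}" for a b
      by (intro absolutely_integrable_continuous_real continuous_intros)
    show "(\<lambda>x. f x + c * x) absolutely_integrable_on {a..b}" for a b
      using int i2 by (intro set_integral_add(1)) auto
    fix \<phi> assume \<phi>: "\<phi> \<in> Cc 1"
    have "has_ac_deriv (\<lambda>x. c * x) (\<lambda>x. c)"
      using has_ac_deriv_cmult[OF has_ac_deriv_ident, of c] by simp
    hence "weak_deriv (\<lambda>x. c * x) (\<lambda>x. c)"
      by (rule weak_deriv_if_has_ac_deriv) simp
    hence cx: "(LINT x|lebesgue. c * x * deriv \<phi> x) = - (c * (LINT x|lebesgue. \<phi> x))"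
      using \<phi> by (simp add: weak_deriv_def)
    have "(LINT x|lebesgue. (f x + c * x) * deriv \<phi> x) =
        (LINT x|lebesgue. f x * deriv \<phi> x + c * x * deriv \<phi> x)"
      by (simp add: algebra_simps)
    also have "\<dots> = (LINT x|lebesgue. f x * deriv \<phi> x) + (LINT x|lebesgue. c * x * deriv \<phi> x)"
      using integrable_mult_Cc[OF int d[OF \<phi>]] integrable_mult_Cc[OF i2 d[OF \<phi>]]
      by (rule Bochner_Integration.integral_add)
    also have "\<dots> = 0" using c[OF \<phi>] cx by simp
    finally show "(LINT x|lebesgue. (f x + c * x) * deriv \<phi> x) = 0" .
  qed blast
  hence "AE x in lebesgue. f x = c0 + (- c) * x" by eventually_elim simp
  thus thesis by (rule that)
qed

section \<open>Convexity of the primitive of a weak solution\<close>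

lemma AE_reflect:
  assumes "AE y in lebesgue. P (y::real)"
  shows "AE y in lebesgue. P (- y)"
proof -
  have "AE y in distr lborel borel uminus. P (y::real)"
    using assms unfolding lborel_distr_uminus by (simp add: AE_completion_iff)
  hence "AE y in lborel. P (- y)" by (rule AE_distrD[rotated]) simp
  thus ?thesis by (rule AE_completion)
qed

lemma integral_square_le_0_imp_zero:
  fixes h :: "real \<Rightarrow> real"
  assumes "continuous_on {a..b} h" "integral {a..b} (\<lambda>y. (h y)\<^sup>2) \<le> 0" "a \<le> y" "y \<le> b" "a < b"
  shows "h y = 0"
proof -
  have "0 \<le> integral {a..b} (\<lambda>y. (h y)\<^sup>2)"
    using assms(1) by (intro integral_nonneg integrable_continuous_real continuous_intros) auto
  hence "integral {a..b} (\<lambda>y. (h y)\<^sup>2) = 0" using assms(2) by simp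
  hence "(h y)\<^sup>2 = 0"
    using integral_eq_0_iff[of a b "\<lambda>y. (h y)\<^sup>2"] continuous_on_power[OF assms(1)] assms(3-5)
    by auto
  thus ?thesis by simp
qed

lemma positive_excursion:
  fixes h :: "real \<Rightarrow> real"
  assumes cont: "continuous_on {\<alpha>..\<beta>} h" and c: "\<alpha> \<le> c" "c \<le> \<beta>" and ends: "h \<alpha> = 0" "h \<beta> = 0" "0 < h c"
  obtains a b where "\<alpha> \<le> a" "a < c" "c < b" "b \<le> \<beta>" "h a = 0" "h b = 0" "\<And>y. a \<le> y \<Longrightarrow> y \<le> b \<Longrightarrow> 0 \<le> h y"
proof -
  define Z where "Z = {y\<in>{\<alpha>..\<beta>}. h y = 0}"
  have "Z = {\<alpha>..\<beta>} \<inter> h -` {0}" by (auto simp: Z_def)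
  hence "closed Z" using continuous_closed_preimage[OF cont] by simp
  hence comp: "compact (Z \<inter> {\<alpha>..c})" "compact (Z \<inter> {c..\<beta>})"
    by (auto intro: closed_Int_compact)
  have ne: "Z \<inter> {\<alpha>..c} \<noteq> {}" "Z \<inter> {c..\<beta>} \<noteq> {}"
  proof -
    have "\<alpha> \<in> Z \<inter> {\<alpha>..c}" "\<beta> \<in> Z \<inter> {c..\<beta>}" using c ends by (auto simp: Z_def)
    thus "Z \<inter> {\<alpha>..c} \<noteq> {}" "Z \<inter> {c..\<beta>} \<noteq> {}" by blast+
  qed
  obtain a where a: "a \<in> Z" "\<alpha> \<le> a" "a \<le> c" "\<And>z. z \<in> Z \<Longrightarrow> \<alpha> \<le> z \<Longrightarrow> z \<le> c \<Longrightarrow> z \<le> a"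
    using compact_attains_sup[OF comp(1) ne(1)] by auto
  obtain b where b: "b \<in> Z" "c \<le> b" "b \<le> \<beta>" "\<And>z. z \<in> Z \<Longrightarrow> c \<le> z \<Longrightarrow> z \<le> \<beta> \<Longrightarrow> b \<le> z"
    using compact_attains_inf[OF comp(2) ne(2)] by auto
  have sub: "continuous_on {x..y} h" if "\<alpha> \<le> x" "y \<le> \<beta>" for x y
    using cont by (rule continuous_on_subset) (use that in auto)
  have nn: "0 \<le> h y" if y: "a \<le> y" "y \<le> b" for y
  proof (rule ccontr)
    assume neg: "\<not> 0 \<le> h y"
    show False
    proof (cases "y \<le> c")
      case True
      obtain z where z: "y \<le> z" "z \<le> c" "h z = 0"
        using IVT'[of h y 0 c] neg ends(3) True sub[of y c] a(2) y c by auto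
      hence "z \<in> Z" using a(2) y c by (auto simp: Z_def)
      hence "z = y" using a(4)[of z] z a(2) y by auto
      thus False using z neg by simp
    next
      case False
      obtain z where z: "c \<le> z" "z \<le> y" "h z = 0"
        using IVT2'[of h y 0 c] neg ends(3) False sub[of c y] b(3) y c by auto
      hence "z \<in> Z" using b(3) y c by (auto simp: Z_def)
      hence "z = y" using b(4)[of z] z b(3) y by auto
      thus False using z neg by simp
    qed
  qed
  have "h a = 0" "h b = 0" using a(1) b(1) by (auto simp: Z_def)
  moreover have "a \<noteq> c" "b \<noteq> c" using calculation ends(3) by auto
  ultimately show thesis using that[of a b] a b nn by auto
qed

text \<open>
  The profile equation integrated twice. \<open>X\<close> is the primitive of \<open>U\<close> and \<open>Z\<close> the one of \<open>X\<close>. The two decay conditions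
  hold along some sequence of radii only, but they carry the factor \<open>R\<close>: square integrability of both differences gives
  no more, and the boundary terms of the energy inequality at \<open>R\<close> need no more. The data are symmetric under
  \<open>y \<mapsto> - y\<close>, \<open>U \<mapsto> - U\<close>, so that every statement on the right half line has a mirror image.
\<close>

locale weak_profile =
  fixes Um Up c0 :: real and A X U Z :: "real \<Rightarrow> real"
  assumes Um_less_Up: "Um < Up"
    and mono_A: "mono A" and A_less: "A Um < A Up"
    and X: "has_ac_deriv X U"
    and Z: "has_ac_deriv Z X"
    and AU: "AE y in lebesgue. A (U y) = c0 + Z y - y * X y / 2"
    and Z0: "Z 0 = 0"
    and decay_right: "\<And>\<epsilon> N. 0 < \<epsilon> \<Longrightarrow> \<exists>R\<ge>N. R * ((c0 + Z R - R * X R / 2 - A Up)\<^sup>2 + (X R - Up * R)\<^sup>2) < \<epsilon>"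
    and decay_left: "\<And>\<epsilon> N. 0 < \<epsilon> \<Longrightarrow> \<exists>R\<ge>N. R * ((c0 + Z (-R) + R * X (-R) / 2 - A Um)\<^sup>2 + (X (-R) + Um * R)\<^sup>2) < \<epsilon>"
begin

definition W where "W y = c0 + Z y - y * X y / 2"

lemma weak_profile_reflect:
  "weak_profile (- Up) (- Um) (- c0) (\<lambda>u. - A (- u)) (\<lambda>y. X (- y)) (\<lambda>y. - U (- y)) (\<lambda>y. - Z (- y))"
proof
  show "has_ac_deriv (\<lambda>y. - Z (- y)) (\<lambda>y. X (- y))"
    using has_ac_deriv_cmult[OF has_ac_deriv_reflect[OF Z], of "-1"] by simp
  show "AE y in lebesgue. - A (- (- U (- y))) = - c0 + - Z (- y) - y * X (- y) / 2"
    using AE_reflect[OF AU] by eventually_elim simp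
  fix \<epsilon> N :: real assume e: "0 < \<epsilon>"
  have sq: "(- c0 + - z - x - - a)\<^sup>2 = (c0 + z + x - a)\<^sup>2" for z x a :: real
    by (simp add: power2_eq_square algebra_simps)
  show "\<exists>R\<ge>N. R * ((- c0 + - Z (- R) - R * X (- R) / 2 - - A (- (- Um)))\<^sup>2 + (X (- R) - - Um * R)\<^sup>2) < \<epsilon>"
    using decay_left[OF e, of N] unfolding sq by simp
  have sq': "(- c0 + - z + x - - a)\<^sup>2 = (c0 + z - x - a)\<^sup>2" for z x a :: real
    by (simp add: power2_eq_square algebra_simps)
  show "\<exists>R\<ge>N. R * ((- c0 + - Z (- (- R)) + R * X (- (- R)) / 2 - - A (- (- Up)))\<^sup>2 + (X (- (- R)) + - Up * R)\<^sup>2) < \<epsilon>"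
    using decay_right[OF e, of N] unfolding sq' by simp
qed (use Um_less_Up mono_A A_less Z0 has_ac_deriv_reflect[OF X] in \<open>auto simp: mono_def\<close>)

lemma X_cont: "continuous_on S X"
  using has_ac_deriv_continuous[OF X] by (rule continuous_on_subset) auto

lemma X_line_cont: "continuous_on S (\<lambda>y. X y - m * y)"
  by (intro continuous_intros X_cont)

text \<open>
  The function on the right has the derivative \<open>(W - A m) (U - m) + 3/4 h\<^sup>2 + q/2 h\<close>, since
  \<open>W' = (X - y U) / 2 = (h - y h' + q) / 2\<close>. Its first term is nonnegative because \<open>W = A \<circ> U\<close> almost everywhere and
  \<open>A\<close> is monotone.
\<close>

lemma energy_inequality:
  fixes m q :: real
  assumes ab: "\<alpha> \<le> \<beta>"
  defines "h \<equiv> \<lambda>y. X y - (m * y + q)"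
  shows "integral {\<alpha>..\<beta>} (\<lambda>y. 3/4 * (h y)\<^sup>2 + q/2 * h y) \<le>
     ((W \<beta> - A m) * h \<beta> + \<beta> * (h \<beta>)\<^sup>2 / 4) - ((W \<alpha> - A m) * h \<alpha> + \<alpha> * (h \<alpha>)\<^sup>2 / 4)"
proof -
  have id: "has_ac_deriv (\<lambda>y. y) (\<lambda>_. 1)" by (rule has_ac_deriv_ident)
  have W: "has_ac_deriv (\<lambda>y. W y - A m) (\<lambda>y. (X y - y * U y) / 2)"
    using has_ac_deriv_diff[OF has_ac_deriv_add[OF has_ac_deriv_const[of "c0 - A m"] Z]
        has_ac_deriv_cmult[OF has_ac_deriv_mult[OF id X], of "1/2"]]
    by (rule has_ac_deriv_cong) (auto simp: W_def field_simps)
  have h: "has_ac_deriv h (\<lambda>y. U y - m)"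
    using has_ac_deriv_diff[OF X has_ac_deriv_add[OF has_ac_deriv_cmult[OF id, of m] has_ac_deriv_const[of q]]]
    by (rule has_ac_deriv_cong) (auto simp: h_def)
  have hc: "continuous_on S h" for S
    unfolding h_def by (intro continuous_intros X_cont)
  obtain K where K: "has_ac_deriv K (\<lambda>y. 3/4 * (h y)\<^sup>2 + q/2 * h y)"
  proof (rule ac_primitive_exists)
    show "(\<lambda>y. 3/4 * (h y)\<^sup>2 + q/2 * h y) absolutely_integrable_on {a..b}" for a b
      by (intro absolutely_integrable_continuous_real continuous_intros hc)
  qed blast
  have yh: "has_ac_deriv (\<lambda>y. y * (h y)\<^sup>2 / 4) (\<lambda>y. (h y)\<^sup>2 / 4 + y * h y * (U y - m) / 2)"
    using has_ac_deriv_cmult[OF has_ac_deriv_mult[OF id has_ac_deriv_mult[OF h h]], of "1/4"]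
    by (rule has_ac_deriv_cong) (auto simp: power2_eq_square field_simps)
  have D: "has_ac_deriv (\<lambda>y. (W y - A m) * h y + y * (h y)\<^sup>2 / 4 - K y)
      (\<lambda>y. (W y - A m) * (U y - m))"
    using has_ac_deriv_diff[OF has_ac_deriv_add[OF has_ac_deriv_mult[OF W h] yh] K]
  proof (rule has_ac_deriv_cong)
    show "AE y in lebesgue. (X y - y * U y) / 2 * h y + (W y - A m) * (U y - m) +
        ((h y)\<^sup>2 / 4 + y * h y * (U y - m) / 2) - (3/4 * (h y)\<^sup>2 + q/2 * h y) =
        (W y - A m) * (U y - m)"
      by (rule AE_I2) (simp add: h_def power2_eq_square field_simps)
  qed simp
  have "(W \<alpha> - A m) * h \<alpha> + \<alpha> * (h \<alpha>)\<^sup>2 / 4 - K \<alpha> \<le> (W \<beta> - A m) * h \<beta> + \<beta> * (h \<beta>)\<^sup>2 / 4 - K \<beta>"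
  proof (rule has_ac_deriv_mono[OF D ab])
    show "AE y in lebesgue. y \<in> {\<alpha>..\<beta>} \<longrightarrow> 0 \<le> (W y - A m) * (U y - m)"
      using AU
    proof eventually_elim
      fix y assume "A (U y) = c0 + Z y - y * X y / 2"
      hence "W y = A (U y)" by (simp add: W_def)
      thus "y \<in> {\<alpha>..\<beta>} \<longrightarrow> 0 \<le> (W y - A m) * (U y - m)"
        using monoD[OF mono_A, of m "U y"] monoD[OF mono_A, of "U y" m]
        by (cases "m \<le> U y") (auto intro: mult_nonneg_nonneg mult_nonpos_nonpos)
    qed
  qed
  thus ?thesis using has_ac_derivD(2)[OF K ab] by simp
qed

lemma chord_contact:
  assumes "\<alpha> < \<beta>" "X \<alpha> = m * \<alpha> + q" "X \<beta> = m * \<beta> + q"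
    and sgn: "\<And>y. \<alpha> \<le> y \<Longrightarrow> y \<le> \<beta> \<Longrightarrow> 0 \<le> q * (X y - (m * y + q))"
    and y: "\<alpha> \<le> y" "y \<le> \<beta>"
  shows "X y = m * y + q"
proof -
  define h where "h y = X y - (m * y + q)" for y
  have hc: "continuous_on S h" for S
    unfolding h_def by (intro continuous_intros X_cont)
  have "3/4 * integral {\<alpha>..\<beta>} (\<lambda>y. (h y)\<^sup>2) = integral {\<alpha>..\<beta>} (\<lambda>y. 3/4 * (h y)\<^sup>2)"
    by simp
  also have "\<dots> \<le> integral {\<alpha>..\<beta>} (\<lambda>y. 3/4 * (h y)\<^sup>2 + q/2 * h y)"
    by (intro integral_le integrable_continuous_real continuous_intros hc)
      (use sgn in \<open>auto simp: h_def\<close>)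
  also have "\<dots> \<le> 0"
    using energy_inequality[of \<alpha> \<beta> m q] assms by (simp add: h_def)
  finally have "integral {\<alpha>..\<beta>} (\<lambda>y. (h y)\<^sup>2) \<le> 0" by simp
  from integral_square_le_0_imp_zero[OF hc this y \<open>\<alpha> < \<beta>\<close>]
  show ?thesis by (simp add: h_def)
qed

text \<open>
  The asymptote has intercept zero, so \<open>chord_contact\<close> applies in the limit of the right end point tending to infinity.
\<close>

lemma contact_right_asymptote:
  assumes "X \<alpha> = Up * \<alpha>" "\<alpha> \<le> y"
  shows "X y = Up * y"
proof (cases "\<alpha> = y")
  case False
  hence "\<alpha> < y" using assms(2) by simp
  define h where "h y = X y - Up * y" for y
  have hc: "continuous_on S h" for S
    unfolding h_def by (intro continuous_intros X_cont)
  have "integral {\<alpha>..y} (\<lambda>y. (h y)\<^sup>2) \<le> 0 + \<epsilon>" if "0 < \<epsilon>" for \<epsilon>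
  proof -
    obtain R where R: "R \<ge> max y 1"
      "R * ((c0 + Z R - R * X R / 2 - A Up)\<^sup>2 + (X R - Up * R)\<^sup>2) < \<epsilon> / 2"
      using decay_right[of "\<epsilon>/2" "max y 1"] \<open>0 < \<epsilon>\<close> half_gt_zero by blast
    hence R': "R * ((W R - A Up)\<^sup>2 + (h R)\<^sup>2) < \<epsilon> / 2" by (simp add: W_def h_def)
    have "3/4 * integral {\<alpha>..y} (\<lambda>y. (h y)\<^sup>2) \<le> 3/4 * integral {\<alpha>..R} (\<lambda>y. (h y)\<^sup>2)"
      using R \<open>\<alpha> < y\<close>
      by (intro mult_left_mono integral_subset_le integrable_continuous_real continuous_intros hc) auto
    also have "\<dots> \<le> (W R - A Up) * h R + R * (h R)\<^sup>2 / 4"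
      using energy_inequality[of \<alpha> R Up 0] R \<open>\<alpha> < y\<close> assms(1) by (simp add: h_def)
    also have "\<dots> \<le> R * ((W R - A Up)\<^sup>2 + (h R)\<^sup>2)"
    proof -
      have "0 \<le> (W R - A Up - h R)\<^sup>2" by simp
      hence "(W R - A Up) * h R \<le> ((W R - A Up)\<^sup>2 + (h R)\<^sup>2) / 2"
        by (simp add: power2_eq_square algebra_simps)
      moreover have "1 * (((W R - A Up)\<^sup>2 + (h R)\<^sup>2) / 2) \<le> R * (((W R - A Up)\<^sup>2 + (h R)\<^sup>2) / 2)"
        using R(1) by (intro mult_right_mono) auto
      moreover have "R * (h R)\<^sup>2 / 4 \<le> R * ((W R - A Up)\<^sup>2 + (h R)\<^sup>2) / 2"
        using R(1) by (simp add: field_simps)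
      ultimately show ?thesis by (simp add: field_simps)
    qed
    finally show ?thesis using R' that by simp
  qed
  hence "integral {\<alpha>..y} (\<lambda>y. (h y)\<^sup>2) \<le> 0" by (rule field_le_epsilon)
  from integral_square_le_0_imp_zero[OF hc this assms(2) order_refl \<open>\<alpha> < y\<close>]
  show ?thesis by (simp add: h_def)
qed (use assms in simp)

lemma contact_left_asymptote:
  assumes "X \<beta> = Um * \<beta>" "y \<le> \<beta>"
  shows "X y = Um * y"
  using weak_profile.contact_right_asymptote[OF weak_profile_reflect, of "- \<beta>" "- y"] assms by simp

text \<open>
  On a line through the origin the identity \<open>W = c0 + Z - y X / 2\<close> reduces to \<open>W = c0\<close>, and
  \<open>W\<close> comes arbitrarily close to \<open>A Up\<close>.
\<close>

lemma level_if_flat_right: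
  assumes "\<And>y. 0 \<le> y \<Longrightarrow> X y = Up * y"
  shows "c0 = A Up"
proof -
  have Weq: "c0 + Z R - R * X R / 2 = c0" if "0 \<le> R" for R
  proof -
    have "integral {0..R} X = integral {0..R} (\<lambda>y. Up * y)"
      by (rule integral_cong) (use assms in auto)
    also have "\<dots> = Up * integral {0..R} (\<lambda>y. y)" by simp
    also have "integral {0..R} (\<lambda>y. y) = R\<^sup>2 / 2"
      using that ident_has_integral[of 0 R] by (simp add: integral_unique)
    finally show ?thesis
      using has_ac_derivD(2)[OF Z that] Z0 assms[OF that] by (simp add: power2_eq_square)
  qed
  have "(c0 - A Up)\<^sup>2 \<le> 0 + \<epsilon>" if e: "0 < \<epsilon>" for \<epsilon>
  proof -
    obtain R where R: "R \<ge> 1" "R * ((c0 + Z R - R * X R / 2 - A Up)\<^sup>2 + (X R - Up * R)\<^sup>2) < \<epsilon>"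
      using decay_right[OF e, of 1] by auto
    have "1 * (c0 - A Up)\<^sup>2 \<le> R * (c0 - A Up)\<^sup>2" using R(1) by (intro mult_right_mono) auto
    moreover have "c0 + Z R - R * X R / 2 = c0" "X R - Up * R = 0"
      using Weq[of R] assms[of R] R(1) by auto
    with R(2) have "R * ((c0 - A Up)\<^sup>2 + 0\<^sup>2) < \<epsilon>" by (simp only:)
    ultimately show ?thesis by simp
  qed
  hence "(c0 - A Up)\<^sup>2 \<le> 0" by (rule field_le_epsilon)
  thus ?thesis by simp
qed

lemma near_right_asymptote:
  assumes "0 < \<epsilon>"
  obtains R where "N \<le> R" "1 \<le> R" "\<bar>X R - Up * R\<bar> < \<epsilon>"
proof -
  obtain R where R: "R \<ge> max N 1"
    "R * ((c0 + Z R - R * X R / 2 - A Up)\<^sup>2 + (X R - Up * R)\<^sup>2) < \<epsilon>\<^sup>2"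
    using decay_right[of "\<epsilon>\<^sup>2" "max N 1"] assms by auto
  have "1 * (X R - Up * R)\<^sup>2 \<le> R * (X R - Up * R)\<^sup>2" using R(1) by (intro mult_right_mono) auto
  moreover have "0 \<le> R * (c0 + Z R - R * X R / 2 - A Up)\<^sup>2" using R(1) by simp
  ultimately have "(X R - Up * R)\<^sup>2 < \<epsilon>\<^sup>2" using R(2) by (simp add: distrib_left)
  hence "\<bar>X R - Up * R\<bar>\<^sup>2 < \<epsilon>\<^sup>2" by simp
  hence "\<bar>X R - Up * R\<bar> < \<epsilon>" by (rule power2_less_imp_less) (use assms in simp)
  thus thesis using that R(1) by auto
qed

text \<open>
  If \<open>X 0 = 0\<close>, both asymptotes are attained from the origin on, and \<open>c0\<close> would equal both \<open>A Um\<close> and \<open>A Up\<close>. If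
  \<open>X 0 < 0\<close>, the graph of \<open>X\<close> has to cross the prolonged left asymptote at some \<open>\<beta> > 0\<close> on its way to the right
  asymptote; contact up to \<open>\<beta>\<close> then gives \<open>X 0 = 0\<close>.
\<close>

lemma X0_pos: "0 < X 0"
proof (rule ccontr)
  interpret r: weak_profile "- Up" "- Um" "- c0" "\<lambda>u. - A (- u)" "\<lambda>y. X (- y)" "\<lambda>y. - U (- y)" "\<lambda>y. - Z (- y)"
    by (rule weak_profile_reflect)
  assume "\<not> 0 < X 0"
  then consider "X 0 = 0" | "X 0 < 0" by linarith
  thus False
  proof cases
    case 1
    have "c0 = A Up"
      by (rule level_if_flat_right) (use contact_right_asymptote[of 0] 1 in auto)
    moreover have "- c0 = - A (- (- Um))"
      by (rule r.level_if_flat_right) (use contact_left_asymptote[of 0] 1 in auto)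
    ultimately show False using A_less by simp
  next
    case 2
    obtain R where R: "1 \<le> R" "\<bar>X R - Up * R\<bar> < Up - Um"
      using near_right_asymptote[of "Up - Um" 1] Um_less_Up by auto
    have "1 * (Up - Um) \<le> R * (Up - Um)" using R Um_less_Up by (intro mult_right_mono) auto
    hence "0 \<le> X R - Um * R" using R by (simp add: algebra_simps abs_less_iff)
    hence "\<exists>\<beta>\<ge>0. \<beta> \<le> R \<and> X \<beta> - Um * \<beta> = 0"
      by (intro IVT'[OF _ _ _ X_line_cont]) (use 2 R(1) in simp_all)
    then obtain \<beta> where "0 \<le> \<beta>" "X \<beta> - Um * \<beta> = 0" by blast
    hence "X 0 = Um * 0" using contact_left_asymptote[of \<beta> 0] by simp
    thus False using 2 by simp
  qed
qed

lemma X_ge_right: "0 \<le> y \<Longrightarrow> Up * y \<le> X y"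
proof (rule ccontr)
  assume y: "0 \<le> y" "\<not> Up * y \<le> X y"
  have "\<exists>\<alpha>\<ge>0. \<alpha> \<le> y \<and> X \<alpha> - Up * \<alpha> = 0"
    by (rule IVT2'[OF _ _ _ X_line_cont]) (use y X0_pos in simp_all)
  then obtain \<alpha> where "0 \<le> \<alpha>" "\<alpha> \<le> y" "X \<alpha> - Up * \<alpha> = 0" by blast
  hence "X y = Up * y" using contact_right_asymptote[of \<alpha> y] by simp
  thus False using y by simp
qed

lemma X_ge_left: "y \<le> 0 \<Longrightarrow> Um * y \<le> X y"
  using weak_profile.X_ge_right[OF weak_profile_reflect, of "- y"] by simp

lemma X_ge: "Up * y \<le> X y" "Um * y \<le> X y"
proof -
  have "0 \<le> y \<Longrightarrow> Um * y \<le> Up * y" "y \<le> 0 \<Longrightarrow> Up * y \<le> Um * y"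
    using Um_less_Up by (auto intro: mult_right_mono mult_right_mono_neg)
  thus "Up * y \<le> X y" "Um * y \<le> X y"
    using X_ge_right[of y] X_ge_left[of y] by linarith+
qed

text \<open>
  Otherwise the ray through \<open>(b, X b)\<close> would pass above \<open>(a, X a)\<close> but start below \<open>(0, X 0)\<close>; it would then cut off a
  chord of intercept zero.
\<close>

lemma ray_slope_antimono:
  assumes "0 < a" "a < b"
  shows "X b / b \<le> X a / a"
proof (rule ccontr)
  assume "\<not> X b / b \<le> X a / a"
  define m where "m = X b / b"
  have neg: "X a - m * a < 0" using \<open>\<not> _\<close> assms by (simp add: m_def field_simps)
  have "\<exists>\<alpha>\<ge>0. \<alpha> \<le> a \<and> X \<alpha> - m * \<alpha> = 0"
    by (rule IVT2'[OF _ _ _ X_line_cont]) (use X0_pos neg assms in simp_all)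
  then obtain \<alpha> where \<alpha>: "0 \<le> \<alpha>" "\<alpha> \<le> a" "X \<alpha> - m * \<alpha> = 0" by blast
  have "X a = m * a + 0"
    by (rule chord_contact[of \<alpha> b]) (use \<alpha> assms in \<open>auto simp: m_def\<close>)
  thus False using neg by simp
qed

lemma ray_slope_mono_left:
  assumes "a < b" "b < 0"
  shows "X b / b \<le> X a / a"
  using weak_profile.ray_slope_antimono[OF weak_profile_reflect, of "- b" "- a"] assms by simp

text \<open>
  A line with negative intercept has a strictly increasing slope seen from the origin on \<open>y > 0\<close>, against
  \<open>ray_slope_antimono\<close>; likewise on \<open>y < 0\<close>. If the chord extends over \<open>0\<close>, it is
  above the left asymptote at both ends, since \<open>X\<close> is, and hence also at \<open>0\<close>.
\<close>

lemma chord_intercept_nonneg: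
  assumes "\<alpha> < \<beta>" "X \<alpha> = m * \<alpha> + q" "X \<beta> = m * \<beta> + q"
  shows "0 \<le> q"
proof -
  consider "0 < \<alpha>" | "\<beta> < 0" | "\<alpha> \<le> 0" "0 \<le> \<beta>" using assms(1) by linarith
  thus ?thesis
  proof cases
    case 1
    hence "m + q / \<beta> \<le> m + q / \<alpha>"
      using ray_slope_antimono[OF 1 assms(1)] assms by (simp add: add_divide_distrib)
    hence "q * \<alpha> \<le> q * \<beta>" using 1 assms(1) by (simp add: field_simps)
    thus ?thesis using assms(1) by (smt (verit) mult_left_mono_neg mult_strict_left_mono_neg)
  next
    case 2
    hence "m + q / \<beta> \<le> m + q / \<alpha>"
      using ray_slope_mono_left[OF assms(1) 2] assms by (simp add: add_divide_distrib)
    hence "q * \<alpha> \<le> q * \<beta>" using 2 assms(1) by (simp add: field_simps)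
    thus ?thesis using assms(1) by (smt (verit) mult_left_mono_neg mult_strict_left_mono_neg)
  next
    case 3
    have "0 \<le> (m - Um) * \<alpha> + q" "0 \<le> (m - Um) * \<beta> + q"
      using X_ge(2)[of \<alpha>] X_ge(2)[of \<beta>] assms by (auto simp: algebra_simps)
    moreover have "(m - Um) * \<alpha> \<le> 0 \<or> (m - Um) * \<beta> \<le> 0"
      using 3 by (cases "0 \<le> m - Um") (auto intro: mult_nonneg_nonpos mult_nonpos_nonneg)
    ultimately show ?thesis by linarith
  qed
qed

text \<open>
  On an excursion of \<open>X\<close> above the chord the intercept and \<open>h\<close> are both nonnegative, and \<open>chord_contact\<close>
  forces \<open>h = 0\<close>.
\<close>

lemma X_convex:
  assumes c: "\<alpha> \<le> c" "c \<le> \<beta>" and ab: "\<alpha> < \<beta>"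
  shows "(\<beta> - \<alpha>) * X c \<le> (\<beta> - c) * X \<alpha> + (c - \<alpha>) * X \<beta>"
proof (rule ccontr)
  assume neg: "\<not> ?thesis"
  define m where "m = (X \<beta> - X \<alpha>) / (\<beta> - \<alpha>)"
  define q where "q = X \<alpha> - m * \<alpha>"
  define h where "h y = X y - (m * y + q)" for y
  have m: "m * (\<beta> - \<alpha>) = X \<beta> - X \<alpha>" using ab by (simp add: m_def)
  have "(\<beta> - \<alpha>) * h c = (\<beta> - \<alpha>) * X c - (\<beta> - \<alpha>) * X \<alpha> - (c - \<alpha>) * (m * (\<beta> - \<alpha>))"
    by (simp add: h_def q_def algebra_simps)
  also have "\<dots> = (\<beta> - \<alpha>) * X c - ((\<beta> - c) * X \<alpha> + (c - \<alpha>) * X \<beta>)"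
    unfolding m by (simp add: algebra_simps)
  finally have "0 < (\<beta> - \<alpha>) * h c" using neg by simp
  hence hc: "0 < h c" using ab by (simp add: zero_less_mult_iff)
  have "h \<alpha> = 0" "h \<beta> = 0" using m by (simp_all add: h_def q_def algebra_simps)
  moreover have "continuous_on {\<alpha>..\<beta>} h"
    unfolding h_def by (intro continuous_intros X_cont)
  ultimately obtain a b where ab': "\<alpha> \<le> a" "a < c" "c < b" "b \<le> \<beta>" "h a = 0" "h b = 0"
      "\<And>y. a \<le> y \<Longrightarrow> y \<le> b \<Longrightarrow> 0 \<le> h y"
    using positive_excursion[of \<alpha> \<beta> h c] c hc by blast
  have ends: "X a = m * a + q" "X b = m * b + q" using ab' by (auto simp: h_def)
  have "0 \<le> q" by (rule chord_intercept_nonneg[OF _ ends]) (use ab' in auto)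
  have "X c = m * c + q"
    by (rule chord_contact[OF _ ends]) (use ab' \<open>0 \<le> q\<close> in \<open>auto simp: h_def\<close>)
  thus False using hc by (simp add: h_def)
qed

text \<open>
  By convexity the slope is at most the one between \<open>b\<close> and a far point \<open>R\<close>, where \<open>X\<close> is close to its asymptote.
\<close>

lemma X_slope_le:
  assumes "a < b"
  shows "X b - X a \<le> Up * (b - a)"
proof (rule field_le_epsilon)
  fix \<epsilon> :: real assume "0 < \<epsilon>"
  define \<delta> where "\<delta> = \<epsilon> / (b - a)"
  have "0 < \<delta>" using \<open>0 < \<epsilon>\<close> assms by (simp add: \<delta>_def)
  obtain R where R: "b + 1 \<le> R" "\<bar>X R - Up * R\<bar> < \<delta>"
    using near_right_asymptote[OF \<open>0 < \<delta>\<close>] by blast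
  have "(R - a) * X b \<le> (R - b) * X a + (b - a) * X R"
    by (rule X_convex) (use assms R in auto)
  hence "(R - b) * (X b - X a) \<le> (b - a) * (X R - X b)" by (simp add: algebra_simps)
  also have "\<dots> \<le> (b - a) * (Up * (R - b) + \<delta>)"
    using R X_ge(1)[of b] assms by (intro mult_left_mono) (auto simp: algebra_simps abs_less_iff)
  also have "\<dots> \<le> (b - a) * (Up * (R - b) + (R - b) * \<delta>)"
  proof -
    have "1 * \<delta> \<le> (R - b) * \<delta>" using R \<open>0 < \<delta>\<close> by (intro mult_right_mono) auto
    thus ?thesis using assms by (intro mult_left_mono) auto
  qed
  also have "\<dots> = (R - b) * (Up * (b - a) + \<epsilon>)" using assms by (simp add: \<delta>_def field_simps)
  finally show "X b - X a \<le> Up * (b - a) + \<epsilon>" using R(1) by (simp add: mult_le_cancel_left)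
qed

lemma X_slope_ge:
  assumes "a < b"
  shows "Um * (b - a) \<le> X b - X a"
  using weak_profile.X_slope_le[OF weak_profile_reflect, of "- b" "- a"] assms
  by (simp add: algebra_simps)

lemma U_between: "AE y in lebesgue. U y \<in> {Um..Up}"
proof -
  have "has_ac_deriv (\<lambda>y. X y - Um * y) (\<lambda>y. U y - Um)"
    using has_ac_deriv_diff[OF X has_ac_deriv_cmult[OF has_ac_deriv_ident, of Um]] by simp
  note D1 = this
  have "has_ac_deriv (\<lambda>y. Up * y - X y) (\<lambda>y. Up - U y)"
    using has_ac_deriv_diff[OF has_ac_deriv_cmult[OF has_ac_deriv_ident, of Up] X] by simp
  note D2 = this
  have "AE y in lebesgue. 0 \<le> U y - Um"
  proof (rule AE_nonneg_if_interval_integrals_nonneg)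
    fix a b :: real assume "a \<le> b"
    thus "0 \<le> integral {a..b} (\<lambda>y. U y - Um)"
      using has_ac_derivD(2)[OF D1 \<open>a \<le> b\<close>] X_slope_ge[of a b]
      by (cases "a = b") (simp_all only: right_diff_distrib, auto)
  qed (use has_ac_derivD(1)[OF D1] in auto)
  moreover have "AE y in lebesgue. 0 \<le> Up - U y"
  proof (rule AE_nonneg_if_interval_integrals_nonneg)
    fix a b :: real assume "a \<le> b"
    thus "0 \<le> integral {a..b} (\<lambda>y. Up - U y)"
      using has_ac_derivD(2)[OF D2 \<open>a \<le> b\<close>] X_slope_le[of a b]
      by (cases "a = b") (simp_all only: right_diff_distrib, auto)
  qed (use has_ac_derivD(1)[OF D2] in auto)
  ultimately show ?thesis by eventually_elim auto
qed

end

section \<open>From the weak equation to the integrated equation\<close>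

lemma primitive_has_deriv:
  assumes "continuous_on UNIV E"
  shows "(primitive Um E has_real_derivative E u) (at u)"
proof -
  define a b where "a = min Um u - 1" and "b = max Um u + 1"
  have "((\<lambda>u. LBINT s=Um..u. E s) has_vector_derivative E u) (at u within {a..b})"
    by (rule interval_integral_FTC2)
      (use assms in \<open>auto simp: a_def b_def intro: continuous_on_subset\<close>)
  hence "((\<lambda>u. LBINT s=Um..u. E s) has_vector_derivative E u) (at u)"
    by (subst (asm) at_within_interior) (auto simp: a_def b_def)
  thus ?thesis
    by (simp add: primitive_def[abs_def] has_real_derivative_iff_has_vector_derivative)
qed

lemma primitive_mono:
  assumes "continuous_on UNIV E" "\<And>u. 0 \<le> E u"
  shows "mono (primitive Um E)"
  by (rule monoI, rule DERIV_nonneg_imp_nondecreasing)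
    (use primitive_has_deriv[OF assms(1)] assms(2) in auto)

lemma primitive_Lipschitz:
  assumes "continuous_on UNIV E" "\<And>u. \<bar>E u\<bar> \<le> L"
  shows "\<bar>primitive Um E a - primitive Um E b\<bar> \<le> L * \<bar>a - b\<bar>"
  using field_differentiable_bound[of UNIV "primitive Um E" E L a b]
    primitive_has_deriv[OF assms(1), of Um] assms(2) by (auto intro: has_field_derivative_at_within)

text \<open>
  If \<open>A\<close> took the same value twice, it would be constant in between, and its derivative would vanish on an interval.
\<close>

lemma strict_mono_of_AE_pos_deriv:
  fixes A E :: "real \<Rightarrow> real"
  assumes A: "\<And>u. (A has_real_derivative E u) (at u)"
    and nonneg: "\<And>u. a \<le> u \<Longrightarrow> u \<le> b \<Longrightarrow> 0 \<le> E u"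
    and pos: "AE u in lebesgue. u \<in> {a..b} \<longrightarrow> 0 < E u"
    and "a \<le> x" "x < y" "y \<le> b"
  shows "A x < A y"
proof -
  have mono: "A s \<le> A t" if "x \<le> s" "s \<le> t" "t \<le> y" for s t
    by (rule DERIV_nonneg_imp_nondecreasing[OF that(2)]) (use A nonneg that assms(4,6) in force)
  have "A x \<noteq> A y"
  proof
    assume eq: "A x = A y"
    have flat: "\<not> 0 < E t" if t: "t \<in> {x<..<y}" for t
    proof -
      have "A s = A x" if "s \<in> {x<..<y}" for s
        using mono[of x s] mono[of s y] that eq by auto
      hence "(A has_real_derivative 0) (at t)"
        using t by (intro has_field_derivative_transform_within_open[of "\<lambda>_. A x" 0 t "{x<..<y}" A]) auto
      thus ?thesis using DERIV_unique A by force
    qed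
    have "AE t in lebesgue. t \<notin> {x<..<y}"
      using pos by eventually_elim (use flat assms(4,6) in auto)
    hence "{x<..<y} \<in> null_sets lebesgue"
      by (subst (asm) AE_iff_null_sets[symmetric]) auto
    hence "emeasure lebesgue {x<..<y} = 0" by (rule null_setsD1)
    thus False using \<open>x < y\<close> by simp
  qed
  thus ?thesis using mono[of x y] \<open>x < y\<close> by simp
qed

lemma has_ac_deriv_step: "has_ac_deriv (\<lambda>y. y * step_fun Um Up y) (step_fun Um Up)"
proof (rule has_ac_derivI)
  fix a b :: real assume ab: "a \<le> b"
  show i: "(step_fun Um Up has_integral (b * step_fun Um Up b - a * step_fun Um Up a)) {a..b}"
  proof (rule fundamental_theorem_of_calculus_interior_strong[of "{0}"])
    fix y assume "y \<in> {a<..<b} - {0}"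
    hence "y \<noteq> 0" by simp
    show "((\<lambda>y. y * step_fun Um Up y) has_vector_derivative step_fun Um Up y) (at y)"
    proof (cases "y < 0")
      case True
      have "((\<lambda>y. y * Um) has_vector_derivative Um) (at y)"
        by (auto intro!: derivative_eq_intros simp flip: has_real_derivative_iff_has_vector_derivative)
      thus ?thesis
        by (rule has_vector_derivative_transform_within_open[of _ _ _ "{..<0}", THEN back_subst[of "\<lambda>d. (_ has_vector_derivative d) _"]])
          (use True in \<open>auto simp: step_fun_def\<close>)
    next
      case False
      have "((\<lambda>y. y * Up) has_vector_derivative Up) (at y)"
        by (auto intro!: derivative_eq_intros simp flip: has_real_derivative_iff_has_vector_derivative)
      thus ?thesis
        by (rule has_vector_derivative_transform_within_open[of _ _ _ "{0<..}", THEN back_subst[of "\<lambda>d. (_ has_vector_derivative d) _"]])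
          (use False \<open>y \<noteq> 0\<close> in \<open>auto simp: step_fun_def\<close>)
    qed
  next
    have "(\<lambda>y. y * step_fun Um Up y) = (\<lambda>y. Um * min y 0 + Up * max y 0)"
      by (auto simp: step_fun_def)
    moreover have "continuous_on {a..b} (\<lambda>y. Um * min y 0 + Up * max y 0)"
      by (intro continuous_intros)
    ultimately show "continuous_on {a..b} (\<lambda>y. y * step_fun Um Up y)" by (simp only:)
  qed (use ab in auto)
  show "step_fun Um Up absolutely_integrable_on {a..b}"
    by (rule absolutely_integrable_integrable_bound[where g = "\<lambda>_. \<bar>Um\<bar> + \<bar>Up\<bar>"])
      (use i in \<open>auto simp: step_fun_def intro: integrable_const_ivl\<close>)
qed

lemma Cc_Suc_subset:
  assumes "\<phi> \<in> Cc (Suc k)"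
  shows "\<phi> \<in> Cc k"
proof -
  have "continuous_on UNIV ((deriv ^^ k) \<phi>)"
    using assms unfolding Cc_def
    by (auto intro!: continuous_at_imp_continuous_on field_differentiable_imp_continuous_at)
  thus ?thesis using assms by (auto simp: Cc_def)
qed

lemma deriv_half_ident_mult_Cc:
  assumes "\<phi> \<in> Cc (Suc k)"
  shows "deriv (\<lambda>z. z / 2 * \<phi> z) = (\<lambda>z. 1/2 * \<phi> z + 1 * (z / 2 * deriv \<phi> z))"
  using assms[THEN Cc_has_deriv]
  by (intro ext DERIV_imp_deriv) (auto intro!: derivative_eq_intros)

lemma Cc_half_ident_mult: "\<phi> \<in> Cc k \<Longrightarrow> (\<lambda>z. z / 2 * \<phi> z) \<in> Cc k"
proof (induction k arbitrary: \<phi>)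
  case 0
  have "bounded {z. z / 2 * \<phi> z \<noteq> 0}"
    by (rule bounded_subset[of "{x. \<phi> x \<noteq> 0}"]) (use 0 in \<open>auto simp: Cc_0_iff\<close>)
  thus ?case using 0 by (auto simp: Cc_0_iff intro!: continuous_intros)
next
  case (Suc k)
  have "bounded {z. z / 2 * \<phi> z \<noteq> 0}"
    by (rule bounded_subset[of "{x. \<phi> x \<noteq> 0}"]) (use Suc.prems in \<open>auto simp: Cc_Suc_iff\<close>)
  moreover have "((\<lambda>z. z / 2 * \<phi> z) has_real_derivative (1/2 * \<phi> z + 1 * (z / 2 * deriv \<phi> z))) (at z)" for z
    using Suc.prems[THEN Cc_has_deriv] by (auto intro!: derivative_eq_intros)
  moreover have "deriv (\<lambda>z. z / 2 * \<phi> z) \<in> Cc k"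
    unfolding deriv_half_ident_mult_Cc[OF Suc.prems]
    by (intro Cc_lincomb Cc_Suc_subset[OF Suc.prems] Suc.IH Cc_deriv[OF Suc.prems])
  ultimately show ?case by (auto simp: Cc_Suc_iff field_differentiable_def)
qed

text \<open>
  A function that stays above \<open>\<epsilon> / y\<close> near infinity is not integrable.
\<close>

lemma slow_decay_of_integrable:
  fixes F G :: "real \<Rightarrow> real"
  assumes F: "continuous_on UNIV F" "\<And>y. 0 \<le> F y"
    and G: "integrable lebesgue G" and le: "AE y in lebesgue. 0 \<le> y \<longrightarrow> F y \<le> G y" and "0 < \<epsilon>"
  shows "\<exists>R\<ge>N. R * F R < \<epsilon>"
proof (rule ccontr)
  assume neg: "\<not> (\<exists>R\<ge>N. R * F R < \<epsilon>)"
  define a where "a = max N 1"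
  have lower: "\<epsilon> / y \<le> F y" if "a \<le> y" for y
    using neg that by (auto simp: a_def not_less field_simps)
  define C where "C = (LINT y|lebesgue. \<bar>G y\<bar>)"
  (* chosen such that the integral of \<epsilon> / y over {a..b} is C + 1 *)
  define b where "b = a * exp ((C + 1) / \<epsilon>)"
  have C: "0 \<le> C" by (simp add: C_def)
  have a: "1 \<le> a" by (simp add: a_def)
  have ab: "a \<le> b"
    unfolding b_def using a C \<open>0 < \<epsilon>\<close> by (intro mult_le_cancel_left1[THEN iffD2]) auto
  have "((\<lambda>y. \<epsilon> / y) has_integral (\<epsilon> * ln b - \<epsilon> * ln a)) {a..b}"
    by (rule fundamental_theorem_of_calculus[OF ab])
      (use a in \<open>auto intro!: derivative_eq_intros simp flip: has_real_derivative_iff_has_vector_derivative\<close>)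
  moreover have "\<epsilon> * ln b - \<epsilon> * ln a = C + 1"
    using a \<open>0 < \<epsilon>\<close> by (simp add: b_def ln_mult distrib_left distrib_right add_divide_distrib)
  ultimately have I: "((\<lambda>y. \<epsilon> / y) has_integral (C + 1)) {a..b}" by simp
  have Fi: "F absolutely_integrable_on {a..b}"
    using F(1) by (intro absolutely_integrable_continuous_real) (auto intro: continuous_on_subset)
  have "C + 1 \<le> integral {a..b} F"
    by (rule has_integral_le[OF I integrable_integral])
      (use lower Fi in \<open>auto dest: set_lebesgue_integral_eq_integral(1)\<close>)
  also have "\<dots> = (LINT y|lebesgue. indicator {a..b} y *\<^sub>R F y)"
    using set_lebesgue_integral_eq_integral(2)[OF Fi] by (simp add: set_lebesgue_integral_def)
  also have "\<dots> \<le> C"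
    unfolding C_def
  proof (rule integral_mono_AE)
    show "integrable lebesgue (\<lambda>y. indicator {a..b} y *\<^sub>R F y)"
      using Fi by (simp add: set_integrable_def)
    show "AE y in lebesgue. indicator {a..b} y *\<^sub>R F y \<le> \<bar>G y\<bar>"
      using le by eventually_elim (use a in \<open>auto simp: indicator_def\<close>)
  qed (use G in auto)
  finally show False by simp
qed

lemma abs_powr_2: "\<bar>x::real\<bar> powr 2 = x\<^sup>2"
  by (cases "x = 0") (simp_all add: powr_numeral)

text \<open>
  Moving the derivatives in the weak equation onto \<open>X\<close> and \<open>Z\<close> leaves
  \<open>\<integral> (A \<circ> U - Z + y X / 2) \<psi>'' = 0\<close>, so that the bracket is an affine function \<open>c0 + c1 y\<close>. The decay of \<open>v\<close> and \<open>w\<close> in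
  the mean excludes \<open>c1 \<noteq> 0\<close>: all the other terms of the identity are \<open>o(R)\<close> along suitable \<open>R \<rightarrow> \<infinity>\<close>, with
  \<open>\<integral> v\<close> over \<open>[0, R]\<close> controlled by Young's inequality.
\<close>

lemma profile_weak_form:
  assumes less: "Um < Up" and pos: "AE u in lebesgue. u \<in> {Um..Up} \<longrightarrow> 0 < D u"
    and prof: "is_profile D Um Up U"
  obtains E c0 X Z where "admissible_extension D Um Up E"
    "weak_profile Um Up c0 (primitive Um E) X U Z"
proof -
  obtain v w E where v2: "in_Lp 2 v" and w2: "in_Lp 2 w" and wd: "weak_deriv v w"
    and Uw: "AE y in lebesgue. U y = step_fun Um Up y + w y" and Uloc: "in_Lp_loc 2 U"
    and E: "admissible_extension D Um Up E"
    and weak: "\<And>\<psi>. \<psi> \<in> Cc 2 \<Longrightarrow> (LINT y|lebesgue. primitive Um E (U y) * (deriv ^^ 2) \<psi> y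
                                    - U y * deriv (\<lambda>z. z / 2 * \<psi> z) y) = 0"
    using prof by (auto simp: is_profile_def in_H1_with_deriv_def)
  have Ec: "continuous_on UNIV E" and E0: "\<And>u. 0 \<le> E u" and ED: "\<And>u. u \<in> {Um..Up} \<Longrightarrow> E u = D u"
    using E by (auto simp: admissible_extension_def)
  obtain L where L: "\<And>u. \<bar>E u\<bar> \<le> L"
    using E unfolding admissible_extension_def bounded_iff by (metis rangeI real_norm_def)
  define A where "A = primitive Um E"
  have A_deriv: "(A has_real_derivative E u) (at u)" for u
    unfolding A_def by (rule primitive_has_deriv[OF Ec])
  have A_Lip: "\<bar>A a - A b\<bar> \<le> L * \<bar>a - b\<bar>" for a b
    unfolding A_def by (rule primitive_Lipschitz[OF Ec L])
  have A_cont: "continuous_on UNIV A"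
    using A_deriv by (auto intro!: continuous_at_imp_continuous_on DERIV_isCont)
  have [measurable]: "A \<in> borel_measurable borel"
    by (rule borel_measurable_continuous_onI[OF A_cont])
  have "A Um < A Up"
  proof (rule strict_mono_of_AE_pos_deriv[OF A_deriv, of Um Up])
    show "AE u in lebesgue. u \<in> {Um..Up} \<longrightarrow> 0 < E u"
      using pos by eventually_elim (auto simp: ED)
  qed (use E0 less in auto)
  obtain v1 where v1: "has_ac_deriv v1 w" and vv1: "AE y in lebesgue. v y = v1 y"
    using weak_deriv_imp_has_ac_deriv[OF wd] by blast
  have v1c: "continuous_on S v1" for S
    using has_ac_deriv_continuous[OF v1] by (rule continuous_on_subset) auto
  define X where "X y = y * step_fun Um Up y + v1 y" for y
  have X: "has_ac_deriv X U"
    using has_ac_deriv_add[OF has_ac_deriv_step v1]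
    by (rule has_ac_deriv_cong) (use Uw in \<open>auto simp: X_def elim: eventually_mono\<close>)
  have Xc: "continuous_on S X" for S
    using has_ac_deriv_continuous[OF X] by (rule continuous_on_subset) auto
  have Xi: "X absolutely_integrable_on {a..b}" for a b
    by (intro absolutely_integrable_continuous_real Xc)
  obtain Z1 where Z1: "has_ac_deriv Z1 X" using ac_primitive_exists[OF Xi] by blast
  define Z where "Z y = Z1 y - Z1 0" for y
  have Z: "has_ac_deriv Z X"
    using has_ac_deriv_diff[OF Z1 has_ac_deriv_const[of "Z1 0"]] by (simp add: Z_def[abs_def])
  have Zc: "continuous_on S Z" for S
    using has_ac_deriv_continuous[OF Z] by (rule continuous_on_subset) auto
  have Um[measurable]: "U \<in> borel_measurable lebesgue" using Uloc by (simp add: in_Lp_loc_def)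
  have Ui: "U absolutely_integrable_on {a..b}" for a b
    using has_ac_derivD(1)[OF X, of a b] by (cases "a \<le> b") (auto simp: set_integrable_def)
  have AUm: "(\<lambda>y. A (U y)) \<in> borel_measurable lebesgue" by measurable
  have AUi: "(\<lambda>y. A (U y)) absolutely_integrable_on {a..b}" for a b
  proof (rule set_integrable_bound)
    show "(\<lambda>y. \<bar>A 0\<bar> + L * \<bar>U y\<bar>) absolutely_integrable_on {a..b}"
      using set_integrable_abs[OF Ui[of a b]]
      by (intro set_integral_add(1)) auto
    show "set_borel_measurable lebesgue {a..b} (\<lambda>y. A (U y))"
      unfolding set_borel_measurable_def using AUm
      by (intro borel_measurable_scaleR borel_measurable_indicator) auto
    have "norm (A (U y)) \<le> norm (\<bar>A 0\<bar> + L * \<bar>U y\<bar>)" for y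
      using A_Lip[of "U y" 0] by simp
    thus "AE y in lebesgue. y \<in> {a..b} \<longrightarrow> norm (A (U y)) \<le> norm (\<bar>A 0\<bar> + L * \<bar>U y\<bar>)" by simp
  qed
  have Xm: "X \<in> borel_measurable lebesgue"
    using borel_measurable_continuous_onI[OF Xc] by (intro measurable_completion) simp
  have wXU: "weak_deriv X U" by (rule weak_deriv_if_has_ac_deriv[OF X Um])
  have wZX: "weak_deriv Z X" by (rule weak_deriv_if_has_ac_deriv[OF Z Xm])
  let ?f = "\<lambda>y. A (U y) - (Z y - y * X y / 2)"
  have Ki: "(\<lambda>y. Z y - y * X y / 2) absolutely_integrable_on {a..b}" for a b
    by (intro absolutely_integrable_continuous_real continuous_intros Zc Xc) auto
  have XXi: "(\<lambda>y. y * X y / 2) absolutely_integrable_on {a..b}" for a b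
    by (intro absolutely_integrable_continuous_real continuous_intros Xc) auto
  have Zi: "Z absolutely_integrable_on {a..b}" for a b
    by (intro absolutely_integrable_continuous_real Zc)
  have fi: "?f absolutely_integrable_on {a..b}" for a b
    by (intro set_integral_diff(1) AUi Ki)
  have orth: "(LINT y|lebesgue. ?f y * (deriv ^^ 2) \<psi> y) = 0" if \<psi>: "\<psi> \<in> Cc 2" for \<psi>
  proof -
    have \<psi>S: "\<psi> \<in> Cc (Suc (Suc 0))" using \<psi> by (simp add: numeral_2_eq_2)
    have d1: "deriv \<psi> \<in> Cc (Suc 0)" by (rule Cc_deriv[OF \<psi>S])
    have d2: "deriv (deriv \<psi>) \<in> Cc 0" by (rule Cc_deriv[OF d1])
    define \<phi> where "\<phi> = deriv (\<lambda>z. z / 2 * \<psi> z)"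
    have \<phi>: "\<phi> \<in> Cc (Suc 0)"
      unfolding \<phi>_def by (rule Cc_deriv[OF Cc_half_ident_mult[OF \<psi>S]])
    have \<phi>_eq: "\<phi> = (\<lambda>z. 1/2 * \<psi> z + 1 * (z / 2 * deriv \<psi> z))"
      unfolding \<phi>_def by (rule deriv_half_ident_mult_Cc[OF \<psi>S])
    have d\<phi>: "deriv \<phi> = (\<lambda>z. deriv \<psi> z + z / 2 * deriv (deriv \<psi>) z)"
      unfolding \<phi>_eq
      unfolding deriv_lincomb_Cc[OF Cc_Suc_subset[OF \<psi>S] Cc_half_ident_mult[OF d1]]
        deriv_half_ident_mult_Cc[OF d1]
      by (simp add: fun_eq_iff)
    have i1: "integrable lebesgue (\<lambda>y. A (U y) * deriv (deriv \<psi>) y)"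
      by (rule integrable_mult_Cc[OF AUi d2])
    have i2: "integrable lebesgue (\<lambda>y. U y * \<phi> y)" by (rule integrable_mult_Cc[OF Ui \<phi>])
    have i3: "integrable lebesgue (\<lambda>y. Z y * deriv (deriv \<psi>) y)" by (rule integrable_mult_Cc[OF Zi d2])
    have i4: "integrable lebesgue (\<lambda>y. y * X y / 2 * deriv (deriv \<psi>) y)" by (rule integrable_mult_Cc[OF XXi d2])
    have i5: "integrable lebesgue (\<lambda>y. X y * deriv \<psi> y)" by (rule integrable_mult_Cc[OF Xi d1])
    have "0 = (LINT y|lebesgue. A (U y) * deriv (deriv \<psi>) y - U y * \<phi> y)"
      using weak[OF \<psi>] by (simp add: A_def \<phi>_def numeral_2_eq_2)
    also have "\<dots> = (LINT y|lebesgue. A (U y) * deriv (deriv \<psi>) y) - (LINT y|lebesgue. U y * \<phi> y)"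
      by (rule Bochner_Integration.integral_diff[OF i1 i2])
    also have "(LINT y|lebesgue. U y * \<phi> y) = - (LINT y|lebesgue. X y * deriv \<phi> y)"
      using wXU \<phi> by (simp add: weak_deriv_def)
    also have "(LINT y|lebesgue. X y * deriv \<phi> y) =
        (LINT y|lebesgue. X y * deriv \<psi> y + y * X y / 2 * deriv (deriv \<psi>) y)"
      by (simp add: d\<phi> algebra_simps)
    also have "\<dots> = (LINT y|lebesgue. X y * deriv \<psi> y) + (LINT y|lebesgue. y * X y / 2 * deriv (deriv \<psi>) y)"
      by (rule Bochner_Integration.integral_add[OF i5 i4])
    also have "(LINT y|lebesgue. X y * deriv \<psi> y) = - (LINT y|lebesgue. Z y * deriv (deriv \<psi>) y)"
      using wZX d1 by (simp add: weak_deriv_def)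
    finally have "0 = (LINT y|lebesgue. A (U y) * deriv (deriv \<psi>) y) -
        ((LINT y|lebesgue. Z y * deriv (deriv \<psi>) y) - (LINT y|lebesgue. y * X y / 2 * deriv (deriv \<psi>) y))"
      by simp
    also have "\<dots> = (LINT y|lebesgue. A (U y) * deriv (deriv \<psi>) y -
        (Z y * deriv (deriv \<psi>) y - y * X y / 2 * deriv (deriv \<psi>) y))"
      using i1 i3 i4 by simp
    also have "\<dots> = (LINT y|lebesgue. ?f y * (deriv ^^ 2) \<psi> y)"
      by (simp add: numeral_2_eq_2 algebra_simps)
    finally show ?thesis by simp
  qed
  obtain c0 c1 where c01: "AE y in lebesgue. ?f y = c0 + c1 * y"
    using AE_affine_if_orthogonal_second_derivs[OF fi orth] by blast
  define W where "W y = c0 + c1 * y + Z y - y * X y / 2" for y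
  have AW: "AE y in lebesgue. A (U y) = W y"
    using c01 by eventually_elim (simp add: W_def)
  have Wc: "continuous_on S W" for S
    unfolding W_def by (intro continuous_intros Zc Xc) auto
  define G where "G y = L\<^sup>2 * (w y)\<^sup>2 + (v y)\<^sup>2" for y
  have vint: "integrable lebesgue (\<lambda>y. (v y)\<^sup>2)" and wint: "integrable lebesgue (\<lambda>y. (w y)\<^sup>2)"
    using v2 w2 by (auto simp: in_Lp_def abs_powr_2)
  have G: "integrable lebesgue G" unfolding G_def using vint wint by auto
  have sq: "(A a - A b)\<^sup>2 \<le> L\<^sup>2 * (a - b)\<^sup>2" for a b
    using power_mono[OF A_Lip[of a b], of 2] by (simp add: power_mult_distrib)
  have right: "AE y in lebesgue. 0 \<le> y \<longrightarrow> (W y - A Up)\<^sup>2 + (X y - Up * y)\<^sup>2 \<le> G y"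
    using AW Uw vv1
  proof eventually_elim
    fix y assume *: "A (U y) = W y" "U y = step_fun Um Up y + w y" "v y = v1 y"
    show "0 \<le> y \<longrightarrow> (W y - A Up)\<^sup>2 + (X y - Up * y)\<^sup>2 \<le> G y"
      using sq[of "U y" Up] * by (auto simp: G_def X_def step_fun_def)
  qed
  have left: "AE y in lebesgue. y < 0 \<longrightarrow> (W y - A Um)\<^sup>2 + (X y - Um * y)\<^sup>2 \<le> G y"
    using AW Uw vv1
  proof eventually_elim
    fix y assume *: "A (U y) = W y" "U y = step_fun Um Up y + w y" "v y = v1 y"
    show "y < 0 \<longrightarrow> (W y - A Um)\<^sup>2 + (X y - Um * y)\<^sup>2 \<le> G y"
      using sq[of "U y" Um] * by (auto simp: G_def X_def step_fun_def)
  qed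
  have decay_right: "\<exists>R\<ge>N. R * ((W R - A Up)\<^sup>2 + (X R - Up * R)\<^sup>2) < \<epsilon>" if "0 < \<epsilon>" for \<epsilon> N
    by (rule slow_decay_of_integrable[OF _ _ G right that]) (auto intro!: continuous_intros Wc Xc)
  have decay_left: "\<exists>R\<ge>N. R * ((W (- R) - A Um)\<^sup>2 + (X (- R) + Um * R)\<^sup>2) < \<epsilon>" if "0 < \<epsilon>" for \<epsilon> N
  proof (rule slow_decay_of_integrable[OF _ _ _ _ that])
    show "continuous_on UNIV (\<lambda>R. (W (- R) - A Um)\<^sup>2 + (X (- R) + Um * R)\<^sup>2)"
      by (intro continuous_intros continuous_on_compose2[OF Wc[of UNIV]] continuous_on_compose2[OF Xc[of UNIV]]) auto
    show "integrable lebesgue (\<lambda>y. G (- y))"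
      using lebesgue_integrable_real_affine[OF G, of "-1" 0] by simp
    have "AE y in lebesgue. y \<noteq> (0::real)" by (intro AE_completion AE_lborel_singleton)
    with AE_reflect[OF left]
    show "AE y in lebesgue. 0 \<le> y \<longrightarrow> (W (- y) - A Um)\<^sup>2 + (X (- y) + Um * y)\<^sup>2 \<le> G (- y)"
      by eventually_elim auto
  qed auto
  have "c1 = 0"
  proof (rule ccontr)
    assume "c1 \<noteq> 0"
    (* d bounds v1 R and W R - A Up and is the parameter of Young's inequality; each of the two terms
       proportional to R then contributes R * d / 2, and together they stay below |c1| R *)
    define d where "d = \<bar>c1\<bar> / 4"
    have d: "0 < d" using \<open>c1 \<noteq> 0\<close> by (simp add: d_def)
    define M where "M = (LINT y|lebesgue. (v y)\<^sup>2)"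
    define K where "K = d + \<bar>A Up - c0\<bar> + M / (2 * d)"
    obtain R where R: "R \<ge> max 1 (K / d + 1)" "R * ((W R - A Up)\<^sup>2 + (X R - Up * R)\<^sup>2) < d\<^sup>2"
      using decay_right[of "d\<^sup>2" "max 1 (K / d + 1)"] d by auto
    have R1: "1 \<le> R" "K / d + 1 \<le> R" using R(1) by auto
    have "1 * ((W R - A Up)\<^sup>2 + (X R - Up * R)\<^sup>2) \<le> R * ((W R - A Up)\<^sup>2 + (X R - Up * R)\<^sup>2)"
      using R1(1) by (intro mult_right_mono) auto
    hence "(W R - A Up)\<^sup>2 + (v1 R)\<^sup>2 < d\<^sup>2"
      using R(2) R1(1) by (simp add: X_def step_fun_def mult.commute)
    moreover have "0 \<le> (W R - A Up)\<^sup>2" "0 \<le> (v1 R)\<^sup>2" by simp_all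
    ultimately have "(W R - A Up)\<^sup>2 < d\<^sup>2" "(v1 R)\<^sup>2 < d\<^sup>2" by linarith+
    hence "\<bar>W R - A Up\<bar>\<^sup>2 < d\<^sup>2" "\<bar>v1 R\<bar>\<^sup>2 < d\<^sup>2" by simp_all
    hence small: "\<bar>W R - A Up\<bar> < d" "\<bar>v1 R\<bar> < d"
      using d by (auto intro: power2_less_imp_less)
    define V where "V = integral {0..R} v1"
    have v1i: "v1 integrable_on {a..b}" "(\<lambda>y. (v1 y)\<^sup>2) absolutely_integrable_on {a..b}" for a b
      by (auto intro!: integrable_continuous_real absolutely_integrable_continuous_real continuous_intros v1c)
    have "integral {0..R} (\<lambda>y. (v1 y)\<^sup>2) = (LINT y|lebesgue. indicator {0..R} y *\<^sub>R (v1 y)\<^sup>2)"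
      using set_lebesgue_integral_eq_integral(2)[OF v1i(2)] by (simp add: set_lebesgue_integral_def)
    also have "\<dots> \<le> M"
      unfolding M_def
    proof (rule integral_mono_AE)
      show "integrable lebesgue (\<lambda>y. indicator {0..R} y *\<^sub>R (v1 y)\<^sup>2)"
        using v1i(2) by (simp add: set_integrable_def)
      show "AE y in lebesgue. indicator {0..R} y *\<^sub>R (v1 y)\<^sup>2 \<le> (v y)\<^sup>2"
        using vv1 by eventually_elim (simp add: indicator_def)
    qed (rule vint)
    finally have vM: "integral {0..R} (\<lambda>y. (v1 y)\<^sup>2) \<le> M" .
    have young: "\<bar>t\<bar> \<le> d / 2 + t\<^sup>2 / (2 * d)" for t
    proof -
      have "0 \<le> (\<bar>t\<bar> - d)\<^sup>2" by simp
      hence "2 * d * \<bar>t\<bar> \<le> d\<^sup>2 + t\<^sup>2" by (simp add: power2_eq_square algebra_simps)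
      thus ?thesis using d by (simp add: field_simps power2_eq_square)
    qed
    have "\<bar>V\<bar> \<le> integral {0..R} (\<lambda>y. d / 2 + (v1 y)\<^sup>2 / (2 * d))"
      unfolding V_def real_norm_def[symmetric]
      by (rule integral_norm_bound_integral)
        (use young d in \<open>auto intro!: integrable_continuous_real continuous_intros v1c\<close>)
    also have "\<dots> = R * d / 2 + integral {0..R} (\<lambda>y. (v1 y)\<^sup>2) / (2 * d)"
      using R1(1) d set_lebesgue_integral_eq_integral(1)[OF v1i(2)]
      by (subst integral_add) (auto intro!: integrable_on_divide)
    also have "\<dots> \<le> R * d / 2 + M / (2 * d)"
      using vM d by (intro add_left_mono divide_right_mono) auto
    finally have V: "\<bar>V\<bar> \<le> R * d / 2 + M / (2 * d)" .
    have "Z R = integral {0..R} X"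
      using has_ac_derivD(2)[OF Z, of 0 R] R1(1) by (simp add: Z_def)
    also have "\<dots> = integral {0..R} (\<lambda>y. Up * y + v1 y)"
      by (rule integral_cong) (auto simp: X_def step_fun_def)
    also have "\<dots> = Up * integral {0..R} (\<lambda>y. y) + V"
      unfolding V_def using v1i(1) by (subst integral_add) (auto intro!: integrable_continuous_real continuous_intros)
    also have "integral {0..R} (\<lambda>y. y) = R\<^sup>2 / 2"
      using R1(1) ident_has_integral[of 0 R] by (simp add: integral_unique)
    finally have "W R = c0 + c1 * R + V - R * v1 R / 2"
      using R1(1) by (simp add: W_def X_def step_fun_def power2_eq_square algebra_simps)
    hence "c1 * R = (W R - A Up) + (A Up - c0) - V + R * v1 R / 2" by simp
    also have "\<dots> \<le> \<bar>W R - A Up\<bar> + \<bar>A Up - c0\<bar> + \<bar>V\<bar> + \<bar>R * v1 R / 2\<bar>" by linarith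
    finally have 1: "c1 * R \<le> \<bar>W R - A Up\<bar> + \<bar>A Up - c0\<bar> + \<bar>V\<bar> + \<bar>R * v1 R / 2\<bar>" .
    have 2: "- (c1 * R) \<le> \<bar>W R - A Up\<bar> + \<bar>A Up - c0\<bar> + \<bar>V\<bar> + \<bar>R * v1 R / 2\<bar>"
      using \<open>c1 * R = (W R - A Up) + (A Up - c0) - V + R * v1 R / 2\<close> by linarith
    have "\<bar>R * v1 R / 2\<bar> = R * \<bar>v1 R\<bar> / 2" using R1(1) by (simp add: abs_mult)
    also have "\<dots> \<le> R * d / 2" using R1(1) small(2) by (intro divide_right_mono mult_left_mono) auto
    finally have 3: "\<bar>R * v1 R / 2\<bar> \<le> R * d / 2" .
    have "\<bar>c1\<bar> * R = \<bar>c1 * R\<bar>" using R1(1) by (simp add: abs_mult)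
    also have "\<dots> \<le> K + R * d" using 1 2 3 V small(1) unfolding K_def by linarith
    finally have "4 * (R * d) \<le> K + R * d" by (simp add: d_def mult.commute)
    moreover have "K + d \<le> R * d"
      using mult_right_mono[OF R1(2), of d] d by (simp add: distrib_right)
    moreover have "0 \<le> K" using d by (simp add: K_def M_def)
    ultimately show False using d by linarith
  qed
  have "weak_profile Um Up c0 A X U Z"
  proof
    show "mono A" unfolding A_def by (rule primitive_mono[OF Ec E0])
    show "AE y in lebesgue. A (U y) = c0 + Z y - y * X y / 2"
      using AW by eventually_elim (simp add: W_def \<open>c1 = 0\<close>)
    show "Z 0 = 0" by (simp add: Z_def)
    show "\<exists>R\<ge>N. R * ((c0 + Z R - R * X R / 2 - A Up)\<^sup>2 + (X R - Up * R)\<^sup>2) < \<epsilon>" if "0 < \<epsilon>" for \<epsilon> N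
      using decay_right[OF that, of N] by (simp add: W_def \<open>c1 = 0\<close>)
    show "\<exists>R\<ge>N. R * ((c0 + Z (-R) + R * X (-R) / 2 - A Um)\<^sup>2 + (X (-R) + Um * R)\<^sup>2) < \<epsilon>" if "0 < \<epsilon>" for \<epsilon> N
      using decay_left[OF that, of N] by (simp add: W_def \<open>c1 = 0\<close>)
  qed (use less \<open>A Um < A Up\<close> X Z in auto)
  thus thesis using that E by (simp add: A_def)
qed

section \<open>Flux and absolute continuity of a regular profile\<close>

lemma powr_mult_exp_le:
  fixes s \<theta> :: real
  assumes "0 < \<theta>" "\<theta> < 1" "0 < s"
  shows "s powr \<theta> * exp (- (1 - \<theta>) * s) \<le> 1 / (1 - \<theta>)"
proof -
  define c where "c = 1 - \<theta>"
  have c: "0 < c" "c < 1" using assms by (auto simp: c_def)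
  have "c * s \<le> exp (c * s)" using exp_ge_add_one_self[of "c * s"] by linarith
  hence "s \<le> exp (c * s) / c" using c by (simp add: field_simps)
  hence "s powr \<theta> \<le> (exp (c * s) / c) powr \<theta>" using assms by (intro powr_mono2) auto
  also have "\<dots> = exp (c * s * \<theta>) / c powr \<theta>"
    using c by (simp add: powr_divide exp_powr_real)
  finally have "s powr \<theta> * exp (- c * s) \<le> exp (c * s * \<theta>) / c powr \<theta> * exp (- c * s)"
    by (intro mult_right_mono) auto
  also have "\<dots> = exp (- (c * s * c)) / c powr \<theta>"
    by (simp add: c_def algebra_simps flip: exp_add)
  also have "\<dots> \<le> 1 / c powr \<theta>"
    using c assms(3) by (intro divide_right_mono) auto
  also have "\<dots> \<le> 1 / c"
    using c assms powr_mono'[of \<theta> 1 c] by (intro divide_left_mono) auto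
  finally show ?thesis by (simp add: c_def)
qed

text \<open>
  What the convexity argument yields: a continuous monotone \<open>V = X'\<close> with flux \<open>(X - y V) / 2\<close>. Since \<open>Q\<close> is a
  formula in \<open>X\<close> and \<open>V\<close>, it is continuous although \<open>V\<close> need not be differentiable everywhere. Again the data are
  symmetric under reflection.
\<close>

locale regular_profile =
  fixes Um Up :: real and A E V X :: "real \<Rightarrow> real"
  assumes Um_less_Up: "Um < Up"
    and A_deriv: "\<And>u. (A has_real_derivative E u) (at u)"
    and E_cont: "continuous_on UNIV E"
    and E_nonneg: "\<And>u. Um \<le> u \<Longrightarrow> u \<le> Up \<Longrightarrow> 0 \<le> E u"
    and E_pos: "AE u in lebesgue. u \<in> {Um..Up} \<longrightarrow> 0 < E u"
    and V_cont: "continuous_on UNIV V" and V_mono: "mono V"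
    and V_range: "\<And>y. Um \<le> V y" "\<And>y. V y \<le> Up"
    and X_deriv: "\<And>y. (X has_real_derivative V y) (at y)"
    and flux: "\<And>y. ((\<lambda>y. A (V y)) has_real_derivative (X y - y * V y) / 2) (at y)"
    and X0_pos: "0 < X 0"
    and asymptote_right: "\<And>\<epsilon> N. 0 < \<epsilon> \<Longrightarrow> \<exists>R\<ge>N. \<bar>X R - Up * R\<bar> < \<epsilon>"
    and asymptote_left: "\<And>\<epsilon> N. 0 < \<epsilon> \<Longrightarrow> \<exists>R\<ge>N. \<bar>X (- R) + Um * R\<bar> < \<epsilon>"
begin

definition Q where "Q y = (X y - y * V y) / 2"

text \<open>
  Where \<open>E \<circ> V\<close> vanishes the value is \<open>0\<close> by the convention for division, which is harmless: \<open>Q\<close>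
  vanishes almost everywhere there.
\<close>

definition V' where "V' y = Q y / E (V y)"

lemma regular_profile_reflect:
  "regular_profile (- Up) (- Um) (\<lambda>u. - A (- u)) (\<lambda>u. E (- u)) (\<lambda>y. - V (- y)) (\<lambda>y. X (- y))"
proof
  have neg: "(uminus has_real_derivative - 1) (at y)" for y :: real
    by (auto intro!: derivative_eq_intros)
  show "((\<lambda>u. - A (- u)) has_real_derivative E (- u)) (at u)" for u
    using DERIV_minus[OF DERIV_chain2[OF A_deriv neg]] by simp
  show "((\<lambda>y. X (- y)) has_real_derivative - V (- y)) (at y)" for y
    using DERIV_chain2[OF X_deriv neg] by simp
  show "((\<lambda>y. - A (- (- V (- y)))) has_real_derivative (X (- y) - y * - V (- y)) / 2) (at y)" for y
    using DERIV_minus[OF DERIV_chain2[OF flux neg]] by simp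
  show "AE u in lebesgue. u \<in> {- Up..- Um} \<longrightarrow> 0 < E (- u)"
    using AE_reflect[OF E_pos] by eventually_elim auto
  show "continuous_on UNIV (\<lambda>u. E (- u))"
    by (intro continuous_on_compose2[OF E_cont] continuous_intros) auto
  show "continuous_on UNIV (\<lambda>u. - V (- u))"
    by (intro continuous_on_compose2[OF V_cont] continuous_intros) auto
  show "mono (\<lambda>y. - V (- y))" using V_mono by (auto simp: mono_def)
qed (use Um_less_Up E_nonneg V_range X0_pos asymptote_right asymptote_left in auto)

lemma A_less: "Um \<le> x \<Longrightarrow> x < y \<Longrightarrow> y \<le> Up \<Longrightarrow> A x < A y"
  by (rule strict_mono_of_AE_pos_deriv[OF A_deriv E_nonneg E_pos]) auto

lemma Q_cont: "continuous_on S Q"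
proof -
  have "continuous_on S X"
    using X_deriv by (auto intro!: continuous_at_imp_continuous_on DERIV_isCont)
  moreover have "continuous_on S V" using V_cont by (rule continuous_on_subset) auto
  ultimately show ?thesis unfolding Q_def by (intro continuous_intros) auto
qed

lemma X_ge_right_asymptote: "Up * y \<le> X y"
proof (rule ccontr)
  assume neg: "\<not> Up * y \<le> X y"
  then obtain R where R: "y \<le> R" "\<bar>X R - Up * R\<bar> < Up * y - X y"
    using asymptote_right[of "Up * y - X y" y] by auto
  have "X R - Up * R \<le> X y - Up * y"
  proof (rule DERIV_nonpos_imp_nonincreasing[OF R(1)])
    fix x
    have "((\<lambda>x. X x - Up * x) has_real_derivative V x - Up) (at x)"
      by (rule derivative_eq_intros X_deriv refl | simp)+
    thus "\<exists>d. ((\<lambda>x. X x - Up * x) has_real_derivative d) (at x) \<and> d \<le> 0"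
      using V_range(2)[of x] by auto
  qed
  thus False using R neg by linarith
qed

text \<open>
  \<open>2 Q\<close> is the height of \<open>X\<close> above its asymptote plus \<open>y (Up - V y)\<close>.
\<close>

lemma Q_lower_right: "y * (Up - V y) / 2 \<le> Q y"
  using X_ge_right_asymptote[of y] unfolding Q_def
  by (simp add: right_diff_distrib mult.commute)

lemma Q_nonneg_right: "0 \<le> y \<Longrightarrow> 0 \<le> Q y"
  using Q_lower_right[of y] V_range(2)[of y] by (smt (verit) divide_nonneg_pos mult_nonneg_nonneg)

lemma Q_reflect:
  "regular_profile.Q (\<lambda>y. - V (- y)) (\<lambda>y. X (- y)) y = Q (- y)"
  using regular_profile.Q_def[OF regular_profile_reflect, of y] by (simp add: Q_def)

lemma Q_nonneg: "0 \<le> Q y"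
  using Q_nonneg_right[of y] regular_profile.Q_nonneg_right[OF regular_profile_reflect, of "- y"]
  by (cases "0 \<le> y") (auto simp: Q_reflect)

lemma Q0: "Q 0 = X 0 / 2" "0 < Q 0"
  using X0_pos by (auto simp: Q_def)

text \<open>
  If \<open>V\<close> were equal to \<open>Up\<close> from \<open>0\<close> on, \<open>A \<circ> V\<close> would be constant there, whereas its derivative \<open>Q 0\<close> at \<open>0\<close> is positive.
\<close>

lemma V0_less: "V 0 < Up"
proof (rule ccontr)
  assume "\<not> V 0 < Up"
  hence V: "V y = Up" if "0 \<le> y" for y
    using monoD[OF V_mono that] V_range(2)[of y] V_range(2)[of 0] by linarith
  have "((\<lambda>y. A (V y)) has_real_derivative Q 0) (at 0)" using flux[of 0] by (simp add: Q_def)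
  from DERIV_pos_inc_right[OF this Q0(2)] obtain d where d: "0 < d"
      "\<And>h. 0 < h \<Longrightarrow> h < d \<Longrightarrow> A (V 0) < A (V (0 + h))" by blast
  from d(2)[of "d/2"] d(1) V[of 0] V[of "d/2"] show False by simp
qed

lemma V0_greater: "Um < V 0"
  using regular_profile.V0_less[OF regular_profile_reflect] by simp

text \<open>
  The image of the measure \<open>Q dy\<close> under \<open>V\<close> is \<open>E du\<close>. Both sides are equal to the integral of \<open>\<phi>\<close> composed
  with the inverse of \<open>A\<close>, by the substitutions \<open>w = A (V y)\<close> and \<open>w = A u\<close>.
\<close>

lemma change_of_variables:
  fixes \<phi> :: "real \<Rightarrow> real"
  assumes [measurable]: "\<phi> \<in> borel_measurable borel" and ab: "a \<le> b"
  shows "(\<integral>\<^sup>+y. ennreal (\<phi> (V y) * Q y * indicator {a..b} y) \<partial>lborel) =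
         (\<integral>\<^sup>+u. ennreal (\<phi> u * E u * indicator {V a..V b} u) \<partial>lborel)"
proof -
  have inj: "inj_on A {Um..Up}"
    by (rule linorder_inj_onI') (use A_less in force)
  have Ac: "continuous_on S A" for S
    using A_deriv by (auto intro!: continuous_at_imp_continuous_on DERIV_isCont)
  define B where "B = inv_into {Um..Up} A"
  have B: "B (A u) = u" if "u \<in> {Um..Up}" for u
    unfolding B_def using inj that by (rule inv_into_f_f)
  have Bc: "continuous_on (A ` {Um..Up}) B"
    by (rule continuous_on_inv[OF Ac]) (use B in auto)
  define J where "J = {A (V a)..A (V b)}"
  have Jsub: "J \<subseteq> A ` {Um..Up}"
  proof
    fix x assume x: "x \<in> J"
    have "V a \<le> V b" using V_mono ab by (rule monoD)
    with x obtain u where "V a \<le> u" "u \<le> V b" "A u = x"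
      using IVT'[of A "V a" x "V b"] Ac by (auto simp: J_def)
    thus "x \<in> A ` {Um..Up}" using V_range(1)[of a] V_range(2)[of b] by force
  qed
  (* B is only continuous on the image of {Um..Up}; cut off, it is Borel measurable *)
  define B' where "B' x = indicator J x *\<^sub>R B x" for x
  have [measurable]: "B' \<in> borel_measurable borel"
    unfolding B'_def J_def
    by (intro borel_measurable_continuous_on_indicator) (use Bc Jsub in \<open>auto simp: J_def intro: continuous_on_subset\<close>)
  have "(\<lambda>x. indicator J x *\<^sub>R \<phi> (B x)) = (\<lambda>x. indicator J x *\<^sub>R \<phi> (B' x))"
    by (auto simp: B'_def indicator_def)
  moreover have "(\<lambda>x. indicator J x *\<^sub>R \<phi> (B' x)) \<in> borel_measurable borel"
    unfolding J_def by measurable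
  ultimately have meas: "set_borel_measurable borel {A (V a)..A (V b)} (\<lambda>x. \<phi> (B x))"
    by (simp add: set_borel_measurable_def J_def)
  have "(\<integral>\<^sup>+x. ennreal (\<phi> (B x) * indicator {A (V a)..A (V b)} x) \<partial>lborel) =
      (\<integral>\<^sup>+y. ennreal (\<phi> (B (A (V y))) * Q y * indicator {a..b} y) \<partial>lborel)"
    by (rule nn_integral_substitution[OF meas _ Q_cont Q_nonneg ab]) (use flux in \<open>simp add: Q_def\<close>)
  moreover have "(\<integral>\<^sup>+x. ennreal (\<phi> (B x) * indicator {A (V a)..A (V b)} x) \<partial>lborel) =
      (\<integral>\<^sup>+u. ennreal (\<phi> (B (A u)) * E u * indicator {V a..V b} u) \<partial>lborel)"
  proof (rule nn_integral_substitution[OF meas A_deriv])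
    show "continuous_on {V a..V b} E" using E_cont by (rule continuous_on_subset) auto
    show "V a \<le> V b" using V_mono ab by (rule monoD)
    show "0 \<le> E u" if "u \<in> {V a..V b}" for u
      using that V_range(1)[of a] V_range(2)[of b] by (intro E_nonneg) auto
  qed
  moreover have "\<phi> (B (A (V y))) = \<phi> (V y)" for y
    using B[of "V y"] V_range[of y] by simp
  moreover have "\<phi> (B (A u)) * E u * indicator {V a..V b} u = \<phi> u * E u * indicator {V a..V b} u" for u
    using B[of u] V_range(1)[of a] V_range(2)[of b] by (simp add: indicator_def)
  ultimately show ?thesis by simp
qed

lemma [measurable]: "E \<in> borel_measurable borel" "V \<in> borel_measurable borel" "Q \<in> borel_measurable borel"
  using E_cont V_cont Q_cont by (auto intro: borel_measurable_continuous_onI)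

lemma V'_measurable[measurable]: "V' \<in> borel_measurable borel"
  unfolding V'_def[abs_def] by measurable

lemma V'_nonneg: "0 \<le> V' y"
  using Q_nonneg E_nonneg V_range by (simp add: V'_def)

lemma E_pos_lborel: "AE u in lborel. u \<in> {Um..Up} \<longrightarrow> 0 < E u"
  using E_pos by (simp add: AE_completion_iff)

text \<open>
  Change of variables with \<open>\<phi> = 1 / E\<close>; this is where it matters that \<open>E\<close> is positive almost everywhere.
\<close>

lemma has_ac_deriv_V: "has_ac_deriv V V'"
  unfolding has_ac_deriv_def
proof (intro allI impI)
  fix a b :: real assume ab: "a \<le> b"
  have Vab: "V a \<le> V b" using V_mono ab by (rule monoD)
  have "(\<integral>\<^sup>+y. ennreal (V' y * indicator {a..b} y) \<partial>lborel) =
      (\<integral>\<^sup>+y. ennreal (1 / E (V y) * Q y * indicator {a..b} y) \<partial>lborel)"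
    by (simp add: V'_def)
  also have "\<dots> = (\<integral>\<^sup>+u. ennreal (1 / E u * E u * indicator {V a..V b} u) \<partial>lborel)"
    by (rule change_of_variables[OF _ ab]) measurable
  also have "\<dots> = (\<integral>\<^sup>+u. indicator {V a..V b} u \<partial>lborel)"
  proof (rule nn_integral_cong_AE)
    show "AE u in lborel. ennreal (1 / E u * E u * indicator {V a..V b} u) = indicator {V a..V b} u"
      using E_pos_lborel
      by eventually_elim (use V_range(1)[of a] V_range(2)[of b] in \<open>auto simp: indicator_def\<close>)
  qed
  also have "\<dots> = ennreal (V b - V a)" using Vab by simp
  finally have "has_bochner_integral lborel (\<lambda>y. V' y * indicator {a..b} y) (V b - V a)"
    using Vab V'_nonneg by (intro has_bochner_integral_nn_integral) auto
  hence i: "integrable lborel (\<lambda>y. indicator {a..b} y *\<^sub>R V' y)"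
      "(LINT y|lborel. indicator {a..b} y *\<^sub>R V' y) = V b - V a"
    by (auto simp: has_bochner_integral_iff mult.commute)
  have ai: "V' absolutely_integrable_on {a..b}"
    unfolding set_integrable_def using i(1) by (subst integrable_completion) auto
  moreover have "integral {a..b} V' = V b - V a"
    using set_lebesgue_integral_eq_integral(2)[OF ai] i(2)
    by (simp add: set_lebesgue_integral_def integral_completion)
  ultimately show "V' absolutely_integrable_on {a..b} \<and> integral {a..b} V' = V b - V a" ..
qed

text \<open>
  Change of variables with the indicator of the zeros of \<open>E\<close> shows that the flux vanishes almost everywhere on the
  set where \<open>E \<circ> V\<close> does.
\<close>

lemma Q_eq: "AE y in lebesgue. Q y = E (V y) * V' y"
proof (rule AE_completion)
  define \<phi> where "\<phi> u = (indicator {u. E u = 0} u :: real)" for u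
  have [measurable]: "\<phi> \<in> borel_measurable borel" unfolding \<phi>_def by measurable
  have "AE y in lborel. \<phi> (V y) * Q y * indicator {- real n..real n} y = 0" for n
  proof -
    have "(\<integral>\<^sup>+y. ennreal (\<phi> (V y) * Q y * indicator {- real n..real n} y) \<partial>lborel) =
        (\<integral>\<^sup>+u. ennreal (\<phi> u * E u * indicator {V (- real n)..V (real n)} u) \<partial>lborel)"
      by (rule change_of_variables) auto
    also have "\<dots> = (\<integral>\<^sup>+u. 0 \<partial>(lborel :: real measure))"
      by (intro nn_integral_cong) (auto simp: \<phi>_def indicator_def)
    also have "\<dots> = 0" by simp
    finally have "AE y in lborel. ennreal (\<phi> (V y) * Q y * indicator {- real n..real n} y) = 0"
      by (subst (asm) nn_integral_0_iff_AE) auto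
    moreover have "0 \<le> \<phi> (V y) * Q y * indicator {- real n..real n} y" for y
      using Q_nonneg[of y] by (simp add: \<phi>_def indicator_def)
    ultimately show ?thesis
      by (elim eventually_mono) (metis ennreal_eq_0_iff order_antisym)
  qed
  hence "AE y in lborel. \<forall>n. \<phi> (V y) * Q y * indicator {- real n..real n} y = 0"
    unfolding AE_all_countable by blast
  thus "AE y in lborel. Q y = E (V y) * V' y"
  proof eventually_elim
    fix y assume *: "\<forall>n. \<phi> (V y) * Q y * indicator {- real n..real n} y = 0"
    obtain n where "\<bar>y\<bar> \<le> real n" using real_arch_simple by blast
    hence "y \<in> {- real n..real n}" by auto
    with spec[OF *, of n] have "E (V y) = 0 \<longrightarrow> Q y = 0" by (auto simp: \<phi>_def)
    thus "Q y = E (V y) * V' y" by (simp add: V'_def)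
  qed
qed

lemma has_ac_deriv_Q: "has_ac_deriv Q (\<lambda>y. - (y / 2) * V' y)"
proof -
  have X: "has_ac_deriv X V" by (rule has_ac_deriv_C1[OF X_deriv V_cont])
  show ?thesis
    using has_ac_deriv_cmult[OF has_ac_deriv_diff[OF X has_ac_deriv_mult[OF has_ac_deriv_ident has_ac_deriv_V]], of "1/2"]
    by (rule has_ac_deriv_cong) (auto simp: Q_def)
qed

section \<open>Decay of the flux\<close>

lemma X_increment:
  assumes "a \<le> b"
  shows "V a * (b - a) \<le> X b - X a"
proof -
  have "X a - V a * a \<le> X b - V a * b"
  proof (rule DERIV_nonneg_imp_nondecreasing[OF assms])
    fix x assume "a \<le> x"
    have "((\<lambda>x. X x - V a * x) has_real_derivative V x - V a) (at x)"
      by (rule derivative_eq_intros X_deriv refl | simp)+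
    thus "\<exists>d. ((\<lambda>x. X x - V a * x) has_real_derivative d) (at x) \<and> 0 \<le> d"
      using monoD[OF V_mono \<open>a \<le> x\<close>] by auto
  qed
  thus ?thesis by (simp add: algebra_simps)
qed

lemma Q_drop:
  assumes "a \<le> b"
  shows "Q a - Q b \<le> b / 2 * (V b - V a)"
  using X_increment[OF assms] by (simp add: Q_def field_simps)

text \<open>
  The flux as a function of \<open>u = V y\<close> is concave with derivative \<open>- y/2\<close>, hence lies above the chord from
  \<open>(V 0, Q 0)\<close> to \<open>(Up, 0)\<close>. The proof uses only that \<open>X\<close> is above its asymptote and has slope at least \<open>V 0\<close>.
\<close>

lemma Q_chord:
  assumes "0 \<le> y"
  shows "Q 0 * (Up - V y) \<le> Q y * (Up - V 0)"
proof -
  let ?t = "Up - V y" and ?T = "Up - V 0" and ?v = "X y - Up * y"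
  have V: "V 0 \<le> V y" using V_mono assms by (rule monoD)
  have t: "0 \<le> ?t" "?t \<le> ?T" using V V_range(2)[of y] by auto
  have v: "0 \<le> ?v" using X_ge_right_asymptote[of y] by simp
  have "X 0 \<le> ?v + y * ?T" using X_increment[OF assms] by (simp add: algebra_simps)
  hence "X 0 * ?t \<le> (?v + y * ?T) * ?t" using t by (intro mult_right_mono) auto
  also have "\<dots> = ?v * ?t + y * ?t * ?T" by (simp add: algebra_simps)
  also have "\<dots> \<le> ?v * ?T + y * ?t * ?T" using v t by (intro add_right_mono mult_left_mono) auto
  also have "\<dots> = 2 * Q y * ?T" by (simp add: Q_def algebra_simps)
  finally show ?thesis by (simp add: Q0)
qed

context
  fixes M :: real
  assumes E_le: "\<And>u. Um \<le> u \<Longrightarrow> u \<le> Up \<Longrightarrow> E u \<le> M"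
begin

lemma M_pos: "0 < M"
proof (rule ccontr)
  assume "\<not> 0 < M"
  have "A Up \<le> A Um"
  proof (rule DERIV_nonpos_imp_nonincreasing[of Um Up A])
    show "\<exists>y. (A has_real_derivative y) (at x) \<and> y \<le> 0" if "Um \<le> x" "x \<le> Up" for x
      using A_deriv[of x] E_le[OF that] \<open>\<not> 0 < M\<close> by force
  qed (use Um_less_Up in simp)
  thus False using A_less[of Um Up] Um_less_Up by simp
qed

lemma V'_ge: "AE y in lebesgue. Q y / M \<le> V' y"
  using Q_eq
proof eventually_elim
  fix y assume "Q y = E (V y) * V' y"
  also have "\<dots> \<le> M * V' y" using E_le[OF V_range] V'_nonneg by (intro mult_right_mono) auto
  finally show "Q y / M \<le> V' y" using M_pos by (simp add: field_simps)
qed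

text \<open>
  \<open>Q' = - y/2 V' \<le> - y/(2 M) Q\<close>, since \<open>Q = E(V) V' \<le> M V'\<close>.
\<close>

lemma Q_gaussian_decay:
  assumes "0 \<le> y"
  shows "Q y * exp (y\<^sup>2 / (4 * M)) \<le> Q 0"
proof -
  have G: "has_ac_deriv (\<lambda>y. exp (y\<^sup>2 / (4 * M))) (\<lambda>y. y / (2 * M) * exp (y\<^sup>2 / (4 * M)))"
    using M_pos by (intro has_ac_deriv_C1) (auto intro!: derivative_eq_intros continuous_intros simp: field_simps)
  from has_ac_deriv_cmult[OF has_ac_deriv_mult[OF has_ac_deriv_Q G], of "-1"]
  have "-1 * (Q 0 * exp (0\<^sup>2 / (4 * M))) \<le> -1 * (Q y * exp (y\<^sup>2 / (4 * M)))"
  proof (rule has_ac_deriv_mono[OF _ assms])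
    show "AE z in lebesgue. z \<in> {0..y} \<longrightarrow> 0 \<le>
        -1 * (- (z / 2) * V' z * exp (z\<^sup>2 / (4 * M)) + Q z * (z / (2 * M) * exp (z\<^sup>2 / (4 * M))))"
      using V'_ge
    proof eventually_elim
      fix z assume *: "Q z / M \<le> V' z"
      have "-1 * (- (z / 2) * V' z * exp (z\<^sup>2 / (4 * M)) + Q z * (z / (2 * M) * exp (z\<^sup>2 / (4 * M)))) =
          z / 2 * (V' z - Q z / M) * exp (z\<^sup>2 / (4 * M))"
        by (simp add: algebra_simps)
      thus "z \<in> {0..y} \<longrightarrow> 0 \<le>
        -1 * (- (z / 2) * V' z * exp (z\<^sup>2 / (4 * M)) + Q z * (z / (2 * M) * exp (z\<^sup>2 / (4 * M))))"
        using * by (metis (no_types, lifting) atLeastAtMost_iff diff_ge_0_iff_ge divide_nonneg_pos exp_ge_zero mult_nonneg_nonneg zero_less_numeral)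
    qed
  qed
  thus ?thesis by simp
qed

text \<open>
  \<open>V' \<ge> Q / M \<ge> k (Up - V)\<close> by \<open>Q_chord\<close>.
\<close>

lemma V_exponential_approach:
  assumes "0 \<le> y"
  defines "k \<equiv> Q 0 / ((Up - V 0) * M)"
  shows "Up - V y \<le> (Up - V 0) * exp (- k * y)"
proof -
  have T: "0 < Up - V 0" using V0_less by simp
  have G: "has_ac_deriv (\<lambda>y. exp (k * y)) (\<lambda>y. k * exp (k * y))"
    by (intro has_ac_deriv_C1) (auto intro!: derivative_eq_intros continuous_intros)
  have V: "has_ac_deriv (\<lambda>y. V y - Up) V'"
    using has_ac_deriv_diff[OF has_ac_deriv_V has_ac_deriv_const[of Up]] by simp
  from has_ac_deriv_mult[OF V G]
  have "(V 0 - Up) * exp (k * 0) \<le> (V y - Up) * exp (k * y)"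
  proof (rule has_ac_deriv_mono[OF _ assms(1)])
    show "AE z in lebesgue. z \<in> {0..y} \<longrightarrow> 0 \<le> V' z * exp (k * z) + (V z - Up) * (k * exp (k * z))"
      using V'_ge
    proof eventually_elim
      fix z assume *: "Q z / M \<le> V' z"
      show "z \<in> {0..y} \<longrightarrow> 0 \<le> V' z * exp (k * z) + (V z - Up) * (k * exp (k * z))"
      proof
        assume "z \<in> {0..y}"
        hence "Q 0 * (Up - V z) \<le> Q z * (Up - V 0)" by (intro Q_chord) auto
        hence "Q 0 * (Up - V z) / ((Up - V 0) * M) \<le> Q z * (Up - V 0) / ((Up - V 0) * M)"
          using T M_pos by (intro divide_right_mono) auto
        hence "k * (Up - V z) \<le> Q z / M" using T by (simp add: k_def)
        hence "0 \<le> (V' z + (V z - Up) * k) * exp (k * z)"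
          using * by (intro mult_nonneg_nonneg) (auto simp: algebra_simps)
        thus "0 \<le> V' z * exp (k * z) + (V z - Up) * (k * exp (k * z))" by (simp add: algebra_simps)
      qed
    qed
  qed
  hence "(Up - V y) * exp (k * y) \<le> Up - V 0" by (simp add: algebra_simps)
  thus ?thesis by (simp add: exp_minus field_simps)
qed

text \<open>
  \<open>2 Q 0 = X 0\<close> is the integral of \<open>Up - V\<close> over the right half line, which the exponential approach bounds by
  \<open>(Up - V 0) / k\<close>.
\<close>

lemma Q0_bound: "2 * (Q 0)\<^sup>2 \<le> M * (Up - V 0)\<^sup>2"
proof -
  define T where "T = Up - V 0"
  define k where "k = Q 0 / (T * M)"
  have T: "0 < T" using V0_less by (simp add: T_def)
  have k: "0 < k" using T M_pos Q0 by (simp add: k_def)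
  have "X 0 - T / k \<le> 0 + \<epsilon>" if e: "0 < \<epsilon>" for \<epsilon>
  proof -
    obtain R where R: "0 \<le> R" "\<bar>X R - Up * R\<bar> < \<epsilon>" using asymptote_right[OF e, of 0] by blast
    have "X 0 - Up * 0 - T / k * exp (- k * 0) \<le> X R - Up * R - T / k * exp (- k * R)"
    proof (rule DERIV_nonneg_imp_nondecreasing[OF R(1)])
      fix x :: real assume "0 \<le> x"
      have "((\<lambda>x. X x - Up * x - T / k * exp (- k * x)) has_real_derivative
          V x - Up + T * exp (- k * x)) (at x)"
        by (rule derivative_eq_intros X_deriv refl | (use k in simp))+
      thus "\<exists>d. ((\<lambda>x. X x - Up * x - T / k * exp (- k * x)) has_real_derivative d) (at x) \<and> 0 \<le> d"
        using V_exponential_approach[OF \<open>0 \<le> x\<close>] unfolding k_def T_def by force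
    qed
    moreover have "0 \<le> T / k * exp (- k * R)" using T k by simp
    ultimately show ?thesis using R(2) by (simp add: abs_less_iff)
  qed
  hence "X 0 - T / k \<le> 0" by (rule field_le_epsilon)
  moreover have "T / k = T\<^sup>2 * M / Q 0" by (simp add: k_def power2_eq_square)
  moreover have "X 0 = 2 * Q 0" by (simp add: Q0)
  ultimately have "2 * Q 0 \<le> T\<^sup>2 * M / Q 0" by linarith
  thus ?thesis using Q0(2) by (simp add: T_def field_simps power2_eq_square)
qed

text \<open>
  Put \<open>T = Up - V 0\<close>, \<open>t = Up - V y\<close> and \<open>Q y = 2 Q 0 exp (- L)\<close>. By \<open>Q_drop\<close> from \<open>y\<close> to the point \<open>Y\<close> at which
  the Gaussian equals \<open>Q y / 2\<close> one has \<open>Q y \<le> Y t\<close>, that is \<open>(Q y)\<^sup>2 \<le> 2 M t\<^sup>2 (2 L)\<close>. On the other hand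
  \<open>(Q y)\<^sup>2 \<le> 2 M T\<^sup>2 exp (- 2 L)\<close> by \<open>Q0_bound\<close>. The geometric mean of both with weights \<open>\<theta>\<close> and \<open>1 - \<theta>\<close> has the
  right powers of \<open>t\<close> and \<open>T\<close>, and \<open>powr_mult_exp_le\<close> bounds the remaining factor uniformly in \<open>L\<close>.
\<close>

lemma flux_bound_by_right_gap:
  assumes "0 < \<theta>" "\<theta> < 1" "0 \<le> y"
  shows "Q y \<le> sqrt (2 * M / (1 - \<theta>)) * ((Up - V 0) powr (1 - \<theta>) * (Up - V y) powr \<theta>)"
proof (cases "Q y = 0")
  case True
  have "0 \<le> 2 * M / (1 - \<theta>)" using M_pos assms by simp
  thus ?thesis using True by simp
next
  case False
  hence q: "0 < Q y" using Q_nonneg[of y] by simp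
  define T t where "T = Up - V 0" and "t = Up - V y"
  have T: "0 < T" using V0_less by (simp add: T_def)
  have t0: "0 \<le> t" using V_range(2) by (simp add: t_def)
  define L where "L = ln (2 * Q 0 / Q y)"
  (* the point where the Gaussian bound equals Q y / 2 *)
  define Y where "Y = sqrt (4 * M * L)"
  have gauss: "Q y * exp (y\<^sup>2 / (4 * M)) \<le> Q 0" by (rule Q_gaussian_decay[OF assms(3)])
  have "exp (y\<^sup>2 / (4 * M)) < 2 * Q 0 / Q y"
    using gauss q Q0(2) by (simp add: field_simps)
  hence yL: "y\<^sup>2 / (4 * M) < L"
    unfolding L_def using q Q0(2) by (subst ln_exp[symmetric], subst ln_less_cancel_iff) auto
  have L: "0 < L" using yL M_pos by (smt (verit) divide_nonneg_pos zero_le_power2)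
  have Y2: "Y\<^sup>2 = 4 * M * L" using L M_pos by (simp add: Y_def)
  have yY: "y \<le> Y"
    unfolding Y_def using yL M_pos by (intro real_le_rsqrt) (simp add: field_simps)
  have "Q Y * exp (Y\<^sup>2 / (4 * M)) \<le> Q 0" by (rule Q_gaussian_decay) (use yY assms(3) in simp)
  moreover have "exp (Y\<^sup>2 / (4 * M)) = 2 * Q 0 / Q y"
    using Y2 M_pos q Q0(2) by (simp add: L_def)
  ultimately have "Q Y * (2 * Q 0 / Q y) \<le> Q 0" by simp
  hence "(2 * Q Y) * Q 0 \<le> Q y * Q 0" using q by (simp add: field_simps)
  hence "Q Y \<le> Q y / 2" using Q0(2) by simp
  moreover have "Q y - Q Y \<le> Y / 2 * t"
  proof -
    have "Q y - Q Y \<le> Y / 2 * (V Y - V y)" by (rule Q_drop[OF yY])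
    also have "\<dots> \<le> Y / 2 * t"
      using V_range(2)[of Y] yY assms(3) by (intro mult_left_mono) (auto simp: t_def)
    finally show ?thesis .
  qed
  ultimately have qY: "Q y \<le> Y * t" by simp
  hence t: "0 < t" using q t0 by (cases "t = 0") auto
  have "(Q y)\<^sup>2 \<le> (Y * t)\<^sup>2" using qY q by (intro power_mono) auto
  also have "\<dots> = 2 * M * t\<^sup>2 * (2 * L)" using Y2 by (simp add: power_mult_distrib)
  finally have b1: "(Q y)\<^sup>2 \<le> 2 * M * t\<^sup>2 * (2 * L)" .
  have "exp (- L) = Q y / (2 * Q 0)"
    using q Q0(2) by (simp add: L_def exp_minus)
  hence "Q y = 2 * Q 0 * exp (- L)" using Q0(2) by simp
  hence "(Q y)\<^sup>2 = 2 * (2 * (Q 0)\<^sup>2) * exp (- (2 * L))"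
    by (simp add: power_mult_distrib flip: exp_double)
  also have "\<dots> \<le> 2 * (M * T\<^sup>2) * exp (- (2 * L))"
    using Q0_bound by (intro mult_right_mono mult_left_mono) (auto simp: T_def)
  finally have b2: "(Q y)\<^sup>2 \<le> 2 * M * T\<^sup>2 * exp (- (2 * L))" by simp
  have sqrt_powr: "x\<^sup>2 powr a = x powr (2 * a)" if "0 < x" for x a :: real
    using that by (simp add: powr_powr flip: powr_numeral)
  define s where "s = 2 * L"
  have s: "0 < s" using L by (simp add: s_def)
  have "(Q y)\<^sup>2 = (Q y)\<^sup>2 powr \<theta> * (Q y)\<^sup>2 powr (1 - \<theta>)"
    using q by (simp flip: powr_add)
  also have "\<dots> \<le> (2 * M * t\<^sup>2 * s) powr \<theta> * (2 * M * T\<^sup>2 * exp (- s)) powr (1 - \<theta>)"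
    using b1 b2 assms unfolding s_def by (intro mult_mono powr_mono2) auto
  also have "\<dots> = ((2 * M) powr \<theta> * (2 * M) powr (1 - \<theta>)) * (t powr \<theta> * T powr (1 - \<theta>))\<^sup>2 *
      (s powr \<theta> * exp (- (1 - \<theta>) * s))"
    using M_pos T t s assms
    by (simp add: powr_mult sqrt_powr exp_powr_real power_mult_distrib powr_power mult.commute mult.left_commute mult.assoc)
      (simp add: algebra_simps)
  also have "(2 * M) powr \<theta> * (2 * M) powr (1 - \<theta>) = 2 * M"
    using M_pos by (simp flip: powr_add)
  also have "2 * M * (t powr \<theta> * T powr (1 - \<theta>))\<^sup>2 * (s powr \<theta> * exp (- (1 - \<theta>) * s)) \<le>
      2 * M * (t powr \<theta> * T powr (1 - \<theta>))\<^sup>2 * (1 / (1 - \<theta>))"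
    using powr_mult_exp_le[OF assms(1,2), of s] s M_pos by (intro mult_left_mono) auto
  also have "\<dots> = (sqrt (2 * M / (1 - \<theta>)) * (T powr (1 - \<theta>) * t powr \<theta>))\<^sup>2"
    using M_pos assms by (simp add: power_mult_distrib)
  finally show ?thesis
    unfolding T_def t_def by (rule power2_le_imp_le) (use M_pos assms in simp)
qed

end

end

section \<open>Extinction and the bound for the derivative\<close>

lemma set_integral_strict_mono:
  fixes f :: "real \<Rightarrow> real"
  assumes f: "set_integrable lebesgue {a..c} f" and pos: "AE u in lebesgue. u \<in> {a..c} \<longrightarrow> 0 < f u"
    and "a \<le> b" "b < c"
  shows "(LINT u:{a..b}|lebesgue. f u) < (LINT u:{a..c}|lebesgue. f u)"
proof -
  let ?g = "\<lambda>u. indicat_real {a..c} u *\<^sub>R f u - indicat_real {a..b} u *\<^sub>R f u"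
  have "set_integrable lebesgue {a..b} f"
    by (rule set_integrable_subset[OF f]) (use \<open>b < c\<close> in auto)
  hence i: "integrable lebesgue (\<lambda>u. indicat_real {a..b} u *\<^sub>R f u)"
      "integrable lebesgue (\<lambda>u. indicat_real {a..c} u *\<^sub>R f u)"
    using f by (simp_all add: set_integrable_def)
  have ge: "AE u in lebesgue. 0 \<le> ?g u"
    using pos by eventually_elim (use \<open>b < c\<close> in \<open>auto simp: indicator_def\<close>)
  have "(LINT u|lebesgue. ?g u) \<noteq> 0"
  proof
    assume "(LINT u|lebesgue. ?g u) = 0"
    hence "AE u in lebesgue. ?g u = 0"
      using integral_nonneg_eq_0_iff_AE[OF Bochner_Integration.integrable_diff[OF i(2,1)] ge] by simp
    with pos have "AE u in lebesgue. u \<notin> {b<..c}"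
      by eventually_elim (use \<open>a \<le> b\<close> in \<open>auto simp: indicator_def\<close>)
    hence "{b<..c} \<in> null_sets lebesgue"
      by (subst (asm) AE_iff_null_sets[symmetric]) auto
    hence "emeasure lebesgue {b<..c} = 0" by (rule null_setsD1)
    thus False using \<open>b < c\<close> by simp
  qed
  moreover have "0 \<le> (LINT u|lebesgue. ?g u)" using ge by (rule integral_nonneg_AE)
  moreover have "(LINT u|lebesgue. ?g u) =
      (LINT u:{a..c}|lebesgue. f u) - (LINT u:{a..b}|lebesgue. f u)"
    unfolding set_lebesgue_integral_def by (rule Bochner_Integration.integral_diff[OF i(2,1)])
  ultimately show ?thesis by simp
qed

lemma set_integrable_lebesgue_reflect:
  fixes f :: "real \<Rightarrow> real"
  shows "set_integrable lebesgue {- b..- a} (\<lambda>u. f (- u)) \<longleftrightarrow> set_integrable lebesgue {a..b} f"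
    "(LINT u:{- b..- a}|lebesgue. f (- u)) = (LINT u:{a..b}|lebesgue. f u)"
proof -
  have ind: "indicator {- b..- a} u = (indicator {a..b} (- u) :: real)" for u :: real
    by (auto simp: indicator_def)
  show "set_integrable lebesgue {- b..- a} (\<lambda>u. f (- u)) \<longleftrightarrow> set_integrable lebesgue {a..b} f"
    unfolding set_integrable_def ind
    using lebesgue_integrable_real_affine_iff[of "-1" "\<lambda>u. indicator {a..b} u *\<^sub>R f u" 0] by simp
  show "(LINT u:{- b..- a}|lebesgue. f (- u)) = (LINT u:{a..b}|lebesgue. f u)"
    unfolding set_lebesgue_integral_def ind
    using lebesgue_integral_real_affine[of "-1" "\<lambda>u. indicator {a..b} u *\<^sub>R f u" 0] by simp
qed

context regular_profile
begin

text \<open>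
  If \<open>V y < Up\<close>, then integrating \<open>Q 0 / (Up - V 0) \<le> Q / (Up - V)\<close> over \<open>[0, y]\<close> and changing variables gives
  \<open>y Q 0 / (Up - V 0) \<le> \<integral> E / (Up - u)\<close> over \<open>[V 0, V y]\<close>, which is strictly less than the integral up to \<open>Up\<close>.
\<close>

lemma extinction_right:
  assumes int: "set_integrable lebesgue {V 0..Up} (\<lambda>u. E u / (Up - u))"
  defines "I \<equiv> LINT u:{V 0..Up}|lebesgue. E u / (Up - u)"
  shows "0 < I" and "(Up - V 0) / Q 0 * I \<le> y \<Longrightarrow> V y = Up"
proof -
  have T: "0 < Up - V 0" using V0_less by simp
  have "AE u in lebesgue. u \<noteq> Up" by (intro AE_completion AE_lborel_singleton)
  with E_pos have pos: "AE u in lebesgue. u \<in> {V 0..Up} \<longrightarrow> 0 < E u / (Up - u)"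
    by eventually_elim (use V0_greater in auto)
  have "(LINT u:{V 0..V 0}|lebesgue. E u / (Up - u)) < I"
    unfolding I_def by (rule set_integral_strict_mono[OF int pos]) (use V0_less in auto)
  moreover have "(LINT u:{V 0..V 0}|lebesgue. E u / (Up - u)) = 0"
  proof -
    have "AE u in lebesgue. u \<noteq> V 0" by (intro AE_completion AE_lborel_singleton)
    hence "AE u in lebesgue. indicat_real {V 0} u *\<^sub>R (E u / (Up - u)) = 0"
      by eventually_elim simp
    thus ?thesis unfolding set_lebesgue_integral_def by (simp add: integral_eq_zero_AE)
  qed
  ultimately show "0 < I" by simp
  assume y: "(Up - V 0) / Q 0 * I \<le> y"
  show "V y = Up"
  proof (rule ccontr)
    assume "V y \<noteq> Up"
    hence Vy: "V y < Up" using V_range(2)[of y] by simp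
    have "0 \<le> (Up - V 0) / Q 0 * I" using T Q0(2) \<open>0 < I\<close> by simp
    hence y0: "0 \<le> y" using y by linarith
    have V0y: "V 0 \<le> V y" using V_mono y0 by (rule monoD)
    define J where "J = (LINT u:{V 0..V y}|lebesgue. E u / (Up - u))"
    have "J < I"
      unfolding I_def J_def by (rule set_integral_strict_mono[OF int pos V0y Vy])
    have i: "integrable lebesgue (\<lambda>u. 1 / (Up - u) * E u * indicator {V 0..V y} u)"
      using set_integrable_subset[OF int, of "{V 0..V y}"] Vy
      by (simp add: set_integrable_def mult.commute)
    have J_eq: "J = (LINT u|lebesgue. 1 / (Up - u) * E u * indicator {V 0..V y} u)"
      by (simp add: J_def set_lebesgue_integral_def mult.commute)
    have nn: "0 \<le> 1 / (Up - u) * E u * indicator {V 0..V y} u" for u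
      using Vy V0_greater E_nonneg[of u] by (auto simp: indicator_def)
    have "J \<ge> 0" unfolding J_eq by (rule integral_nonneg_AE) (use nn in auto)
    have "ennreal (y * (Q 0 / (Up - V 0))) = (\<integral>\<^sup>+z. ennreal (Q 0 / (Up - V 0)) * indicator {0..y} z \<partial>lborel)"
      using y0 Q0(2) T by (subst nn_integral_cmult_indicator) (auto simp: mult.commute simp flip: ennreal_mult)
    also have "\<dots> \<le> (\<integral>\<^sup>+z. ennreal (1 / (Up - V z) * Q z * indicator {0..y} z) \<partial>lborel)"
    proof (rule nn_integral_mono)
      fix z
      have "Q 0 / (Up - V 0) \<le> 1 / (Up - V z) * Q z" if "0 \<le> z" "z \<le> y"
        using Q_chord[OF that(1)] monoD[OF V_mono that(2)] Vy T by (simp add: field_simps)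
      thus "ennreal (Q 0 / (Up - V 0)) * indicator {0..y} z \<le> ennreal (1 / (Up - V z) * Q z * indicator {0..y} z)"
        by (auto simp: indicator_def intro: ennreal_leI)
    qed
    also have "\<dots> = (\<integral>\<^sup>+u. ennreal (1 / (Up - u) * E u * indicator {V 0..V y} u) \<partial>lborel)"
      by (rule change_of_variables[OF _ y0]) measurable
    also have "\<dots> = (\<integral>\<^sup>+u. ennreal (1 / (Up - u) * E u * indicator {V 0..V y} u) \<partial>lebesgue)"
      by (rule nn_integral_completion[symmetric])
    also have "\<dots> = ennreal J"
      unfolding J_eq by (rule nn_integral_eq_integral[OF i]) (use nn in auto)
    finally have "y * (Q 0 / (Up - V 0)) \<le> J" using \<open>J \<ge> 0\<close> by simp
    moreover have "I \<le> y * (Q 0 / (Up - V 0))" using y T Q0(2) by (simp add: field_simps)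
    ultimately show False using \<open>J < I\<close> by simp
  qed
qed

lemma extinction_left:
  assumes int: "set_integrable lebesgue {Um..V 0} (\<lambda>u. E u / (u - Um))"
  defines "I \<equiv> LINT u:{Um..V 0}|lebesgue. E u / (u - Um)"
  shows "0 < I" and "y \<le> - ((V 0 - Um) / Q 0) * I \<Longrightarrow> V y = Um"
proof -
  have eq: "(\<lambda>u. E (- u) / (- Um - u)) = (\<lambda>u. E (- u) / (- u - Um))"
    by (auto simp: algebra_simps)
  have int': "set_integrable lebesgue {- V (- 0)..- Um} (\<lambda>u. E (- u) / (- Um - u))"
    using int set_integrable_lebesgue_reflect(1)[of "V 0" Um "\<lambda>u. E u / (u - Um)"] unfolding eq by simp
  have I: "(LINT u:{- V (- 0)..- Um}|lebesgue. E (- u) / (- Um - u)) = I"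
    using set_integrable_lebesgue_reflect(2)[of "V 0" Um "\<lambda>u. E u / (u - Um)"] unfolding eq by (simp add: I_def)
  show "0 < I"
    using regular_profile.extinction_right(1)[OF regular_profile_reflect int'] unfolding I .
  show "V y = Um" if "y \<le> - ((V 0 - Um) / Q 0) * I"
    using regular_profile.extinction_right(2)[OF regular_profile_reflect int', of "- y"] that
    unfolding I Q_reflect by (simp add: algebra_simps)
qed

definition flux_const where
  "flux_const M \<theta> = sqrt (2 * M / (1 - \<theta>)) * ((Up - Um) / ((Up - V 0) powr \<theta> * (V 0 - Um) powr \<theta>))"

lemma flux_bound_nonneg_side:
  assumes E_le: "\<And>u. Um \<le> u \<Longrightarrow> u \<le> Up \<Longrightarrow> E u \<le> M"
    and \<theta>: "0 < \<theta>" "\<theta> < 1" and y: "0 \<le> y"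
  shows "Q y \<le> flux_const M \<theta> * ((Up - V y) powr \<theta> * (V y - Um) powr \<theta>)"
proof -
  define T where "T = Up - V 0"
  have T: "0 < T" "T \<le> Up - Um" using V0_less V0_greater by (auto simp: T_def)
  have m: "(V 0 - Um) powr \<theta> \<le> (V y - Um) powr \<theta>"
    using monoD[OF V_mono y] V0_greater \<theta> by (intro powr_mono2) auto
  have m0: "0 < (V 0 - Um) powr \<theta>" using V0_greater by simp
  have "0 \<le> 2 * M / (1 - \<theta>)" using M_pos[OF E_le] \<theta> by simp
  hence S: "0 \<le> sqrt (2 * M / (1 - \<theta>))" by simp
  have "T powr (1 - \<theta>) = T / T powr \<theta>" using T by (simp add: powr_diff)
  also have "\<dots> \<le> (Up - Um) / T powr \<theta>" using T by (intro divide_right_mono) auto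
  also have "\<dots> = (Up - Um) / (T powr \<theta> * (V 0 - Um) powr \<theta>) * (V 0 - Um) powr \<theta>" using m0 by simp
  also have "\<dots> \<le> (Up - Um) / (T powr \<theta> * (V 0 - Um) powr \<theta>) * (V y - Um) powr \<theta>"
    using m m0 T by (intro mult_left_mono) auto
  finally have *: "T powr (1 - \<theta>) \<le> (Up - Um) / (T powr \<theta> * (V 0 - Um) powr \<theta>) * (V y - Um) powr \<theta>" .
  have "Q y \<le> sqrt (2 * M / (1 - \<theta>)) * (T powr (1 - \<theta>) * (Up - V y) powr \<theta>)"
    unfolding T_def by (rule flux_bound_by_right_gap[OF E_le \<theta> y])
  also have "\<dots> \<le> sqrt (2 * M / (1 - \<theta>)) * ((Up - Um) / (T powr \<theta> * (V 0 - Um) powr \<theta>) * (V y - Um) powr \<theta> * (Up - V y) powr \<theta>)"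
    using * S by (intro mult_left_mono mult_right_mono) auto
  finally show ?thesis by (simp add: flux_const_def T_def mult_ac)
qed

lemma flux_bound:
  assumes E_le: "\<And>u. Um \<le> u \<Longrightarrow> u \<le> Up \<Longrightarrow> E u \<le> M" and \<theta>: "0 < \<theta>" "\<theta> < 1"
  shows "Q y \<le> flux_const M \<theta> * ((Up - V y) powr \<theta> * (V y - Um) powr \<theta>)"
proof (cases "0 \<le> y")
  case True
  show ?thesis by (rule flux_bound_nonneg_side[OF E_le \<theta> True])
next
  case False
  have "regular_profile.Q (\<lambda>y. - V (- y)) (\<lambda>y. X (- y)) (- y) \<le>
      regular_profile.flux_const (- Up) (- Um) (\<lambda>y. - V (- y)) M \<theta> *
      ((- Um - - V (- (- y))) powr \<theta> * (- V (- (- y)) - - Up) powr \<theta>)"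
    by (rule regular_profile.flux_bound_nonneg_side[OF regular_profile_reflect _ \<theta>])
      (use E_le False in auto)
  thus ?thesis
    unfolding Q_reflect regular_profile.flux_const_def[OF regular_profile_reflect] flux_const_def
    by (simp add: mult.commute add.commute)
qed

text \<open>
  One factor of \<open>|V'|\<^sup>p\<close> is kept as \<open>Q / E\<close> for the change of variables, and the flux bound is inserted in the
  other \<open>p - 1\<close>.
\<close>

lemma V'_powr_le:
  assumes E_le: "\<And>u. Um \<le> u \<Longrightarrow> u \<le> Up \<Longrightarrow> E u \<le> M" and \<theta>: "0 < \<theta>" "\<theta> < 1" and p: "1 \<le> p"
  shows "\<bar>V' y\<bar> powr p \<le> flux_const M \<theta> powr (p - 1) * C_tilde_integrand E Um Up p \<theta> (V y) / E (V y) * Q y"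
proof (cases "E (V y) = 0 \<or> Q y = 0")
  case True
  thus ?thesis by (auto simp: V'_def)
next
  case False
  have e: "0 < E (V y)" and q: "0 < Q y"
    using False E_nonneg[of "V y"] V_range[of y] Q_nonneg[of y] by (auto simp: less_le)
  define x where "x = (Up - V y) powr \<theta> * (V y - Um) powr \<theta>"
  have qx: "Q y \<le> flux_const M \<theta> * x" unfolding x_def by (rule flux_bound[OF E_le \<theta>])
  have x: "0 \<le> x" by (simp add: x_def)
  have "0 < flux_const M \<theta> * x" using qx q by linarith
  hence Kx: "0 < flux_const M \<theta>" "0 < x"
    using x zero_less_mult_pos2[of "flux_const M \<theta>" x] by (cases "x = 0"; auto)+
  have "\<bar>V' y\<bar> powr p = (Q y / E (V y)) powr (1 + (p - 1))" using e q by (simp add: V'_def)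
  also have "\<dots> = Q y / E (V y) * (Q y / E (V y)) powr (p - 1)"
    using e q by (simp only: powr_add) simp
  also have "\<dots> \<le> Q y / E (V y) * (flux_const M \<theta> * (x / E (V y))) powr (p - 1)"
    using e q p qx by (intro mult_left_mono powr_mono2) (auto simp: divide_right_mono)
  also have "\<dots> = Q y / E (V y) * (flux_const M \<theta> powr (p - 1) * (x / E (V y)) powr (p - 1))"
    using e Kx by (subst powr_mult) auto
  finally show ?thesis by (simp add: C_tilde_integrand_def x_def mult_ac)
qed

lemma V'_Lp_bound:
  assumes E_le: "\<And>u. Um \<le> u \<Longrightarrow> u \<le> Up \<Longrightarrow> E u \<le> M" and \<theta>: "0 < \<theta>" "\<theta> < 1" and p: "1 \<le> p"
    and int: "set_integrable lebesgue {Um..Up} (C_tilde_integrand E Um Up p \<theta>)"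
  shows "integrable lebesgue (\<lambda>y. \<bar>V' y\<bar> powr p)"
    "(LINT y|lebesgue. \<bar>V' y\<bar> powr p) \<le> flux_const M \<theta> powr (p - 1) * C_tilde E Um Up p \<theta>"
proof -
  define c where "c = flux_const M \<theta> powr (p - 1)"
  define f where "f = C_tilde_integrand E Um Up p \<theta>"
  have f0: "0 \<le> f u" for u by (simp add: f_def C_tilde_integrand_def)
  have [measurable]: "f \<in> borel_measurable borel"
    unfolding f_def C_tilde_integrand_def[abs_def] by measurable
  have C: "C_tilde E Um Up p \<theta> = (LINT u|lebesgue. f u * indicator {Um..Up} u)"
    by (simp add: C_tilde_def f_def set_lebesgue_integral_def mult.commute)
  have i: "integrable lebesgue (\<lambda>u. c * (f u * indicator {Um..Up} u))"
    using int by (simp add: f_def set_integrable_def mult.commute)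
  have C0: "0 \<le> c * C_tilde E Um Up p \<theta>"
    unfolding C c_def by (intro mult_nonneg_nonneg integral_nonneg_AE) (use f0 in auto)
  have part: "(\<integral>\<^sup>+y. ennreal (\<bar>V' y\<bar> powr p) * indicator {- real n..real n} y \<partial>lborel) \<le>
      ennreal (c * C_tilde E Um Up p \<theta>)" for n
  proof -
    have "(\<integral>\<^sup>+y. ennreal (\<bar>V' y\<bar> powr p) * indicator {- real n..real n} y \<partial>lborel) \<le>
        (\<integral>\<^sup>+y. ennreal (c * f (V y) / E (V y) * Q y * indicator {- real n..real n} y) \<partial>lborel)"
      by (intro nn_integral_mono)
        (use V'_powr_le[OF E_le \<theta> p] in \<open>auto simp: c_def f_def indicator_def intro: ennreal_leI\<close>)
    also have "\<dots> = (\<integral>\<^sup>+u. ennreal (c * f u / E u * E u * indicator {V (- real n)..V (real n)} u) \<partial>lborel)"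
      by (rule change_of_variables) auto
    also have "\<dots> \<le> (\<integral>\<^sup>+u. ennreal (c * (f u * indicator {Um..Up} u)) \<partial>lborel)"
    proof (intro nn_integral_mono ennreal_leI)
      fix u
      have "Um \<le> V (- real n)" "V (real n) \<le> Up" by (rule V_range)+
      thus "c * f u / E u * E u * indicator {V (- real n)..V (real n)} u \<le> c * (f u * indicator {Um..Up} u)"
        using f0[of u] by (auto simp: indicator_def c_def)
    qed
    also have "\<dots> = (\<integral>\<^sup>+u. ennreal (c * (f u * indicator {Um..Up} u)) \<partial>lebesgue)"
      by (rule nn_integral_completion[symmetric])
    also have "\<dots> = ennreal (LINT u|lebesgue. c * (f u * indicator {Um..Up} u))"
      by (rule nn_integral_eq_integral[OF i]) (use f0 in \<open>auto simp: c_def\<close>)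
    finally show ?thesis by (simp add: C)
  qed
  have "(\<integral>\<^sup>+y. ennreal (\<bar>V' y\<bar> powr p) \<partial>lborel) =
      (\<integral>\<^sup>+y. (SUP n. ennreal (\<bar>V' y\<bar> powr p) * indicator {- real n..real n} y) \<partial>lborel)"
  proof (intro nn_integral_cong antisym SUP_least)
    fix y
    obtain n where "\<bar>y\<bar> \<le> real n" using real_arch_simple by blast
    hence "y \<in> {- real n..real n}" by (auto simp: abs_le_iff)
    hence "ennreal (\<bar>V' y\<bar> powr p) = ennreal (\<bar>V' y\<bar> powr p) * indicator {- real n..real n} y" by simp
    also have "\<dots> \<le> (SUP n. ennreal (\<bar>V' y\<bar> powr p) * indicator {- real n..real n} y)"
      by (rule SUP_upper) simp
    finally show "ennreal (\<bar>V' y\<bar> powr p) \<le> (SUP n. ennreal (\<bar>V' y\<bar> powr p) * indicator {- real n..real n} y)" .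
  qed (auto simp: indicator_def)
  also have "\<dots> = (SUP n. \<integral>\<^sup>+y. ennreal (\<bar>V' y\<bar> powr p) * indicator {- real n..real n} y \<partial>lborel)"
    by (rule nn_integral_monotone_convergence_SUP)
      (auto simp: incseq_def le_fun_def indicator_def)
  also have "\<dots> \<le> ennreal (c * C_tilde E Um Up p \<theta>)"
    by (rule SUP_least) (rule part)
  finally have le: "(\<integral>\<^sup>+y. ennreal (\<bar>V' y\<bar> powr p) \<partial>lebesgue) \<le> ennreal (c * C_tilde E Um Up p \<theta>)"
    by (simp add: nn_integral_completion)
  have "(\<lambda>y. \<bar>V' y\<bar> powr p) \<in> borel_measurable lborel" by measurable
  hence m: "(\<lambda>y. \<bar>V' y\<bar> powr p) \<in> borel_measurable lebesgue" by (rule measurable_completion)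
  show 1: "integrable lebesgue (\<lambda>y. \<bar>V' y\<bar> powr p)"
    by (rule integrableI_nonneg[OF m]) (use le in \<open>auto simp: top.not_eq_extremum intro: order_le_less_trans\<close>)
  show "(LINT y|lebesgue. \<bar>V' y\<bar> powr p) \<le> flux_const M \<theta> powr (p - 1) * C_tilde E Um Up p \<theta>"
    using le C0 by (subst (asm) nn_integral_eq_integral[OF 1]) (auto simp: c_def)
qed

end

section \<open>The regular representative of the profile\<close>

lemma AE_closed_imp_all:
  fixes S :: "real set"
  assumes "closed S" "AE y in lebesgue. y \<in> S"
  shows "y \<in> S"
proof (rule ccontr)
  assume "y \<notin> S"
  have "- S \<in> null_sets lebesgue"
    using assms AE_iff_null_sets[of "- S" lebesgue] by (auto simp: borel_open open_Compl)
  moreover have "\<not> negligible (- S)"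
    using \<open>closed S\<close> \<open>y \<notin> S\<close> by (intro open_not_negligible) (auto simp: open_Compl)
  ultimately show False by (simp add: negligible_iff_null_sets)
qed

text \<open>
  \<open>W = A \<circ> U\<close> almost everywhere and \<open>U\<close> takes its values in \<open>[Um, Up]\<close>, so the continuous function \<open>W\<close> takes all its
  values in the compact image of this interval. There \<open>A\<close> has a continuous inverse, and \<open>V\<close> is its composition with
  \<open>W\<close>.
\<close>

lemma (in weak_profile) regular_representative:
  assumes A_deriv: "\<And>u. (A has_real_derivative E u) (at u)" and Ec: "continuous_on UNIV E"
    and E0: "\<And>u. 0 \<le> E u" and Epos: "AE u in lebesgue. u \<in> {Um..Up} \<longrightarrow> 0 < E u"
  obtains V where "AE y in lebesgue. U y = V y" "regular_profile Um Up A E V X"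
proof -
  have A_less: "A x < A y" if "Um \<le> x" "x < y" "y \<le> Up" for x y
    by (rule strict_mono_of_AE_pos_deriv[OF A_deriv E0 Epos that])
  have inj: "inj_on A {Um..Up}" by (rule linorder_inj_onI') (use A_less in force)
  have Ac: "continuous_on S A" for S
    using A_deriv by (auto intro!: continuous_at_imp_continuous_on DERIV_isCont)
  define B where "B = inv_into {Um..Up} A"
  have B: "B (A u) = u" if "u \<in> {Um..Up}" for u
    unfolding B_def using inj that by (rule inv_into_f_f)
  have Bc: "continuous_on (A ` {Um..Up}) B"
    by (rule continuous_on_inv[OF Ac]) (use B in auto)
  have Wc: "continuous_on S W" for S
    unfolding W_def[abs_def] using has_ac_deriv_continuous[OF Z] X_cont
    by (intro continuous_intros) (auto intro: continuous_on_subset)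
  have AW: "AE y in lebesgue. A (U y) = W y" using AU by (simp add: W_def)
  have "W y \<in> A ` {Um..Up}" for y
  proof -
    have "compact (A ` {Um..Up})" by (intro compact_continuous_image Ac compact_Icc)
    hence "closed (W -` (A ` {Um..Up}))"
      by (intro continuous_closed_vimage compact_imp_closed) (use Wc[of UNIV] in \<open>auto simp: continuous_on_eq_continuous_at\<close>)
    moreover have "AE y in lebesgue. y \<in> W -` (A ` {Um..Up})"
      using AW U_between
    proof eventually_elim
      fix y assume "A (U y) = W y" "U y \<in> {Um..Up}"
      thus "y \<in> W -` (A ` {Um..Up})" by (metis imageI vimageI2)
    qed
    ultimately show ?thesis using AE_closed_imp_all by blast
  qed
  note W_range = this
  define V where "V y = B (W y)" for y
  have AV: "A (V y) = W y" and Vr: "V y \<in> {Um..Up}" for y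
    using W_range[of y] B by (auto simp: V_def)
  have Vc: "continuous_on UNIV V"
    unfolding V_def by (rule continuous_on_compose2[OF Bc Wc]) (use W_range in auto)
  have UV: "AE y in lebesgue. U y = V y"
    using AW U_between by eventually_elim (metis B V_def)
  have X': "has_ac_deriv X V" by (rule has_ac_deriv_cong[OF X _ UV]) simp
  have Xd: "(X has_real_derivative V y) (at y)" for y
    by (rule has_ac_deriv_imp_DERIV[OF X' Vc])
  have Zd: "(Z has_real_derivative X y) (at y)" for y
    by (rule has_ac_deriv_imp_DERIV[OF Z X_cont])
  have conv: "convex_on UNIV X"
  proof (rule convex_on_linorderI)
    fix t x y :: real assume t: "0 < t" "t < 1" and xy: "x < y"
    define c where "c = (1 - t) * x + t * y"
    have c: "c - x = t * (y - x)" "y - c = (1 - t) * (y - x)" by (auto simp: c_def algebra_simps)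
    have "0 \<le> c - x" "0 \<le> y - c" unfolding c using t xy by auto
    hence "(y - x) * X c \<le> (y - c) * X x + (c - x) * X y" by (intro X_convex) (use xy in auto)
    hence "(y - x) * X c \<le> (y - x) * ((1 - t) * X x + t * X y)"
      unfolding c by (simp add: algebra_simps)
    thus "X ((1 - t) *\<^sub>R x + t *\<^sub>R y) \<le> (1 - t) * X x + t * X y"
      using xy by (simp add: c_def)
  qed auto
  have tangent: "V a * (b - a) \<le> X b - X a" for a b
    using convex_on_imp_above_tangent[OF conv connected_UNIV, of a b "V a"] Xd[of a] by simp
  have Vm: "mono V"
  proof (rule monoI)
    fix a b :: real assume "a \<le> b"
    show "V a \<le> V b"
    proof (cases "a = b")
      case False
      have "(V a - V b) * (b - a) \<le> 0" using tangent[of a b] tangent[of b a] by (simp add: algebra_simps)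
      thus ?thesis using False \<open>a \<le> b\<close> by (simp add: mult_le_0_iff)
    qed simp
  qed
  have "regular_profile Um Up A E V X"
  proof
    show "((\<lambda>y. A (V y)) has_real_derivative (X y - y * V y) / 2) (at y)" for y
      unfolding AV W_def
      by (rule derivative_eq_intros Zd Xd refl | simp add: field_simps)+
    show "\<exists>R\<ge>N. \<bar>X R - Up * R\<bar> < \<epsilon>" if "0 < \<epsilon>" for \<epsilon> N
      using near_right_asymptote[OF that, of N] by blast
    show "\<exists>R\<ge>N. \<bar>X (- R) + Um * R\<bar> < \<epsilon>" if "0 < \<epsilon>" for \<epsilon> N
      using weak_profile.near_right_asymptote[OF weak_profile_reflect that, of N] by auto
  qed (use Um_less_Up A_deriv Ec E0 Epos Vc Vm Vr Xd X0_pos in auto)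
  thus thesis using that UV by blast
qed

lemma primitive_cong:
  assumes "\<And>u. Um \<le> u \<Longrightarrow> u \<le> x \<Longrightarrow> D u = E u" "Um \<le> x"
  shows "primitive Um D x = primitive Um E x"
  unfolding primitive_def
proof (rule interval_integral_cong)
  fix u assume "u \<in> einterval (min (ereal Um) (ereal x)) (max (ereal Um) (ereal x))"
  moreover have "min (ereal Um) (ereal x) = ereal Um" "max (ereal Um) (ereal x) = ereal x"
    using assms(2) by (simp_all add: min_def max_def)
  ultimately have "Um < u" "u < x" by (simp_all add: einterval_iff)
  thus "D u = E u" by (intro assms(1)) simp_all
qed

theorem theorem3p5:
  fixes D U :: "real \<Rightarrow> real" and Um Up \<theta> p :: real
  assumes "Um < Up"
    and "continuous_on {Um..Up} D"
    and "\<forall>u\<in>{Um..Up}. 0 \<le> D u"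
    and "0 < \<theta>" "\<theta> < 1" "1 \<le> p"
    and "C_tilde_finite D Um Up p \<theta>"
    and "is_profile D Um Up U"
  shows "\<exists>V U' Q.
      continuous_on UNIV V \<and> (AE y in lebesgue. U y = V y) \<and>
      mono V \<and> range V \<subseteq> {Um..Up} \<and> Um < V 0 \<and> V 0 < Up \<and>
      weak_deriv V U' \<and>
      continuous_on UNIV Q \<and> weak_deriv (\<lambda>y. primitive Um D (V y)) Q \<and>
      (AE y in lebesgue. Q y = D (V y) * U' y) \<and> 0 < Q 0 \<and>
      in_Lp p U' \<and>
      Lp_norm p U' powr p \<le> C_hat D Um Up \<theta> (V 0) powr (p - 1) * C_tilde D Um Up p \<theta> \<and>
      (set_integrable lebesgue {V 0..Up} (\<lambda>s. D s / (Up - s)) \<longrightarrow>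
        (let y_plus = (Up - V 0) / Q 0 * (LINT u:{V 0..Up}|lebesgue. D u / (Up - u))
         in 0 < y_plus \<and> (\<forall>y\<ge>y_plus. V y = Up))) \<and>
      (set_integrable lebesgue {Um..V 0} (\<lambda>s. D s / (s - Um)) \<longrightarrow>
        (let y_minus = - ((V 0 - Um) / Q 0) * (LINT u:{Um..V 0}|lebesgue. D u / (u - Um))
         in y_minus < 0 \<and> (\<forall>y\<le>y_minus. V y = Um)))"
proof -
  have D_pos: "AE u in lebesgue. u \<in> {Um..Up} \<longrightarrow> 0 < D u"
    using assms(7) by (simp add: C_tilde_finite_def)
  obtain E c0 X Z where adm: "admissible_extension D Um Up E"
    and wp: "weak_profile Um Up c0 (primitive Um E) X U Z"
    using profile_weak_form[OF assms(1) D_pos assms(8)] by blast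
  have Ec: "continuous_on UNIV E" and E0: "\<And>u. 0 \<le> E u" and ED: "\<And>u. u \<in> {Um..Up} \<Longrightarrow> E u = D u"
    using adm by (auto simp: admissible_extension_def)
  have E_pos: "AE u in lebesgue. u \<in> {Um..Up} \<longrightarrow> 0 < E u"
    using D_pos by eventually_elim (auto simp: ED)
  obtain V where UV: "AE y in lebesgue. U y = V y"
    and "regular_profile Um Up (primitive Um E) E V X"
    using weak_profile.regular_representative[OF wp primitive_has_deriv[OF Ec] Ec E0 E_pos] by blast
  interpret regular_profile Um Up "primitive Um E" E V X by fact
  define M where "M = (SUP u\<in>{Um..Up}. D u)"
  have "bdd_above (D ` {Um..Up})"
    using assms(2) by (intro bounded_imp_bdd_above compact_imp_bounded compact_continuous_image) auto
  hence E_le: "E u \<le> M" if "Um \<le> u" "u \<le> Up" for u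
    using that unfolding M_def by (subst ED) (auto intro: cSUP_upper)
  have ci: "C_tilde_integrand E Um Up p \<theta> u = C_tilde_integrand D Um Up p \<theta> u" if "u \<in> {Um..Up}" for u
    using ED[OF that] by (simp add: C_tilde_integrand_def)
  have set_cong: "set_integrable lebesgue S f \<longleftrightarrow> set_integrable lebesgue S g"
    "(LINT u:S|lebesgue. f u) = (LINT u:S|lebesgue. g u)" if "\<And>u. u \<in> S \<Longrightarrow> f u = g u"
    for S and f g :: "real \<Rightarrow> real"
  proof -
    have "(\<lambda>u. indicat_real S u *\<^sub>R f u) = (\<lambda>u. indicat_real S u *\<^sub>R g u)"
      using that by (auto simp: indicator_def)
    thus "set_integrable lebesgue S f \<longleftrightarrow> set_integrable lebesgue S g"
      "(LINT u:S|lebesgue. f u) = (LINT u:S|lebesgue. g u)"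
      by (simp_all add: set_integrable_def set_lebesgue_integral_def)
  qed
  have int: "set_integrable lebesgue {Um..Up} (C_tilde_integrand E Um Up p \<theta>)"
    using assms(7) set_cong(1)[of "{Um..Up}" "C_tilde_integrand E Um Up p \<theta>"
      "C_tilde_integrand D Um Up p \<theta>"] ci by (simp add: C_tilde_finite_def)
  have Ct: "C_tilde E Um Up p \<theta> = C_tilde D Um Up p \<theta>"
    unfolding C_tilde_def by (rule set_cong(2)[OF ci])
  have Ch: "C_hat D Um Up \<theta> (V 0) = flux_const M \<theta>" by (simp add: C_hat_def flux_const_def M_def)
  note Lp = V'_Lp_bound[OF E_le assms(4,5,6) int]
  have Vm: "V' \<in> borel_measurable lebesgue" and Qm: "Q \<in> borel_measurable lebesgue"
    by (rule measurable_completion, simp)+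
  have "weak_deriv V V'" by (rule weak_deriv_if_has_ac_deriv[OF has_ac_deriv_V Vm])
  moreover have "weak_deriv (\<lambda>y. primitive Um D (V y)) Q"
  proof -
    have "primitive Um D (V y) = primitive Um E (V y)" for y
      by (rule primitive_cong) (use ED V_range[of y] in auto)
    moreover have "has_ac_deriv (\<lambda>y. primitive Um E (V y)) Q"
      by (rule has_ac_deriv_C1[OF _ Q_cont]) (use flux in \<open>simp add: Q_def\<close>)
    ultimately show ?thesis using weak_deriv_if_has_ac_deriv[OF _ Qm] by simp
  qed
  moreover have "AE y in lebesgue. Q y = D (V y) * V' y"
    using Q_eq by eventually_elim (use ED V_range in auto)
  moreover have "in_Lp p V'" using Lp(1) Vm by (simp add: in_Lp_def)
  moreover have "Lp_norm p V' powr p \<le> C_hat D Um Up \<theta> (V 0) powr (p - 1) * C_tilde D Um Up p \<theta>"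
  proof -
    have "0 \<le> (LINT y|lebesgue. \<bar>V' y\<bar> powr p)" by (rule integral_nonneg_AE) simp
    hence "Lp_norm p V' powr p = (LINT y|lebesgue. \<bar>V' y\<bar> powr p)"
      using assms(6) by (simp add: Lp_norm_def powr_powr)
    thus ?thesis using Lp(2) by (simp add: Ct Ch)
  qed
  moreover have "set_integrable lebesgue {V 0..Up} (\<lambda>s. D s / (Up - s)) \<longrightarrow>
        (let y_plus = (Up - V 0) / Q 0 * (LINT u:{V 0..Up}|lebesgue. D u / (Up - u))
         in 0 < y_plus \<and> (\<forall>y\<ge>y_plus. V y = Up))"
  proof -
    have eq: "D u / (Up - u) = E u / (Up - u)" if "u \<in> {V 0..Up}" for u
      using that V0_greater by (simp add: ED)
    have eqs: "set_integrable lebesgue {V 0..Up} (\<lambda>u. D u / (Up - u)) \<longleftrightarrow>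
        set_integrable lebesgue {V 0..Up} (\<lambda>u. E u / (Up - u))"
      "(LINT u:{V 0..Up}|lebesgue. D u / (Up - u)) = (LINT u:{V 0..Up}|lebesgue. E u / (Up - u))"
      by (rule set_cong, erule eq)+
    show ?thesis
      unfolding Let_def eqs
    proof (intro impI conjI allI)
      assume i: "set_integrable lebesgue {V 0..Up} (\<lambda>u. E u / (Up - u))"
      show "0 < (Up - V 0) / Q 0 * (LINT u:{V 0..Up}|lebesgue. E u / (Up - u))"
        using extinction_right(1)[OF i] V0_less Q0(2) by (intro mult_pos_pos divide_pos_pos) simp_all
      show "V y = Up" if "(Up - V 0) / Q 0 * (LINT u:{V 0..Up}|lebesgue. E u / (Up - u)) \<le> y" for y
        using that by (rule extinction_right(2)[OF i])
    qed
  qed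
  moreover have "set_integrable lebesgue {Um..V 0} (\<lambda>s. D s / (s - Um)) \<longrightarrow>
        (let y_minus = - ((V 0 - Um) / Q 0) * (LINT u:{Um..V 0}|lebesgue. D u / (u - Um))
         in y_minus < 0 \<and> (\<forall>y\<le>y_minus. V y = Um))"
  proof -
    have eq: "D u / (u - Um) = E u / (u - Um)" if "u \<in> {Um..V 0}" for u
      using that V0_less by (simp add: ED)
    have eqs: "set_integrable lebesgue {Um..V 0} (\<lambda>u. D u / (u - Um)) \<longleftrightarrow>
        set_integrable lebesgue {Um..V 0} (\<lambda>u. E u / (u - Um))"
      "(LINT u:{Um..V 0}|lebesgue. D u / (u - Um)) = (LINT u:{Um..V 0}|lebesgue. E u / (u - Um))"
      by (rule set_cong, erule eq)+
    show ?thesis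
      unfolding Let_def eqs
    proof (intro impI conjI allI)
      assume i: "set_integrable lebesgue {Um..V 0} (\<lambda>u. E u / (u - Um))"
      have "0 < (V 0 - Um) / Q 0" using V0_greater Q0(2) by simp
      thus "- ((V 0 - Um) / Q 0) * (LINT u:{Um..V 0}|lebesgue. E u / (u - Um)) < 0"
        using extinction_left(1)[OF i] by (intro mult_neg_pos) simp_all
      show "V y = Um" if "y \<le> - ((V 0 - Um) / Q 0) * (LINT u:{Um..V 0}|lebesgue. E u / (u - Um))" for y
        using that by (rule extinction_left(2)[OF i])
    qed
  qed
  moreover have "range V \<subseteq> {Um..Up}" using V_range by auto
  ultimately show ?thesis
    using UV V_cont V_mono V0_greater V0_less Q_cont[of UNIV] Q0(2)
    by - (rule exI[of _ V], rule exI[of _ V'], rule exI[of _ Q], (intro conjI; assumption))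
qed

end
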